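(* Let $S$ be a local ring, let $(x,y)$ be a pair of exact zero-divisors in $S$, and let $R=S/(x)$. Let $M$ and $N$ be $R$-modules such that $yN=0$. If there exists an integer $n\ge 2$ such that $\operatorname{Tor}^R_i(M,N)=0$ for $1\le i\le n$, then $\operatorname{Tor}^S_i(M,N)\cong M\otimes_S N$ for $0\le i\le n-1$. Consequently, if $M$ and $N$ are moreover nonzero and finitely generated, then $\operatorname{Tor}^S_i(M,N)\neq 0$ for $0\le i\le n-1$.
   Context: "Local ring" means commutative Noetherian local ring. A pair $(x,y)$ of elements of a local ring $S$ is a pair of exact zero-divisors if $x$ is nonzero, $x$ belongs to the maximal ideal of $S$, and $\operatorname{ann}_S(x)=(y)$ and $\operatorname{ann}_S(y)=(x)$. Every $R$-module is regarded as an $S$-module via the quotient map $S\to R$. Modules are not assumed finitely generated unless stated. *)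

theory Defs
  imports "HOL-Algebra.Ring_Divisibility" "HOL-Algebra.Module"
begin

section \<open>Local rings and exact zero-divisors\<close>

text \<open>
  Rings are those of \<^theory>\<open>HOL-Algebra.Ring\<close>. Having a unique maximal ideal forces a ring to
  be nonzero, because \<^locale>\<open>maximalideal\<close> requires properness.
\<close>

locale local_ring = cring R + noetherian_ring R for R (structure) +
  assumes unique_maximal: "\<exists>!m. maximalideal m R"

definition max_ideal :: "('a, 'k) ring_scheme \<Rightarrow> 'a set"
  where "max_ideal R = (THE m. maximalideal m R)"

definition ann :: "('a, 'k) ring_scheme \<Rightarrow> 'a \<Rightarrow> 'a set"
  where "ann R x = {s \<in> carrier R. s \<otimes>\<^bsub>R\<^esub> x = \<zero>\<^bsub>R\<^esub>}"

definition exact_zero_divisors :: "('a, 'k) ring_scheme \<Rightarrow> 'a \<Rightarrow> 'a \<Rightarrow> bool"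
  where "exact_zero_divisors R x y \<longleftrightarrow>
    x \<in> carrier R \<and> y \<in> carrier R \<and> x \<noteq> \<zero>\<^bsub>R\<^esub> \<and> x \<in> max_ideal R \<and>
    ann R x = PIdl\<^bsub>R\<^esub> y \<and> ann R y = PIdl\<^bsub>R\<^esub> x"


section \<open>Modules\<close>

definition module_hom ::
    "('a, 'k) ring_scheme \<Rightarrow> ('a, 'm, 'p) module_scheme \<Rightarrow> ('a, 'n, 'q) module_scheme \<Rightarrow> ('m \<Rightarrow> 'n) set"
  where "module_hom R M N = {f \<in> carrier M \<rightarrow> carrier N.
    (\<forall>u\<in>carrier M. \<forall>v\<in>carrier M. f (u \<oplus>\<^bsub>M\<^esub> v) = f u \<oplus>\<^bsub>N\<^esub> f v) \<and>
    (\<forall>r\<in>carrier R. \<forall>u\<in>carrier M. f (r \<odot>\<^bsub>M\<^esub> u) = r \<odot>\<^bsub>N\<^esub> f u)}"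

definition module_iso ::
    "('a, 'k) ring_scheme \<Rightarrow> ('a, 'm, 'p) module_scheme \<Rightarrow> ('a, 'n, 'q) module_scheme \<Rightarrow> bool"
  where "module_iso R M N \<longleftrightarrow> (\<exists>f\<in>module_hom R M N. bij_betw f (carrier M) (carrier N))"

definition zero_module :: "('a, 'm, 'p) module_scheme \<Rightarrow> bool"
  where "zero_module M \<longleftrightarrow> carrier M = {\<zero>\<^bsub>M\<^esub>}"

definition submodule_gen ::
    "('a, 'k) ring_scheme \<Rightarrow> ('a, 'm, 'p) module_scheme \<Rightarrow> 'm set \<Rightarrow> 'm set"
  where "submodule_gen R M A = \<Inter>{H. submodule H R M \<and> A \<subseteq> H}"

definition fin_gen_module :: "('a, 'k) ring_scheme \<Rightarrow> ('a, 'm, 'p) module_scheme \<Rightarrow> bool"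
  where "fin_gen_module R M \<longleftrightarrow>
    (\<exists>A. finite A \<and> A \<subseteq> carrier M \<and> submodule_gen R M A = carrier M)"

definition restrict_scalars :: "('s \<Rightarrow> 'r) \<Rightarrow> ('r, 'm, 'p) module_scheme \<Rightarrow> ('s, 'm) module"
  where "restrict_scalars \<phi> M =
    \<lparr>carrier = carrier M, mult = mult M, one = one M, zero = zero M, add = add M,
     smult = (\<lambda>s u. \<phi> s \<odot>\<^bsub>M\<^esub> u)\<rparr>"

text \<open>
  The record type \<^type>\<open>module_scheme\<close> extends rings, but \<^locale>\<open>module\<close> puts no condition on the
  fields \<open>mult\<close> and \<open>one\<close>; they are left unspecified below.
\<close>

definition quot_module :: "('a, 'm, 'p) module_scheme \<Rightarrow> 'm set \<Rightarrow> ('a, 'm set) module"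
  where "quot_module M H =
    \<lparr>carrier = a_rcosets\<^bsub>M\<^esub> H, mult = undefined, one = undefined, zero = H, add = set_add M,
     smult = (\<lambda>r X. \<Union>u\<in>X. H +>\<^bsub>M\<^esub> (r \<odot>\<^bsub>M\<^esub> u))\<rparr>"

text \<open>The free module on a set \<open>X\<close>: finitely supported functions from \<open>X\<close> to \<open>R\<close>, extended by zero.\<close>

definition free_module :: "('a, 'k) ring_scheme \<Rightarrow> 'x set \<Rightarrow> ('a, 'x \<Rightarrow> 'a) module"
  where "free_module R X =
    \<lparr>carrier = {f. (\<forall>x\<in>X. f x \<in> carrier R) \<and> (\<forall>x. x \<notin> X \<longrightarrow> f x = \<zero>\<^bsub>R\<^esub>) \<and> finite {x. f x \<noteq> \<zero>\<^bsub>R\<^esub>}},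
     mult = undefined, one = undefined, zero = (\<lambda>x. \<zero>\<^bsub>R\<^esub>), add = (\<lambda>f g x. f x \<oplus>\<^bsub>R\<^esub> g x),
     smult = (\<lambda>r f x. r \<otimes>\<^bsub>R\<^esub> f x)\<rparr>"

definition free_basis :: "('a, 'k) ring_scheme \<Rightarrow> 'x \<Rightarrow> 'x \<Rightarrow> 'a"
  where "free_basis R b = (\<lambda>x. if x = b then \<one>\<^bsub>R\<^esub> else \<zero>\<^bsub>R\<^esub>)"

text \<open>The linear map from a free module to \<open>M\<close> prescribed by \<open>g\<close> on the basis.\<close>

definition lin_ext ::
    "('a, 'k) ring_scheme \<Rightarrow> ('a, 'm, 'p) module_scheme \<Rightarrow> ('x \<Rightarrow> 'm) \<Rightarrow> ('x \<Rightarrow> 'a) \<Rightarrow> 'm"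
  where "lin_ext R M g f = (\<Oplus>\<^bsub>M\<^esub>x\<in>{x. f x \<noteq> \<zero>\<^bsub>R\<^esub>}. f x \<odot>\<^bsub>M\<^esub> g x)"


section \<open>Tensor products\<close>

definition tensor_rel ::
    "('a, 'k) ring_scheme \<Rightarrow> ('a, 'm, 'p) module_scheme \<Rightarrow> ('a, 'n, 'q) module_scheme
      \<Rightarrow> ('m \<times> 'n \<Rightarrow> 'a) set"
  where "tensor_rel R M N =
    (let F = free_module R (carrier M \<times> carrier N); e = free_basis R in
      {e (u \<oplus>\<^bsub>M\<^esub> u', v) \<ominus>\<^bsub>F\<^esub> (e (u, v) \<oplus>\<^bsub>F\<^esub> e (u', v)) | u u' v.
         u \<in> carrier M \<and> u' \<in> carrier M \<and> v \<in> carrier N} \<union>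
      {e (u, v \<oplus>\<^bsub>N\<^esub> v') \<ominus>\<^bsub>F\<^esub> (e (u, v) \<oplus>\<^bsub>F\<^esub> e (u, v')) | u v v'.
         u \<in> carrier M \<and> v \<in> carrier N \<and> v' \<in> carrier N} \<union>
      {e (r \<odot>\<^bsub>M\<^esub> u, v) \<ominus>\<^bsub>F\<^esub> r \<odot>\<^bsub>F\<^esub> e (u, v) | r u v.
         r \<in> carrier R \<and> u \<in> carrier M \<and> v \<in> carrier N} \<union>
      {e (u, r \<odot>\<^bsub>N\<^esub> v) \<ominus>\<^bsub>F\<^esub> r \<odot>\<^bsub>F\<^esub> e (u, v) | r u v.
         r \<in> carrier R \<and> u \<in> carrier M \<and> v \<in> carrier N})"

definition tensor_ker ::
    "('a, 'k) ring_scheme \<Rightarrow> ('a, 'm, 'p) module_scheme \<Rightarrow> ('a, 'n, 'q) module_scheme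
      \<Rightarrow> ('m \<times> 'n \<Rightarrow> 'a) set"
  where "tensor_ker R M N =
    submodule_gen R (free_module R (carrier M \<times> carrier N)) (tensor_rel R M N)"

definition tensor ::
    "('a, 'k) ring_scheme \<Rightarrow> ('a, 'm, 'p) module_scheme \<Rightarrow> ('a, 'n, 'q) module_scheme
      \<Rightarrow> ('a, ('m \<times> 'n \<Rightarrow> 'a) set) module"
  where "tensor R M N =
    quot_module (free_module R (carrier M \<times> carrier N)) (tensor_ker R M N)"

text \<open>
  The map from \<open>M \<otimes> N\<close> to \<open>M' \<otimes> N\<close> induced by \<open>f\<close> from \<open>M\<close> to \<open>M'\<close>. It is computed on representatives
  in the free module on \<open>M \<times> N\<close>; the union is over representatives that all give the same coset.
\<close>

definition tensor_map ::
    "('a, 'k) ring_scheme \<Rightarrow> ('a, 'm', 'p) module_scheme \<Rightarrow> ('a, 'n, 'q) module_scheme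
      \<Rightarrow> ('m \<Rightarrow> 'm') \<Rightarrow> ('m \<times> 'n \<Rightarrow> 'a) set \<Rightarrow> ('m' \<times> 'n \<Rightarrow> 'a) set"
  where "tensor_map R M' N f Z =
    (let F' = free_module R (carrier M' \<times> carrier N) in
      \<Union>z\<in>Z. tensor_ker R M' N +>\<^bsub>F'\<^esub> lin_ext R F' (\<lambda>(u, v). free_basis R (f u, v)) z)"


section \<open>Homology, free resolutions and Tor\<close>

text \<open>Homology of \<open>\<dots> \<rightarrow> C 2 \<rightarrow> C 1 \<rightarrow> C 0 \<rightarrow> 0\<close>, where \<open>d i\<close> goes from \<open>C (Suc i)\<close> to \<open>C i\<close>.\<close>

fun homology :: "(nat \<Rightarrow> ('a, 'c) module) \<Rightarrow> (nat \<Rightarrow> 'c \<Rightarrow> 'c) \<Rightarrow> nat \<Rightarrow> ('a, 'c set) module"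
  where
    "homology C d 0 = quot_module (C 0) (d 0 ` carrier (C (Suc 0)))"
  | "homology C d (Suc i) =
      quot_module ((C (Suc i))\<lparr>carrier := a_kernel (C (Suc i)) (C i) (d i)\<rparr>)
        (d (Suc i) ` carrier (C (Suc (Suc i))))"

text \<open>
  Tor is computed from a specific functorial free resolution of \<open>M\<close>; by the comparison theorem any
  other projective resolution gives the same modules up to isomorphism. Degree \<open>0\<close> is free on the
  elements of \<open>M\<close>, and degree \<open>n + 1\<close> is free on the presentations (lists of coefficients and basis
  elements) of elements of the kernel in degree \<open>n\<close>. As a kernel element has several presentations,
  this has more generators than needed, but all bases live in one datatype, so that a resolution of
  unbounded length can be typed. Exactness is proved in \<open>syz_resolution\<close> at the end of this theory.
\<close>

datatype ('a, 'm) syz = Gen 'm | Rel "('a \<times> ('a, 'm) syz) list"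

fun formal_sum :: "('a, 'k) ring_scheme \<Rightarrow> ('a \<times> 'x) list \<Rightarrow> 'x \<Rightarrow> 'a"
  where
    "formal_sum R [] = (\<lambda>x. \<zero>\<^bsub>R\<^esub>)"
  | "formal_sum R ((r, b) # l) = (\<lambda>x. r \<otimes>\<^bsub>R\<^esub> free_basis R b x \<oplus>\<^bsub>R\<^esub> formal_sum R l x)"

definition syz_aug ::
    "('a, 'k) ring_scheme \<Rightarrow> ('a, 'm, 'p) module_scheme \<Rightarrow> (('a, 'm) syz \<Rightarrow> 'a) \<Rightarrow> 'm"
  where "syz_aug R M = lin_ext R M (\<lambda>b. case b of Gen u \<Rightarrow> u | Rel l \<Rightarrow> \<zero>\<^bsub>M\<^esub>)"

definition syz_bd ::
    "('a, 'k) ring_scheme \<Rightarrow> (('a, 'm) syz \<Rightarrow> 'a) \<Rightarrow> (('a, 'm) syz \<Rightarrow> 'a)"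
  where "syz_bd R =
    lin_ext R (free_module R UNIV) (\<lambda>b. case b of Gen u \<Rightarrow> \<zero>\<^bsub>free_module R UNIV\<^esub> | Rel l \<Rightarrow> formal_sum R l)"

fun syz_basis ::
    "('a, 'k) ring_scheme \<Rightarrow> ('a, 'm, 'p) module_scheme \<Rightarrow> nat \<Rightarrow> ('a, 'm) syz set"
  where
    "syz_basis R M 0 = Gen ` carrier M"
  | "syz_basis R M (Suc n) =
      {Rel l | l. set l \<subseteq> carrier R \<times> syz_basis R M n \<and>
        (if n = 0 then syz_aug R M (formal_sum R l) = \<zero>\<^bsub>M\<^esub>
         else syz_bd R (formal_sum R l) = \<zero>\<^bsub>free_module R UNIV\<^esub>)}"

definition syz_module ::
    "('a, 'k) ring_scheme \<Rightarrow> ('a, 'm, 'p) module_scheme \<Rightarrow> nat \<Rightarrow> ('a, ('a, 'm) syz \<Rightarrow> 'a) module"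
  where "syz_module R M n = free_module R (syz_basis R M n)"

definition Tor ::
    "('a, 'k) ring_scheme \<Rightarrow> ('a, 'm, 'p) module_scheme \<Rightarrow> ('a, 'n, 'q) module_scheme \<Rightarrow> nat
      \<Rightarrow> ('a, ((('a, 'm) syz \<Rightarrow> 'a) \<times> 'n \<Rightarrow> 'a) set set) module"
  where "Tor R M N =
    homology (\<lambda>i. tensor R (syz_module R M i) N)
      (\<lambda>i. tensor_map R (syz_module R M i) N (syz_bd R))"

section \<open>The resolution used for Tor is a free resolution\<close>

lemma free_module_simps [simp]:
  "\<zero>\<^bsub>free_module R X\<^esub> = (\<lambda>x. \<zero>\<^bsub>R\<^esub>)"
  "f \<oplus>\<^bsub>free_module R X\<^esub> g = (\<lambda>x. f x \<oplus>\<^bsub>R\<^esub> g x)"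
  "r \<odot>\<^bsub>free_module R X\<^esub> f = (\<lambda>x. r \<otimes>\<^bsub>R\<^esub> f x)"
  by (simp_all add: free_module_def)

lemma free_module_carrier:
  "f \<in> carrier (free_module R X) \<longleftrightarrow>
    (\<forall>x\<in>X. f x \<in> carrier R) \<and> (\<forall>x. x \<notin> X \<longrightarrow> f x = \<zero>\<^bsub>R\<^esub>) \<and> finite {x. f x \<noteq> \<zero>\<^bsub>R\<^esub>}"
  by (simp add: free_module_def)

lemma (in cring) free_module_apply:
  "f \<in> carrier (free_module R X) \<Longrightarrow> f x \<in> carrier R"
  unfolding free_module_carrier by (cases "x \<in> X") auto

lemma (in cring) free_module_add_closed:
  assumes "f \<in> carrier (free_module R X)" "g \<in> carrier (free_module R X)"
  shows "(\<lambda>x. f x \<oplus> g x) \<in> carrier (free_module R X)"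
proof -
  have "{x. f x \<oplus> g x \<noteq> \<zero>} \<subseteq> {x. f x \<noteq> \<zero>} \<union> {x. g x \<noteq> \<zero>}"
    by auto
  with assms show ?thesis
    unfolding free_module_carrier by (auto intro: finite_subset)
qed

lemma (in cring) free_module_smult_closed:
  assumes "r \<in> carrier R" "f \<in> carrier (free_module R X)"
  shows "(\<lambda>x. r \<otimes> f x) \<in> carrier (free_module R X)"
proof -
  have "{x. r \<otimes> f x \<noteq> \<zero>} \<subseteq> {x. f x \<noteq> \<zero>}"
    using assms by auto
  with assms show ?thesis
    unfolding free_module_carrier by (auto intro: finite_subset)
qed

lemma (in cring) free_module_module: "module R (free_module R X)"
proof (rule moduleI)
  show "abelian_group (free_module R X)"
  proof (rule abelian_groupI)
    fix f assume f: "f \<in> carrier (free_module R X)"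
    show "\<exists>g\<in>carrier (free_module R X). g \<oplus>\<^bsub>free_module R X\<^esub> f = \<zero>\<^bsub>free_module R X\<^esub>"
      by (rule bexI[OF _ free_module_smult_closed[OF _ f, of "\<ominus> \<one>"]])
        (auto simp: free_module_apply[OF f] l_minus l_neg)
  next
    show "\<zero>\<^bsub>free_module R X\<^esub> \<in> carrier (free_module R X)"
      by (simp add: free_module_carrier)
  qed (auto simp: free_module_add_closed free_module_apply a_ac)
qed (auto simp: cring_axioms free_module_smult_closed free_module_apply l_distr r_distr m_assoc)

lemma (in cring) free_basis_closed:
  "b \<in> X \<Longrightarrow> free_basis R b \<in> carrier (free_module R X)"
  unfolding free_module_carrier free_basis_def
  by (auto intro: finite_subset[of _ "{b}"])

lemma (in cring) formal_sum_closed: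
  "set l \<subseteq> carrier R \<times> X \<Longrightarrow> formal_sum R l \<in> carrier (free_module R X)"
proof (induction l)
  case Nil
  then show ?case by (simp add: free_module_carrier)
next
  case (Cons a l)
  then show ?case
    by (cases a) (auto intro!: free_module_add_closed free_module_smult_closed free_basis_closed)
qed

lemma (in cring) formal_sum_surj:
  assumes f: "f \<in> carrier (free_module R X)"
  shows "\<exists>l. set l \<subseteq> carrier R \<times> X \<and> formal_sum R l = f"
proof -
  have "\<exists>l. set l \<subseteq> carrier R \<times> X \<and> formal_sum R l = f"
    if "finite A" "{x. f x \<noteq> \<zero>} \<subseteq> A" "f \<in> carrier (free_module R X)" for A f
    using that
  proof (induction A arbitrary: f rule: finite_induct)
    case empty
    then have "formal_sum R [] = f" by auto
    then show ?case by (intro exI[of _ "[]"]) simp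
  next
    case (insert a A)
    define g where "g = f(a := \<zero>)"
    have "g \<in> carrier (free_module R X)"
      using insert.prems unfolding g_def free_module_carrier
      by (auto intro: finite_subset[of _ "{x. f x \<noteq> \<zero>}"])
    moreover have "{x. g x \<noteq> \<zero>} \<subseteq> A"
      using insert.prems by (auto simp: g_def)
    ultimately obtain l where l: "set l \<subseteq> carrier R \<times> X" "formal_sum R l = g"
      using insert.IH by blast
    show ?case
    proof (cases "a \<in> X")
      case True
      have "formal_sum R ((f a, a) # l) = f"
        using free_module_apply[OF insert.prems(2)]
        by (auto simp: l g_def free_basis_def)
      then show ?thesis
        using l True free_module_apply[OF insert.prems(2)]
        by (intro exI[of _ "(f a, a) # l"]) auto
    next
      case False
      then have "g = f"
        using insert.prems unfolding g_def free_module_carrier by auto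
      with l show ?thesis by blast
    qed
  qed
  with f show ?thesis
    unfolding free_module_carrier by blast
qed

lemma (in module) lin_ext_superset:
  assumes f: "f \<in> carrier (free_module R X)" and g: "g \<in> X \<rightarrow> carrier M"
    and A: "finite A" "{x. f x \<noteq> \<zero>} \<subseteq> A" "A \<subseteq> X"
  shows "lin_ext R M g f = (\<Oplus>\<^bsub>M\<^esub>x\<in>A. f x \<odot>\<^bsub>M\<^esub> g x)"
  unfolding lin_ext_def
proof (rule M.add.finprod_mono_neutral_cong_left)
  show "f i \<odot>\<^bsub>M\<^esub> g i = \<zero>\<^bsub>M\<^esub>" if "i \<in> A - {x. f x \<noteq> \<zero>}" for i
    using that A(3) g by (auto simp: Pi_iff subset_iff)
  show "(\<lambda>x. f x \<odot>\<^bsub>M\<^esub> g x) \<in> A \<rightarrow> carrier M"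
    using A(3) g R.free_module_apply[OF f] by (auto simp: Pi_iff subset_iff)
qed (use A in auto)

lemma (in module) lin_ext_closed:
  assumes f: "f \<in> carrier (free_module R X)" and g: "g \<in> X \<rightarrow> carrier M"
  shows "lin_ext R M g f \<in> carrier M"
  unfolding lin_ext_def
  using g R.free_module_apply[OF f] f[unfolded free_module_carrier]
  by (intro M.finsum_closed) (fastforce simp: Pi_iff)

lemma (in module) lin_ext_hom:
  assumes g: "g \<in> X \<rightarrow> carrier M"
  shows "lin_ext R M g \<in> module_hom R (free_module R X) M"
proof -
  have gX: "g x \<in> carrier M" if "x \<in> X" for x using g that by auto
  have add: "lin_ext R M g (\<lambda>x. f x \<oplus> h x) = lin_ext R M g f \<oplus>\<^bsub>M\<^esub> lin_ext R M g h"
    if f: "f \<in> carrier (free_module R X)" and h: "h \<in> carrier (free_module R X)" for f h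
  proof -
    define A where "A = {x. f x \<noteq> \<zero>} \<union> {x. h x \<noteq> \<zero>}"
    have A: "finite A" "A \<subseteq> X" "{x. f x \<noteq> \<zero>} \<subseteq> A" "{x. h x \<noteq> \<zero>} \<subseteq> A"
        "{x. f x \<oplus> h x \<noteq> \<zero>} \<subseteq> A"
      using f h unfolding A_def free_module_carrier by auto
    have "(\<Oplus>\<^bsub>M\<^esub>x\<in>A. (f x \<oplus> h x) \<odot>\<^bsub>M\<^esub> g x) = (\<Oplus>\<^bsub>M\<^esub>x\<in>A. f x \<odot>\<^bsub>M\<^esub> g x \<oplus>\<^bsub>M\<^esub> h x \<odot>\<^bsub>M\<^esub> g x)"
      using A(2) gX R.free_module_apply[OF f] R.free_module_apply[OF h]
      by (intro M.finsum_cong') (auto simp: smult_l_distr subset_iff)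
    also have "\<dots> = (\<Oplus>\<^bsub>M\<^esub>x\<in>A. f x \<odot>\<^bsub>M\<^esub> g x) \<oplus>\<^bsub>M\<^esub> (\<Oplus>\<^bsub>M\<^esub>x\<in>A. h x \<odot>\<^bsub>M\<^esub> g x)"
      using A(2) gX R.free_module_apply[OF f] R.free_module_apply[OF h]
      by (intro M.finsum_addf) (auto simp: subset_iff)
    finally show ?thesis
      using A f h g R.free_module_add_closed[OF f h] by (simp add: lin_ext_superset)
  qed
  have smult: "lin_ext R M g (\<lambda>x. r \<otimes> f x) = r \<odot>\<^bsub>M\<^esub> lin_ext R M g f"
    if r: "r \<in> carrier R" and f: "f \<in> carrier (free_module R X)" for r f
  proof -
    define A where "A = {x. f x \<noteq> \<zero>}"
    have A: "finite A" "A \<subseteq> X" "{x. f x \<noteq> \<zero>} \<subseteq> A" "{x. r \<otimes> f x \<noteq> \<zero>} \<subseteq> A"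
      using f r unfolding A_def free_module_carrier by auto
    have "r \<odot>\<^bsub>M\<^esub> (\<Oplus>\<^bsub>M\<^esub>x\<in>A. f x \<odot>\<^bsub>M\<^esub> g x) = (\<Oplus>\<^bsub>M\<^esub>x\<in>A. r \<odot>\<^bsub>M\<^esub> (f x \<odot>\<^bsub>M\<^esub> g x))"
      using A(1,2) gX r R.free_module_apply[OF f]
      by (intro finsum_smult_ldistr) (auto simp: subset_iff)
    also have "\<dots> = (\<Oplus>\<^bsub>M\<^esub>x\<in>A. (r \<otimes> f x) \<odot>\<^bsub>M\<^esub> g x)"
      using A(2) gX r R.free_module_apply[OF f]
      by (intro M.finsum_cong') (auto simp: smult_assoc1 subset_iff)
    finally show ?thesis
      using A f g R.free_module_smult_closed[OF r f] by (simp add: lin_ext_superset)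
  qed
  show ?thesis
    unfolding module_hom_def by (simp add: lin_ext_closed[OF _ g] add smult)
qed

lemma (in module) lin_ext_basis:
  assumes g: "g \<in> X \<rightarrow> carrier M" and b: "b \<in> X"
  shows "lin_ext R M g (free_basis R b) = g b"
proof -
  have gb: "g b \<in> carrier M" using g b by auto
  have "lin_ext R M g (free_basis R b) = (\<Oplus>\<^bsub>M\<^esub>x\<in>{b}. free_basis R b x \<odot>\<^bsub>M\<^esub> g x)"
    using b by (intro lin_ext_superset[OF R.free_basis_closed[OF b] g]) (auto simp: free_basis_def)
  also have "\<dots> = g b"
    using gb by (simp add: free_basis_def)
  finally show ?thesis .
qed

lemma (in cring) finsum_free_module:
  assumes "finite A" "h \<in> A \<rightarrow> carrier (free_module R X)"
  shows "(\<Oplus>\<^bsub>free_module R X\<^esub>i\<in>A. h i) = (\<lambda>x. \<Oplus>i\<in>A. h i x)"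
proof -
  interpret F: module R "free_module R X" by (rule free_module_module)
  show ?thesis
    using assms
  proof (induction rule: finite_induct)
    case (insert a A)
    moreover have "(\<lambda>i. h i x) \<in> A \<rightarrow> carrier R" "h a x \<in> carrier R" for x
      using insert.prems free_module_apply by fastforce+
    ultimately show ?case
      by (auto simp: Pi_iff intro!: ext)
  qed simp
qed

lemma (in cring) lin_ext_free_mono:
  assumes f: "f \<in> carrier (free_module R X)" and g: "g \<in> X \<rightarrow> carrier (free_module R Y)"
  shows "lin_ext R (free_module R UNIV) g f = lin_ext R (free_module R Y) g f"
proof -
  have g': "g x \<in> carrier (free_module R Y)" if "f x \<noteq> \<zero>" for x
    using that f g unfolding free_module_carrier[of f] by blast
  have sub: "carrier (free_module R Y) \<subseteq> carrier (free_module R UNIV)"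
  proof
    fix h assume h: "h \<in> carrier (free_module R Y)"
    then show "h \<in> carrier (free_module R UNIV)"
      using free_module_apply[OF h] unfolding free_module_carrier by auto
  qed
  have fin: "finite {x. f x \<noteq> \<zero>}" using f unfolding free_module_carrier by simp
  have h: "(\<lambda>x. f x \<odot>\<^bsub>free_module R Y\<^esub> g x) \<in> {x. f x \<noteq> \<zero>} \<rightarrow> carrier (free_module R Y)"
    using free_module_smult_closed[OF free_module_apply[OF f] g'] by auto
  then have "(\<lambda>x. f x \<odot>\<^bsub>free_module R UNIV\<^esub> g x) \<in> {x. f x \<noteq> \<zero>} \<rightarrow> carrier (free_module R UNIV)"
    using sub by auto
  with h fin show ?thesis
    unfolding lin_ext_def by (simp add: finsum_free_module)
qed

lemma (in cring) formal_sum_Rel_closed: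
  assumes "b \<in> syz_basis R M (Suc n)"
  shows "(case b of Gen u \<Rightarrow> \<zero>\<^bsub>free_module R UNIV\<^esub> | Rel l \<Rightarrow> formal_sum R l)
    \<in> carrier (syz_module R M n)"
proof -
  obtain l where "b = Rel l" "set l \<subseteq> carrier R \<times> syz_basis R M n"
    using assms by auto
  then show ?thesis
    unfolding syz_module_def using formal_sum_closed[of l] by simp
qed

lemma (in cring) syz_bd_eq:
  assumes "f \<in> carrier (syz_module R M (Suc n))"
  shows "syz_bd R f = lin_ext R (syz_module R M n)
    (\<lambda>b. case b of Gen u \<Rightarrow> \<zero>\<^bsub>free_module R UNIV\<^esub> | Rel l \<Rightarrow> formal_sum R l) f"
  unfolding syz_bd_def syz_module_def
  by (rule lin_ext_free_mono[OF assms[unfolded syz_module_def]], rule Pi_I,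
      rule formal_sum_Rel_closed[unfolded syz_module_def])

lemma (in cring) syz_bd_hom:
  "syz_bd R \<in> module_hom R (syz_module R M (Suc n)) (syz_module R M n)"
proof -
  interpret F: module R "syz_module R M n"
    unfolding syz_module_def by (rule free_module_module)
  interpret F': module R "syz_module R M (Suc n)"
    unfolding syz_module_def by (rule free_module_module)
  have "lin_ext R (syz_module R M n)
      (\<lambda>b. case b of Gen u \<Rightarrow> \<zero>\<^bsub>free_module R UNIV\<^esub> | Rel l \<Rightarrow> formal_sum R l)
      \<in> module_hom R (syz_module R M (Suc n)) (syz_module R M n)"
    unfolding syz_module_def[of R M "Suc n"]
    using formal_sum_Rel_closed[of _ M n] by (intro F.lin_ext_hom) auto
  then show ?thesis
    unfolding module_hom_def
    by (simp add: Pi_iff syz_bd_eq[of _ M n] F'.smult_closed del: free_module_simps)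
qed

lemma (in module) syz_aug_hom:
  "syz_aug R M \<in> module_hom R (syz_module R M 0) M"
  unfolding syz_aug_def syz_module_def by (intro lin_ext_hom) auto

lemma (in module) syz_aug_surj:
  "syz_aug R M ` carrier (syz_module R M 0) = carrier M"
proof
  show "syz_aug R M ` carrier (syz_module R M 0) \<subseteq> carrier M"
    using syz_aug_hom unfolding module_hom_def by auto
  show "carrier M \<subseteq> syz_aug R M ` carrier (syz_module R M 0)"
  proof
    fix u assume u: "u \<in> carrier M"
    have "syz_aug R M (free_basis R (Gen u)) = u"
      unfolding syz_aug_def
      by (subst lin_ext_basis[where X = "syz_basis R M 0"]) (use u in auto)
    moreover have "free_basis R (Gen u) \<in> carrier (syz_module R M 0)"
      unfolding syz_module_def using u by (intro R.free_basis_closed) auto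
    ultimately show "u \<in> syz_aug R M ` carrier (syz_module R M 0)"
      by force
  qed
qed

lemma (in module) module_hom_kernel:
  assumes P: "module R P" and f: "f \<in> module_hom R P M"
  shows "submodule (a_kernel P M f) R P"
proof -
  interpret P: module R P by (rule P)
  have cl: "f u \<in> carrier M" if "u \<in> carrier P" for u
    using f that unfolding module_hom_def by auto
  have add: "f (u \<oplus>\<^bsub>P\<^esub> v) = f u \<oplus>\<^bsub>M\<^esub> f v" if "u \<in> carrier P" "v \<in> carrier P" for u v
    using f that unfolding module_hom_def by auto
  have sm: "f (r \<odot>\<^bsub>P\<^esub> u) = r \<odot>\<^bsub>M\<^esub> f u" if "r \<in> carrier R" "u \<in> carrier P" for r u
    using f that unfolding module_hom_def by auto
  have z: "f \<zero>\<^bsub>P\<^esub> = \<zero>\<^bsub>M\<^esub>"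
    using sm[of \<zero> "\<zero>\<^bsub>P\<^esub>"] cl[of "\<zero>\<^bsub>P\<^esub>"] by simp
  have inv: "\<ominus>\<^bsub>P\<^esub> u = (\<ominus> \<one>) \<odot>\<^bsub>P\<^esub> u" if "u \<in> carrier P" for u
    using P.smult_l_minus[of \<one> u] that by simp
  show ?thesis
    by (rule P.submoduleI) (auto simp: a_kernel_def' z add sm inv)
qed

text \<open>
  A linear map out of \<open>syz_module R M (Suc n)\<close> whose basis elements are sent to the formal sums they
  represent has as image the submodule \<open>K\<close> of which these are all the presentations.
\<close>

lemma (in cring) syz_bd_image:
  assumes K: "submodule K R (syz_module R M n)"
    and basis: "syz_basis R M (Suc n) =
      {Rel l | l. set l \<subseteq> carrier R \<times> syz_basis R M n \<and> formal_sum R l \<in> K}"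
  shows "syz_bd R ` carrier (syz_module R M (Suc n)) = K"
proof
  interpret F: module R "syz_module R M n"
    unfolding syz_module_def by (rule free_module_module)
  interpret F': module R "syz_module R M n\<lparr>carrier := K\<rparr>"
    by (rule submodule.submodule_is_module[OF K F.module_axioms])
  define g where "g = (\<lambda>b::('a, 'c) syz. case b of Gen u \<Rightarrow> \<zero>\<^bsub>free_module R UNIV\<^esub> | Rel l \<Rightarrow> formal_sum R l)"
  have gK: "g b \<in> K" if "b \<in> syz_basis R M (Suc n)" for b
    using that unfolding basis g_def by auto
  have KF: "K \<subseteq> carrier (syz_module R M n)" using F.submoduleE(1)[OF K] .
  show "syz_bd R ` carrier (syz_module R M (Suc n)) \<subseteq> K"
  proof safe
    fix f assume f: "f \<in> carrier (syz_module R M (Suc n))"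
    have fX: "f b \<in> carrier R" for b
      by (rule free_module_apply[OF f[unfolded syz_module_def]])
    have fin: "finite {b. f b \<noteq> \<zero>}" and sub: "{b. f b \<noteq> \<zero>} \<subseteq> syz_basis R M (Suc n)"
      using f unfolding syz_module_def free_module_carrier by blast+
    have "(\<Oplus>\<^bsub>syz_module R M n\<^esub>b\<in>A. f b \<odot>\<^bsub>syz_module R M n\<^esub> g b) \<in> K"
      if "finite A" "A \<subseteq> syz_basis R M (Suc n)" for A
      using that
    proof (induction rule: finite_induct)
      case empty
      then show ?case using F'.zero_closed by simp
    next
      case (insert a A)
      have 1: "f b \<odot>\<^bsub>syz_module R M n\<^esub> g b \<in> K" if "b \<in> insert a A" for b
        using that insert.prems gK fX F.submoduleE(4)[OF K] by blast
      then have "(\<Oplus>\<^bsub>syz_module R M n\<^esub>b\<in>insert a A. f b \<odot>\<^bsub>syz_module R M n\<^esub> g b) =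
          f a \<odot>\<^bsub>syz_module R M n\<^esub> g a \<oplus>\<^bsub>syz_module R M n\<^esub>
          (\<Oplus>\<^bsub>syz_module R M n\<^esub>b\<in>A. f b \<odot>\<^bsub>syz_module R M n\<^esub> g b)"
        using insert.hyps KF by (intro F.M.finsum_insert) auto
      then show ?case
        using 1 insert.IH insert.prems F.submoduleE(5)[OF K] by simp
    qed
    from this[OF fin sub] show "syz_bd R f \<in> K"
      unfolding syz_bd_eq[OF f] lin_ext_def g_def .
  qed
  show "K \<subseteq> syz_bd R ` carrier (syz_module R M (Suc n))"
  proof
    fix k assume k: "k \<in> K"
    then have "k \<in> carrier (free_module R (syz_basis R M n))"
      using KF unfolding syz_module_def by blast
    then obtain l where l: "set l \<subseteq> carrier R \<times> syz_basis R M n" "formal_sum R l = k"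
      using formal_sum_surj by blast
    have b: "Rel l \<in> syz_basis R M (Suc n)"
      unfolding basis using l k by blast
    then have e: "free_basis R (Rel l) \<in> carrier (syz_module R M (Suc n))"
      unfolding syz_module_def by (rule free_basis_closed)
    have "syz_bd R (free_basis R (Rel l)) = g (Rel l)"
      unfolding syz_bd_eq[OF e] g_def[symmetric]
      using gK KF b by (intro F.lin_ext_basis[where X = "syz_basis R M (Suc n)"]) auto
    with e l show "k \<in> syz_bd R ` carrier (syz_module R M (Suc n))"
      unfolding g_def by force
  qed
qed

theorem (in module) syz_resolution:
  shows "syz_aug R M \<in> module_hom R (syz_module R M 0) M"
    and "syz_aug R M ` carrier (syz_module R M 0) = carrier M"
    and "syz_bd R \<in> module_hom R (syz_module R M (Suc n)) (syz_module R M n)"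
    and "syz_bd R ` carrier (syz_module R M (Suc 0)) = a_kernel (syz_module R M 0) M (syz_aug R M)"
    and "syz_bd R ` carrier (syz_module R M (Suc (Suc n))) =
      a_kernel (syz_module R M (Suc n)) (syz_module R M n) (syz_bd R)"
proof -
  have mod: "module R (syz_module R M n)" for n
    unfolding syz_module_def by (rule R.free_module_module)
  show "syz_bd R ` carrier (syz_module R M (Suc 0)) = a_kernel (syz_module R M 0) M (syz_aug R M)"
  proof (rule R.syz_bd_image[OF module_hom_kernel[OF mod syz_aug_hom]])
    have "formal_sum R l \<in> carrier (syz_module R M 0)" if "set l \<subseteq> carrier R \<times> syz_basis R M 0" for l
      unfolding syz_module_def using R.formal_sum_closed[OF that] .
    then show "syz_basis R M (Suc 0) = {Rel l | l. set l \<subseteq> carrier R \<times> syz_basis R M 0 \<and>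
        formal_sum R l \<in> a_kernel (syz_module R M 0) M (syz_aug R M)}"
      by (auto simp: a_kernel_def')
  qed
  show "syz_bd R ` carrier (syz_module R M (Suc (Suc n))) =
      a_kernel (syz_module R M (Suc n)) (syz_module R M n) (syz_bd R)"
  proof (rule R.syz_bd_image[OF module.module_hom_kernel[OF mod mod R.syz_bd_hom]])
    have "formal_sum R l \<in> carrier (syz_module R M (Suc n))"
      if "set l \<subseteq> carrier R \<times> syz_basis R M (Suc n)" for l
      unfolding syz_module_def using R.formal_sum_closed[OF that] .
    moreover have "\<zero>\<^bsub>syz_module R M n\<^esub> = \<zero>\<^bsub>free_module R UNIV\<^esub>"
      by (simp add: syz_module_def)
    ultimately show "syz_basis R M (Suc (Suc n)) = {Rel l | l. set l \<subseteq> carrier R \<times> syz_basis R M (Suc n) \<and>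
        formal_sum R l \<in> a_kernel (syz_module R M (Suc n)) (syz_module R M n) (syz_bd R)}"
      unfolding a_kernel_def' syz_basis.simps(2)[of R M "Suc n"]
      by (auto simp del: free_module_simps syz_basis.simps)
  qed
qed (rule syz_aug_hom syz_aug_surj R.syz_bd_hom)+

end

theory Submission
  imports Defs
begin

text \<open>
  Let \<open>F\<close> be a free resolution of \<open>M\<close> over \<open>R\<close>, with basis \<open>B p\<close> in degree \<open>p\<close>. As \<open>(x, y)\<close> is a pair
  of exact zero-divisors, \<open>R\<close> has over \<open>S\<close> the periodic resolution
  \<open>\<dots> \<rightarrow> S \<rightarrow> S \<rightarrow> S\<close> with differentials multiplication by \<open>x\<close>, by \<open>y\<close>, by \<open>x\<close>, and so on. Replacing
  each copy of \<open>R\<close> in \<open>F\<close> by this resolution gives free modules over \<open>S\<close> with bases consisting of the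
  triples \<open>(p, q, b)\<close> with \<open>b \<in> B p\<close>, in total degree \<open>p + q\<close>. They carry a differential whose component
  from \<open>(p, q)\<close> to \<open>(p, q - 1)\<close> is multiplication by \<open>x\<close> or \<open>y\<close>, and whose component to \<open>(p - 1, q)\<close> is,
  up to sign, a lift \<open>\<Delta>\<close> of the differential of \<open>F\<close>. The square of \<open>\<Delta>\<close> is only divisible by \<open>x\<close>, so there
  are further components, to bidegrees with smaller \<open>p\<close>. They are constructed by recursion on
  the degree (\<open>matrix_exists\<close>), and since only the two leading components matter for exactness, the
  result is a free resolution of \<open>M\<close> over \<open>S\<close> (\<open>total_free_resolution\<close>). Both facts rest on
  \<open>cycle_is_boundary\<close>.

  Now take coefficients in \<open>N\<close>. Both \<open>x\<close> and \<open>y\<close> act as zero, so the leading component of the differential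
  is that of \<open>F\<close> with coefficients in \<open>N\<close>, which is exact in degrees \<open>1, \<dots>, n\<close> by the vanishing of Tor
  over \<open>R\<close>. Hence the component of a cycle with the largest \<open>p\<close> can be removed modulo boundaries as long
  as \<open>1 \<le> p \<le> n\<close>. For \<open>i < n\<close> it follows that every cycle of degree \<open>i\<close> is homologous to one in bidegree
  \<open>(0, i)\<close>, and that the boundaries in this bidegree come from \<open>(1, i)\<close>. So the homology in degree
  \<open>i\<close> is the cokernel of the first differential of \<open>F\<close> with coefficients in \<open>N\<close>
  (\<open>homology_iso_cokernel\<close>). This cokernel does not depend on \<open>i\<close>, and the homology in degree \<open>0\<close> is the
  tensor product of \<open>M\<close> and \<open>N\<close> over \<open>S\<close> (\<open>homology_zero_iso_tensor\<close>).

  It remains to know that Tor, which is defined by another resolution, can be computed from this one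
  (\<open>homology_iso\<close>). To this end tensor products with free modules are written as modules of vectors
  with entries in \<open>N\<close> (\<open>Tor_iso\<close>), on which matrices over the ring act.

  Finally, a nonzero finitely generated module over a local ring maps onto the residue field
  (\<open>residue_surjection\<close>). The product of two such maps is a nonzero bilinear form, so the tensor product
  of two such modules is not zero (\<open>tensor_nonzero\<close>).
\<close>


section \<open>Homomorphisms and quotients of modules\<close>

lemma (in abelian_group) minus_eq_zero_iff:
  assumes "u \<in> carrier G" "v \<in> carrier G"
  shows "u \<ominus> v = \<zero> \<longleftrightarrow> u = v"
  unfolding a_minus_def using assms
  by (metis a_inv_closed add.inv_equality minus_minus r_neg)

lemma (in abelian_group) minus_add_cancel:
  assumes "u \<in> carrier G" "v \<in> carrier G"
  shows "v \<oplus> (u \<ominus> v) = u"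
  unfolding a_minus_def using assms by (metis a_assoc a_comm a_inv_closed r_neg2)

lemma (in abelian_group) minus_unique:
  assumes "u = v \<oplus> w" "v \<in> carrier G" "w \<in> carrier G"
  shows "w = u \<ominus> v"
  unfolding a_minus_def assms(1) using assms(2,3) by (metis a_comm a_closed a_inv_closed r_neg1)

lemma (in abelian_group) add_eq_self:
  assumes "u \<oplus> v = u" "u \<in> carrier G" "v \<in> carrier G"
  shows "v = \<zero>"
  using minus_unique[OF assms(1)[symmetric] assms(2,3)] minus_eq_zero_iff[OF assms(2,2)] by simp

lemma module_homI:
  assumes "\<And>u. u \<in> carrier M \<Longrightarrow> f u \<in> carrier N"
    and "\<And>u v. u \<in> carrier M \<Longrightarrow> v \<in> carrier M \<Longrightarrow> f (u \<oplus>\<^bsub>M\<^esub> v) = f u \<oplus>\<^bsub>N\<^esub> f v"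
    and "\<And>r u. r \<in> carrier R \<Longrightarrow> u \<in> carrier M \<Longrightarrow> f (r \<odot>\<^bsub>M\<^esub> u) = r \<odot>\<^bsub>N\<^esub> f u"
  shows "f \<in> module_hom R M N"
  using assms by (simp add: module_hom_def)

lemma module_homD:
  assumes "f \<in> module_hom R M N"
  shows "u \<in> carrier M \<Longrightarrow> f u \<in> carrier N"
    and "u \<in> carrier M \<Longrightarrow> v \<in> carrier M \<Longrightarrow> f (u \<oplus>\<^bsub>M\<^esub> v) = f u \<oplus>\<^bsub>N\<^esub> f v"
    and "r \<in> carrier R \<Longrightarrow> u \<in> carrier M \<Longrightarrow> f (r \<odot>\<^bsub>M\<^esub> u) = r \<odot>\<^bsub>N\<^esub> f u"
  using assms by (auto simp: module_hom_def)

lemma module_hom_comp: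
  assumes "f \<in> module_hom R L M" "g \<in> module_hom R M N"
  shows "(\<lambda>u. g (f u)) \<in> module_hom R L N"
  using module_homD[OF assms(1)] module_homD[OF assms(2)] by (intro module_homI) auto

lemma module_hom_zero:
  assumes "module R M" "module R N" "f \<in> module_hom R M N"
  shows "f \<zero>\<^bsub>M\<^esub> = \<zero>\<^bsub>N\<^esub>"
proof -
  interpret M: module R M by fact
  interpret N: module R N by fact
  have "f (\<zero>\<^bsub>R\<^esub> \<odot>\<^bsub>M\<^esub> \<zero>\<^bsub>M\<^esub>) = \<zero>\<^bsub>R\<^esub> \<odot>\<^bsub>N\<^esub> f \<zero>\<^bsub>M\<^esub>"
    by (rule module_homD[OF assms(3)]) auto
  then show ?thesis using module_homD(1)[OF assms(3), of "\<zero>\<^bsub>M\<^esub>"] by simp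
qed

lemma module_hom_a_inv:
  assumes "module R M" "module R N" "f \<in> module_hom R M N" "u \<in> carrier M"
  shows "f (\<ominus>\<^bsub>M\<^esub> u) = \<ominus>\<^bsub>N\<^esub> f u"
proof -
  interpret M: module R M by fact
  interpret N: module R N by fact
  have "f (\<ominus>\<^bsub>M\<^esub> u) \<oplus>\<^bsub>N\<^esub> f u = f (\<ominus>\<^bsub>M\<^esub> u \<oplus>\<^bsub>M\<^esub> u)"
    using assms(4) by (simp add: module_homD(2)[OF assms(3)])
  also have "\<dots> = \<zero>\<^bsub>N\<^esub>"
    using assms(4) module_hom_zero[OF assms(1-3)] by (simp add: M.l_neg)
  finally show ?thesis
    using assms(4) module_homD(1)[OF assms(3)] by (metis M.a_inv_closed N.add.inv_equality)
qed

lemma module_hom_minus: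
  assumes "module R M" "module R N" "f \<in> module_hom R M N" "u \<in> carrier M" "v \<in> carrier M"
  shows "f (u \<ominus>\<^bsub>M\<^esub> v) = f u \<ominus>\<^bsub>N\<^esub> f v"
proof -
  interpret M: module R M by fact
  show ?thesis
    unfolding a_minus_def using assms(4,5)
    by (simp add: module_homD(2)[OF assms(3)] module_hom_a_inv[OF assms(1-3)])
qed

lemma module_iso_trans:
  assumes "module_iso R L M" "module_iso R M N"
  shows "module_iso R L N"
proof -
  obtain f g where f: "f \<in> module_hom R L M" "bij_betw f (carrier L) (carrier M)"
    and g: "g \<in> module_hom R M N" "bij_betw g (carrier M) (carrier N)"
    using assms unfolding module_iso_def by auto
  have "(\<lambda>u. g (f u)) \<in> module_hom R L N" by (rule module_hom_comp[OF f(1) g(1)])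
  moreover have "bij_betw (\<lambda>u. g (f u)) (carrier L) (carrier N)"
    using bij_betw_trans[OF f(2) g(2)] by (simp add: comp_def)
  ultimately show ?thesis unfolding module_iso_def by blast
qed

lemma module_iso_sym:
  assumes "module R L" "module R M" "module_iso R L M"
  shows "module_iso R M L"
proof -
  interpret L: module R L by fact
  interpret M: module R M by fact
  obtain f where f: "f \<in> module_hom R L M" and b: "bij_betw f (carrier L) (carrier M)"
    using assms unfolding module_iso_def by auto
  define g where "g = the_inv_into (carrier L) f"
  have inj: "inj_on f (carrier L)" using b by (rule bij_betw_imp_inj_on)
  have bg: "bij_betw g (carrier M) (carrier L)"
    unfolding g_def by (rule bij_betw_the_inv_into[OF b])
  have gc: "g u \<in> carrier L" if "u \<in> carrier M" for u using bg that by (rule bij_betw_apply)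
  have fg: "f (g u) = u" if "u \<in> carrier M" for u
    unfolding g_def using f_the_inv_into_f_bij_betw[OF b] that by blast
  have eq: "g u = w" if "u \<in> carrier M" "w \<in> carrier L" "f w = u" for u w
    using inj_onD[OF inj, of "g u" w] that gc fg by auto
  have "g \<in> module_hom R M L"
    using gc fg module_homD[OF f] by (intro module_homI eq) auto
  with bg show ?thesis unfolding module_iso_def by blast
qed

lemma zero_module_iso:
  assumes "module R L" "module R M" "module_iso R L M"
  shows "zero_module L \<longleftrightarrow> zero_module M"
proof -
  obtain f where f: "f \<in> module_hom R L M" and b: "bij_betw f (carrier L) (carrier M)"
    using assms unfolding module_iso_def by auto
  interpret L: module R L by fact
  interpret M: module R M by fact
  have im: "f ` carrier L = carrier M" and inj: "inj_on f (carrier L)"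
    using b by (auto simp: bij_betw_def)
  have z: "f \<zero>\<^bsub>L\<^esub> = \<zero>\<^bsub>M\<^esub>" by (rule module_hom_zero[OF assms(1,2) f])
  have "carrier L = {\<zero>\<^bsub>L\<^esub>}" if "carrier M = {\<zero>\<^bsub>M\<^esub>}"
  proof -
    have "u = \<zero>\<^bsub>L\<^esub>" if "u \<in> carrier L" for u
    proof (rule inj_onD[OF inj])
      show "f u = f \<zero>\<^bsub>L\<^esub>" using im z that \<open>carrier M = _\<close> by auto
    qed (use that in auto)
    then show ?thesis by auto
  qed
  then show ?thesis unfolding zero_module_def using im z by auto
qed

lemma module_hom_image_submodule:
  assumes "module R M" "module R N" "f \<in> module_hom R M N"
  shows "submodule (f ` carrier M) R N"
proof -
  interpret M: module R M by fact
  interpret N: module R N by fact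
  show ?thesis
  proof (rule N.submoduleI)
    show "f ` carrier M \<subseteq> carrier N" using module_homD(1)[OF assms(3)] by auto
    show "\<zero>\<^bsub>N\<^esub> \<in> f ` carrier M"
      using module_hom_zero[OF assms] by (metis M.zero_closed image_eqI)
  next
    fix a assume "a \<in> f ` carrier M"
    then show "\<ominus>\<^bsub>N\<^esub> a \<in> f ` carrier M"
      using module_hom_a_inv[OF assms] by (auto intro!: image_eqI[where x = "\<ominus>\<^bsub>M\<^esub> u" for u])
  next
    fix a b assume "a \<in> f ` carrier M" "b \<in> f ` carrier M"
    then obtain u v where "u \<in> carrier M" "v \<in> carrier M" "a = f u" "b = f v" by auto
    then show "a \<oplus>\<^bsub>N\<^esub> b \<in> f ` carrier M"
      using module_homD(2)[OF assms(3), of u v] by (metis M.a_closed image_eqI)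
  next
    fix r a assume "r \<in> carrier R" "a \<in> f ` carrier M"
    then obtain u where "u \<in> carrier M" "a = f u" by auto
    then show "r \<odot>\<^bsub>N\<^esub> a \<in> f ` carrier M"
      using module_homD(3)[OF assms(3) \<open>r \<in> carrier R\<close>, of u] M.smult_closed[OF \<open>r \<in> carrier R\<close>, of u]
      by (metis image_eqI)
  qed
qed

context module
begin

lemma submodule_abelian_subgroup:
  assumes "submodule H R M" shows "abelian_subgroup H M"
  by (rule abelian_subgroupI3)
    (use assms in \<open>auto intro: additive_subgroupI submodule.axioms(1) abelian_group_axioms\<close>)

lemma quot_eq_iff:
  assumes H: "submodule H R M" and "a \<in> carrier M" "b \<in> carrier M"
  shows "H +>\<^bsub>M\<^esub> a = H +>\<^bsub>M\<^esub> b \<longleftrightarrow> (\<exists>h\<in>H. a = h \<oplus>\<^bsub>M\<^esub> b)"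
proof
  interpret H: abelian_subgroup H M by (rule submodule_abelian_subgroup[OF H])
  assume "H +>\<^bsub>M\<^esub> a = H +>\<^bsub>M\<^esub> b"
  then have "a \<in> H +>\<^bsub>M\<^esub> b" using H.a_rcos_self[OF assms(2)] by auto
  then show "\<exists>h\<in>H. a = h \<oplus>\<^bsub>M\<^esub> b" by (auto simp: a_r_coset_def')
next
  assume "\<exists>h\<in>H. a = h \<oplus>\<^bsub>M\<^esub> b"
  then have "a \<in> H +>\<^bsub>M\<^esub> b" by (auto simp: a_r_coset_def')
  from M.a_repr_independence[OF this assms(3) submodule.axioms(1)[OF H]]
  show "H +>\<^bsub>M\<^esub> a = H +>\<^bsub>M\<^esub> b" by simp
qed

lemma quot_smult:
  assumes H: "submodule H R M" and r: "r \<in> carrier R" and a: "a \<in> carrier M"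
  shows "(\<Union>u\<in>H +>\<^bsub>M\<^esub> a. H +>\<^bsub>M\<^esub> (r \<odot>\<^bsub>M\<^esub> u)) = H +>\<^bsub>M\<^esub> (r \<odot>\<^bsub>M\<^esub> a)"
proof -
  interpret H: abelian_subgroup H M by (rule submodule_abelian_subgroup[OF H])
  have "H +>\<^bsub>M\<^esub> (r \<odot>\<^bsub>M\<^esub> u) = H +>\<^bsub>M\<^esub> (r \<odot>\<^bsub>M\<^esub> a)" if u: "u \<in> H +>\<^bsub>M\<^esub> a" for u
  proof -
    obtain h where h: "h \<in> H" "u = h \<oplus>\<^bsub>M\<^esub> a" using u by (auto simp: a_r_coset_def')
    then have "h \<in> carrier M" using H.a_subset by auto
    with h a r have "r \<odot>\<^bsub>M\<^esub> u = r \<odot>\<^bsub>M\<^esub> h \<oplus>\<^bsub>M\<^esub> r \<odot>\<^bsub>M\<^esub> a" "r \<odot>\<^bsub>M\<^esub> u \<in> carrier M"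
      by (auto simp: smult_r_distr)
    then show ?thesis
      using quot_eq_iff[OF H, of "r \<odot>\<^bsub>M\<^esub> u" "r \<odot>\<^bsub>M\<^esub> a"] submoduleE(4)[OF H r h(1)] a r by auto
  qed
  moreover have "H +>\<^bsub>M\<^esub> a \<noteq> {}" using H.a_rcos_self[OF a] by auto
  ultimately show ?thesis by auto
qed

lemma quot_carrier: "carrier (quot_module M H) = (\<lambda>a. H +>\<^bsub>M\<^esub> a) ` carrier M"
  by (auto simp: quot_module_def A_RCOSETS_def')

lemma quot_proj_hom:
  assumes H: "submodule H R M"
  shows "(\<lambda>a. H +>\<^bsub>M\<^esub> a) \<in> module_hom R M (quot_module M H)"
proof -
  interpret H: abelian_subgroup H M by (rule submodule_abelian_subgroup[OF H])
  show ?thesis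
    by (rule module_homI) (auto simp: quot_smult[OF H] quot_module_def H.a_rcos_sum A_RCOSETS_def')
qed

lemma quot_module_module:
  assumes H: "submodule H R M"
  shows "module R (quot_module M H)"
proof -
  interpret H: abelian_subgroup H M by (rule submodule_abelian_subgroup[OF H])
  let ?Q = "quot_module M H"
  note q = module_homD[OF quot_proj_hom[OF H]]
  have ex: "\<exists>a\<in>carrier M. X = H +>\<^bsub>M\<^esub> a" if "X \<in> carrier ?Q" for X
    using that by (auto simp: quot_carrier)
  have z: "\<zero>\<^bsub>?Q\<^esub> = H +>\<^bsub>M\<^esub> \<zero>\<^bsub>M\<^esub>"
    using H.a_subset by (simp add: quot_module_def)
  show ?thesis
  proof (rule moduleI)
    show "abelian_group ?Q"
    proof (rule abelian_groupI)
      fix X assume "X \<in> carrier ?Q"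
      then obtain a where a: "a \<in> carrier M" "X = H +>\<^bsub>M\<^esub> a" using ex by blast
      have "(H +>\<^bsub>M\<^esub> (\<ominus>\<^bsub>M\<^esub> a)) \<oplus>\<^bsub>?Q\<^esub> X = \<zero>\<^bsub>?Q\<^esub>"
        using a by (simp add: q(2)[symmetric] z M.l_neg del: H.a_rcos_sum)
      then show "\<exists>Y\<in>carrier ?Q. Y \<oplus>\<^bsub>?Q\<^esub> X = \<zero>\<^bsub>?Q\<^esub>" using a q(1) by blast
    qed (use q in \<open>auto simp: z q(2)[symmetric] M.a_ac dest!: ex\<close>)
  qed (use q in \<open>auto simp: q(2,3)[symmetric] smult_l_distr smult_r_distr smult_assoc1 R.is_cring dest!: ex\<close>)
qed

lemma quot_eq_zero_iff:
  assumes H: "submodule H R M" and a: "a \<in> carrier M"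
  shows "H +>\<^bsub>M\<^esub> a = \<zero>\<^bsub>quot_module M H\<^esub> \<longleftrightarrow> a \<in> H"
proof -
  interpret H: abelian_subgroup H M by (rule submodule_abelian_subgroup[OF H])
  have "\<zero>\<^bsub>quot_module M H\<^esub> = H +>\<^bsub>M\<^esub> \<zero>\<^bsub>M\<^esub>"
    using H.a_subset by (simp add: quot_module_def)
  then show ?thesis using quot_eq_iff[OF H a M.zero_closed] H.a_subset by auto
qed

lemma quot_lift:
  assumes H: "submodule H R M" and W: "module R W" and f: "f \<in> module_hom R M W"
    and 0: "\<And>h. h \<in> H \<Longrightarrow> f h = \<zero>\<^bsub>W\<^esub>"
  obtains F where "F \<in> module_hom R (quot_module M H) W"
    and "\<And>a. a \<in> carrier M \<Longrightarrow> F (H +>\<^bsub>M\<^esub> a) = f a"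
proof -
  interpret W: module R W by fact
  interpret H: abelian_subgroup H M by (rule submodule_abelian_subgroup[OF H])
  define F where "F = (\<lambda>X. f (SOME a. a \<in> carrier M \<and> X = H +>\<^bsub>M\<^esub> a))"
  have F: "F (H +>\<^bsub>M\<^esub> a) = f a" if a: "a \<in> carrier M" for a
  proof -
    let ?b = "SOME b. b \<in> carrier M \<and> H +>\<^bsub>M\<^esub> a = H +>\<^bsub>M\<^esub> b"
    have b: "?b \<in> carrier M \<and> H +>\<^bsub>M\<^esub> a = H +>\<^bsub>M\<^esub> ?b"
      by (rule someI_ex) (use a in blast)
    then obtain h where h: "h \<in> H" "a = h \<oplus>\<^bsub>M\<^esub> ?b" using quot_eq_iff[OF H a] by blast
    have "f a = f h \<oplus>\<^bsub>W\<^esub> f ?b"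
      by (subst h(2), rule module_homD(2)[OF f]) (use h b H.a_subset in auto)
    then show ?thesis using 0[OF h(1)] b module_homD(1)[OF f] unfolding F_def by simp
  qed
  note q = module_homD(2,3)[OF quot_proj_hom[OF H], symmetric]
  have "F \<in> module_hom R (quot_module M H) W"
    by (rule module_homI) (auto simp: quot_carrier F q module_homD[OF f])
  with F show ?thesis using that by blast
qed

end

lemma module_isoI:
  assumes "f \<in> module_hom R M N" "g \<in> module_hom R N M"
    and "\<And>u. u \<in> carrier M \<Longrightarrow> g (f u) = u" "\<And>v. v \<in> carrier N \<Longrightarrow> f (g v) = v"
  shows "module_iso R M N"
proof -
  have "bij_betw f (carrier M) (carrier N)"
    by (rule bij_betw_byWitness[where f' = g])
      (use assms module_homD(1)[OF assms(1)] module_homD(1)[OF assms(2)] in auto)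
  with assms(1) show ?thesis unfolding module_iso_def by blast
qed

lemma module_hom_inj_onI:
  assumes M: "module R M" and N: "module R N" and f: "f \<in> module_hom R M N"
    and 0: "\<And>u. u \<in> carrier M \<Longrightarrow> f u = \<zero>\<^bsub>N\<^esub> \<Longrightarrow> u = \<zero>\<^bsub>M\<^esub>"
  shows "inj_on f (carrier M)"
proof (rule inj_onI)
  interpret M: module R M by fact
  interpret N: module R N by fact
  fix u v assume u: "u \<in> carrier M" and v: "v \<in> carrier M" and e: "f u = f v"
  have "f (u \<ominus>\<^bsub>M\<^esub> v) = \<zero>\<^bsub>N\<^esub>"
    using e module_homD(1)[OF f v] module_hom_minus[OF M N f u v] N.M.minus_eq_zero_iff by metis
  then have "u \<ominus>\<^bsub>M\<^esub> v = \<zero>\<^bsub>M\<^esub>" using u v by (intro 0) auto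
  then show "u = v" using u v M.M.minus_eq_zero_iff by blast
qed

lemma first_isomorphism:
  assumes M: "module R M" and W: "module R W" and f: "f \<in> module_hom R M W"
    and H: "submodule H R M" and ker: "\<And>z. z \<in> carrier M \<Longrightarrow> f z = \<zero>\<^bsub>W\<^esub> \<longleftrightarrow> z \<in> H"
    and sur: "carrier W \<subseteq> f ` carrier M"
  shows "module_iso R (quot_module M H) W"
proof -
  interpret M: module R M by fact
  let ?Q = "quot_module M H"
  have HM: "H \<subseteq> carrier M" using M.submoduleE(1)[OF H] .
  obtain F where F: "F \<in> module_hom R ?Q W"
    and Fq: "\<And>a. a \<in> carrier M \<Longrightarrow> F (H +>\<^bsub>M\<^esub> a) = f a"
    using M.quot_lift[OF H W f] ker HM by (metis subsetD)
  have "inj_on F (carrier ?Q)"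
  proof (rule module_hom_inj_onI[OF M.quot_module_module[OF H] W F])
    fix X assume "X \<in> carrier ?Q" "F X = \<zero>\<^bsub>W\<^esub>"
    then obtain a where "a \<in> carrier M" "X = H +>\<^bsub>M\<^esub> a" "f a = \<zero>\<^bsub>W\<^esub>"
      using Fq by (auto simp: M.quot_carrier)
    then show "X = \<zero>\<^bsub>?Q\<^esub>" using ker M.quot_eq_zero_iff[OF H] by simp
  qed
  moreover have "F ` carrier ?Q = carrier W"
    using sur module_homD(1)[OF f] Fq by (force simp: M.quot_carrier image_image)
  ultimately show ?thesis using F unfolding module_iso_def bij_betw_def by blast
qed

text \<open>
  The criterion by which homology modules are compared below: modulo the submodules that are divided
  out, \<open>f\<close> is injective and surjective.
\<close>

lemma quot_module_iso:
  assumes M: "module R M" and M': "module R M'" and f: "f \<in> module_hom R M M'"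
    and H: "submodule H R M" and H': "submodule H' R M'"
    and iff: "\<And>z. z \<in> carrier M \<Longrightarrow> f z \<in> H' \<longleftrightarrow> z \<in> H"
    and sur: "\<And>z'. z' \<in> carrier M' \<Longrightarrow> \<exists>z\<in>carrier M. \<exists>h\<in>H'. z' = h \<oplus>\<^bsub>M'\<^esub> f z"
  shows "module_iso R (quot_module M H) (quot_module M' H')"
proof (rule first_isomorphism[OF M _ _ H])
  interpret M': module R M' by fact
  show "module R (quot_module M' H')" by (rule M'.quot_module_module[OF H'])
  show "(\<lambda>u. H' +>\<^bsub>M'\<^esub> f u) \<in> module_hom R M (quot_module M' H')"
    by (rule module_hom_comp[OF f M'.quot_proj_hom[OF H']])
  show "H' +>\<^bsub>M'\<^esub> f z = \<zero>\<^bsub>quot_module M' H'\<^esub> \<longleftrightarrow> z \<in> H" if "z \<in> carrier M" for z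
    using M'.quot_eq_zero_iff[OF H' module_homD(1)[OF f that]] iff[OF that] by simp
  show "carrier (quot_module M' H') \<subseteq> (\<lambda>u. H' +>\<^bsub>M'\<^esub> f u) ` carrier M"
  proof
    fix Y assume "Y \<in> carrier (quot_module M' H')"
    then obtain z' where z': "z' \<in> carrier M'" "Y = H' +>\<^bsub>M'\<^esub> z'" by (auto simp: M'.quot_carrier)
    obtain z h where zh: "z \<in> carrier M" "h \<in> H'" "z' = h \<oplus>\<^bsub>M'\<^esub> f z" using sur[OF z'(1)] by blast
    have "Y = H' +>\<^bsub>M'\<^esub> f z"
      unfolding z'(2) using zh M'.quot_eq_iff[OF H' z'(1) module_homD(1)[OF f zh(1)]] by blast
    then show "Y \<in> (\<lambda>u. H' +>\<^bsub>M'\<^esub> f u) ` carrier M" using zh(1) by blast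
  qed
qed

section \<open>Complexes of modules\<close>

definition chain_complex ::
    "('a, 'k) ring_scheme \<Rightarrow> (nat \<Rightarrow> ('a, 'c) module) \<Rightarrow> (nat \<Rightarrow> 'c \<Rightarrow> 'c) \<Rightarrow> bool"
  where "chain_complex R C d \<longleftrightarrow>
    (\<forall>i. module R (C i)) \<and> (\<forall>i. d i \<in> module_hom R (C (Suc i)) (C i)) \<and>
    (\<forall>i. \<forall>z\<in>carrier (C (Suc (Suc i))). d i (d (Suc i) z) = \<zero>\<^bsub>C i\<^esub>)"

text \<open>
  In degree \<open>0\<close> every element is a cycle. With this convention all degrees can be treated alike,
  although \<^const>\<open>homology\<close> distinguishes degree \<open>0\<close>.
\<close>

definition cycles :: "(nat \<Rightarrow> ('a, 'c) module) \<Rightarrow> (nat \<Rightarrow> 'c \<Rightarrow> 'c) \<Rightarrow> nat \<Rightarrow> 'c set"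
  where "cycles C d i = {z \<in> carrier (C i). \<forall>j. i = Suc j \<longrightarrow> d j z = \<zero>\<^bsub>C j\<^esub>}"

definition boundaries :: "(nat \<Rightarrow> ('a, 'c) module) \<Rightarrow> (nat \<Rightarrow> 'c \<Rightarrow> 'c) \<Rightarrow> nat \<Rightarrow> 'c set"
  where "boundaries C d i = d i ` carrier (C (Suc i))"

lemma homology_eq: "homology C d i = quot_module ((C i)\<lparr>carrier := cycles C d i\<rparr>) (boundaries C d i)"
  by (cases i) (simp_all add: cycles_def boundaries_def a_kernel_def')

lemma (in module) submodule_of_submodule:
  assumes "submodule H R M" "submodule K R M" "H \<subseteq> K"
  shows "submodule H R (M\<lparr>carrier := K\<rparr>)"
  by (rule module.module_incl_imp_submodule)
    (use assms submodule.submodule_is_module[OF assms(1) module_axioms]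
      submodule.submodule_is_module[OF assms(2) module_axioms] in simp_all)

lemma
  assumes C: "chain_complex R C d"
  shows cycles_submodule: "submodule (cycles C d i) R (C i)"
    and boundaries_submodule: "submodule (boundaries C d i) R (C i)"
    and boundaries_subset_cycles: "boundaries C d i \<subseteq> cycles C d i"
proof -
  have m: "module R (C j)" and d: "d j \<in> module_hom R (C (Suc j)) (C j)" for j
    using C by (auto simp: chain_complex_def)
  show "submodule (cycles C d i) R (C i)"
  proof (cases i)
    case 0
    then show ?thesis using module.carrier_is_submodule[OF m[of i]] by (simp add: cycles_def)
  next
    case (Suc j)
    then show ?thesis
      using module.module_hom_kernel[OF m m d, of j] by (simp add: cycles_def a_kernel_def')
  qed
  show "submodule (boundaries C d i) R (C i)"
    unfolding boundaries_def by (rule module_hom_image_submodule[OF m m d])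
  show "boundaries C d i \<subseteq> cycles C d i"
    using C module_homD(1)[OF d] by (auto simp: chain_complex_def boundaries_def cycles_def)
qed

lemma
  assumes C: "chain_complex R C d"
  shows cycles_module: "module R ((C i)\<lparr>carrier := cycles C d i\<rparr>)"
    and boundaries_submodule_cycles: "submodule (boundaries C d i) R ((C i)\<lparr>carrier := cycles C d i\<rparr>)"
    and homology_module: "module R (homology C d i)"
proof -
  have m: "module R (C i)" using C by (simp add: chain_complex_def)
  show 1: "module R ((C i)\<lparr>carrier := cycles C d i\<rparr>)"
    by (rule submodule.submodule_is_module[OF cycles_submodule[OF C] m])
  show 2: "submodule (boundaries C d i) R ((C i)\<lparr>carrier := cycles C d i\<rparr>)"
    by (rule module.submodule_of_submodule[OF m boundaries_submodule[OF C] cycles_submodule[OF C]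
        boundaries_subset_cycles[OF C]])
  show "module R (homology C d i)"
    unfolding homology_eq by (rule module.quot_module_module[OF 1 2])
qed

lemma zero_homology_iff:
  fixes C :: "nat \<Rightarrow> ('a, 'c) module"
  assumes C: "chain_complex R C d"
  shows "zero_module (homology C d i) \<longleftrightarrow> cycles C d i \<subseteq> boundaries C d i"
proof -
  let ?Z = "(C i)\<lparr>carrier := cycles C d i\<rparr>" and ?B = "boundaries C d i"
  interpret Z: module R ?Z by (rule cycles_module[OF C])
  note B = boundaries_submodule_cycles[OF C, of i]
  interpret H: module R "quot_module ?Z ?B" by (rule Z.quot_module_module[OF B])
  have zero: "X = {c} \<longleftrightarrow> (\<forall>z\<in>A. g z = c)" if "X = g ` A" "c \<in> X" for X c A and g :: "'c \<Rightarrow> 'c set"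
    using that by auto
  have "zero_module (quot_module ?Z ?B) \<longleftrightarrow>
      (\<forall>z\<in>cycles C d i. ?B +>\<^bsub>?Z\<^esub> z = \<zero>\<^bsub>quot_module ?Z ?B\<^esub>)"
    unfolding zero_module_def
    by (rule zero) (use Z.quot_carrier[of ?B] H.M.zero_closed in simp_all)
  also have "\<dots> \<longleftrightarrow> (\<forall>z\<in>cycles C d i. z \<in> ?B)"
    using Z.quot_eq_zero_iff[OF B] by simp
  finally show ?thesis unfolding homology_eq by blast
qed

lemma homology_isoI:
  assumes C: "chain_complex R C d" and C': "chain_complex R C' d'"
    and f: "f \<in> module_hom R (C i) (C' i)"
    and cyc: "\<And>z. z \<in> cycles C d i \<Longrightarrow> f z \<in> cycles C' d' i"
    and iff: "\<And>z. z \<in> cycles C d i \<Longrightarrow> f z \<in> boundaries C' d' i \<longleftrightarrow> z \<in> boundaries C d i"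
    and sur: "\<And>z'. z' \<in> cycles C' d' i \<Longrightarrow>
      \<exists>z\<in>cycles C d i. \<exists>h\<in>boundaries C' d' i. z' = h \<oplus>\<^bsub>C' i\<^esub> f z"
  shows "module_iso R (homology C d i) (homology C' d' i)"
  unfolding homology_eq
proof (rule quot_module_iso[OF cycles_module[OF C] cycles_module[OF C'] _
      boundaries_submodule_cycles[OF C] boundaries_submodule_cycles[OF C']])
  have "z \<in> carrier (C i)" if "z \<in> cycles C d i" for z using that by (simp add: cycles_def)
  then show "f \<in> module_hom R ((C i)\<lparr>carrier := cycles C d i\<rparr>) ((C' i)\<lparr>carrier := cycles C' d' i\<rparr>)"
    using module_homD(2,3)[OF f] cyc by (intro module_homI) auto
qed (use iff sur in auto)

section \<open>Finitely supported vectors and matrices\<close>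

text \<open>
  The direct sum of copies of \<open>N\<close> indexed by \<open>X\<close>. It plays the role of the tensor product of \<open>N\<close>
  with the free module on \<open>X\<close>, in a form in which the entries of a vector can be read off.
\<close>

definition fsupp :: "('a, 'n, 'q) module_scheme \<Rightarrow> 'x set \<Rightarrow> ('a, 'x \<Rightarrow> 'n) module"
  where "fsupp N X =
    \<lparr>carrier = {f. (\<forall>x\<in>X. f x \<in> carrier N) \<and> (\<forall>x. x \<notin> X \<longrightarrow> f x = \<zero>\<^bsub>N\<^esub>) \<and> finite {x. f x \<noteq> \<zero>\<^bsub>N\<^esub>}},
     mult = undefined, one = undefined, zero = (\<lambda>x. \<zero>\<^bsub>N\<^esub>), add = (\<lambda>f g x. f x \<oplus>\<^bsub>N\<^esub> g x),
     smult = (\<lambda>r f x. r \<odot>\<^bsub>N\<^esub> f x)\<rparr>"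

abbreviation vecs :: "('a, 'n, 'q) module_scheme \<Rightarrow> 'x set \<Rightarrow> ('x \<Rightarrow> 'n) set"
  where "vecs N X \<equiv> carrier (fsupp N X)"

definition self_module :: "('a, 'k) ring_scheme \<Rightarrow> ('a, 'a) module"
  where "self_module R =
    \<lparr>carrier = carrier R, mult = mult R, one = one R, zero = zero R, add = add R, smult = mult R\<rparr>"

definition single :: "('a, 'n, 'q) module_scheme \<Rightarrow> 'x \<Rightarrow> 'n \<Rightarrow> 'x \<Rightarrow> 'n"
  where "single N b n = (\<lambda>x. if x = b then n else \<zero>\<^bsub>N\<^esub>)"

text \<open>
  The image of the pure tensor of \<open>f\<close> and \<open>n\<close> when the tensor product of \<open>N\<close> with a free module is
  identified with a module of vectors.
\<close>

definition scale :: "('a, 'n, 'q) module_scheme \<Rightarrow> ('x \<Rightarrow> 'a) \<Rightarrow> 'n \<Rightarrow> 'x \<Rightarrow> 'n"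
  where "scale N f n = (\<lambda>x. f x \<odot>\<^bsub>N\<^esub> n)"

text \<open>
  The map out of a direct sum given by \<open>h x\<close> on the summand indexed by \<open>x\<close>. For \<open>N = R\<close> this is
  \<^const>\<open>lin_ext\<close>, see \<open>lin_ext_eq_dsum_ext\<close> below.
\<close>

definition dsum_ext ::
    "('a, 'n, 'q) module_scheme \<Rightarrow> ('a, 'w, 'p) module_scheme \<Rightarrow> ('x \<Rightarrow> 'n \<Rightarrow> 'w) \<Rightarrow> ('x \<Rightarrow> 'n) \<Rightarrow> 'w"
  where "dsum_ext N W h v = (\<Oplus>\<^bsub>W\<^esub>x\<in>{x. v x \<noteq> \<zero>\<^bsub>N\<^esub>}. h x (v x))"

text \<open>
  A matrix is given by its columns \<open>A b\<close>, one for each basis element \<open>b\<close> of the source. The same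
  matrix over \<open>R\<close> acts on vectors with entries in any module \<open>N\<close>.
\<close>

definition mapp :: "('a, 'n, 'q) module_scheme \<Rightarrow> ('b \<Rightarrow> 'c \<Rightarrow> 'a) \<Rightarrow> ('b \<Rightarrow> 'n) \<Rightarrow> 'c \<Rightarrow> 'n"
  where "mapp N A v = (\<lambda>c. dsum_ext N N (\<lambda>b n. A b c \<odot>\<^bsub>N\<^esub> n) v)"

definition is_mat :: "('a, 'k) ring_scheme \<Rightarrow> 'b set \<Rightarrow> 'c set \<Rightarrow> ('b \<Rightarrow> 'c \<Rightarrow> 'a) \<Rightarrow> bool"
  where "is_mat R X C A \<longleftrightarrow> (\<forall>b\<in>X. A b \<in> carrier (free_module R C))"

definition matmul ::
    "('a, 'k) ring_scheme \<Rightarrow> ('c \<Rightarrow> 'd \<Rightarrow> 'a) \<Rightarrow> ('b \<Rightarrow> 'c \<Rightarrow> 'a) \<Rightarrow> 'b \<Rightarrow> 'd \<Rightarrow> 'a"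
  where "matmul R B A = (\<lambda>b. mapp (self_module R) B (A b))"

lemma self_module_simps [simp]:
  "carrier (self_module R) = carrier R" "\<zero>\<^bsub>self_module R\<^esub> = \<zero>\<^bsub>R\<^esub>" "u \<oplus>\<^bsub>self_module R\<^esub> v = u \<oplus>\<^bsub>R\<^esub> v"
  "r \<odot>\<^bsub>self_module R\<^esub> u = r \<otimes>\<^bsub>R\<^esub> u"
  by (simp_all add: self_module_def)

lemma (in cring) self_module_module: "module R (self_module R)"
proof (rule moduleI)
  show "abelian_group (self_module R)"
    by (rule abelian_groupI) (auto simp: a_ac intro: bexI[of _ "\<ominus> _"] l_neg)
qed (auto simp: is_cring l_distr r_distr m_assoc)

lemma free_module_eq: "free_module R X = fsupp (self_module R) X"
  by (simp add: free_module_def fsupp_def)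

lemma fsupp_simps [simp]:
  "\<zero>\<^bsub>fsupp N X\<^esub> = (\<lambda>x. \<zero>\<^bsub>N\<^esub>)"
  "f \<oplus>\<^bsub>fsupp N X\<^esub> g = (\<lambda>x. f x \<oplus>\<^bsub>N\<^esub> g x)"
  "r \<odot>\<^bsub>fsupp N X\<^esub> f = (\<lambda>x. r \<odot>\<^bsub>N\<^esub> f x)"
  by (simp_all add: fsupp_def)

lemma fsupp_carrier:
  "f \<in> vecs N X \<longleftrightarrow>
    (\<forall>x\<in>X. f x \<in> carrier N) \<and> (\<forall>x. x \<notin> X \<longrightarrow> f x = \<zero>\<^bsub>N\<^esub>) \<and> finite {x. f x \<noteq> \<zero>\<^bsub>N\<^esub>}"
  by (simp add: fsupp_def)

lemma fsupp_outside: "f \<in> vecs N X \<Longrightarrow> x \<notin> X \<Longrightarrow> f x = \<zero>\<^bsub>N\<^esub>"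
  by (simp add: fsupp_carrier)

lemma free_basis_eq_single: "free_basis R b = single (self_module R) b \<one>\<^bsub>R\<^esub>"
  by (simp add: free_basis_def single_def cong: if_cong)

context module
begin

lemma fsupp_apply: "f \<in> vecs M X \<Longrightarrow> f x \<in> carrier M"
  unfolding fsupp_carrier by (cases "x \<in> X") auto

lemma fsupp_add_closed:
  assumes "f \<in> vecs M X" "g \<in> vecs M X"
  shows "(\<lambda>x. f x \<oplus>\<^bsub>M\<^esub> g x) \<in> vecs M X"
proof -
  have "{x. f x \<oplus>\<^bsub>M\<^esub> g x \<noteq> \<zero>\<^bsub>M\<^esub>} \<subseteq> {x. f x \<noteq> \<zero>\<^bsub>M\<^esub>} \<union> {x. g x \<noteq> \<zero>\<^bsub>M\<^esub>}"
    by auto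
  with assms show ?thesis
    unfolding fsupp_carrier by (auto intro: finite_subset)
qed

lemma fsupp_map_closed:
  assumes "f \<in> vecs M X" "h \<zero>\<^bsub>M\<^esub> = \<zero>\<^bsub>W\<^esub>" "\<And>u. u \<in> carrier M \<Longrightarrow> h u \<in> carrier W"
  shows "(\<lambda>x. h (f x)) \<in> vecs W X"
proof -
  have "{x. h (f x) \<noteq> \<zero>\<^bsub>W\<^esub>} \<subseteq> {x. f x \<noteq> \<zero>\<^bsub>M\<^esub>}"
    using assms by auto
  with assms show ?thesis
    unfolding fsupp_carrier by (auto intro: finite_subset)
qed

lemma fsupp_module: "module R (fsupp M X)"
proof (rule moduleI)
  show "abelian_group (fsupp M X)"
  proof (rule abelian_groupI)
    fix f assume f: "f \<in> vecs M X"
    show "\<exists>g\<in>vecs M X. g \<oplus>\<^bsub>fsupp M X\<^esub> f = \<zero>\<^bsub>fsupp M X\<^esub>"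
      by (rule bexI[OF _ fsupp_map_closed[OF f, of "a_inv M"]])
        (auto simp: fsupp_apply[OF f] M.l_neg)
  next
    show "\<zero>\<^bsub>fsupp M X\<^esub> \<in> vecs M X"
      by (simp add: fsupp_carrier)
  qed (auto simp: fsupp_add_closed fsupp_apply M.a_ac)
qed (auto simp: R.is_cring fsupp_map_closed fsupp_apply smult_l_distr smult_r_distr smult_assoc1)

lemma fsupp_a_inv:
  assumes "f \<in> vecs M X"
  shows "\<ominus>\<^bsub>fsupp M X\<^esub> f = (\<lambda>x. \<ominus>\<^bsub>M\<^esub> f x)"
proof -
  interpret F: module R "fsupp M X" by (rule fsupp_module)
  show ?thesis
    by (rule F.M.minus_equality)
      (use assms fsupp_map_closed[OF assms, of "a_inv M" M] in \<open>auto simp: fsupp_apply[OF assms] M.l_neg\<close>)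
qed

lemma fsupp_minus:
  assumes "f \<in> vecs M X" "g \<in> vecs M X"
  shows "f \<ominus>\<^bsub>fsupp M X\<^esub> g = (\<lambda>x. f x \<ominus>\<^bsub>M\<^esub> g x)"
  by (simp add: a_minus_def fsupp_a_inv[OF assms(2)])

lemma single_closed: "b \<in> X \<Longrightarrow> n \<in> carrier M \<Longrightarrow> single M b n \<in> vecs M X"
  unfolding fsupp_carrier single_def by (auto intro: finite_subset[of _ "{b}"])

lemma fsupp_induct [consumes 1, case_names zero single add]:
  assumes f: "f \<in> vecs M X"
    and 0: "P (\<lambda>x. \<zero>\<^bsub>M\<^esub>)"
    and s: "\<And>b n. b \<in> X \<Longrightarrow> n \<in> carrier M \<Longrightarrow> P (single M b n)"
    and a: "\<And>f g. f \<in> vecs M X \<Longrightarrow> g \<in> vecs M X \<Longrightarrow> P f \<Longrightarrow> P g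
      \<Longrightarrow> P (\<lambda>x. f x \<oplus>\<^bsub>M\<^esub> g x)"
  shows "P f"
proof -
  have "P f" if "finite A" "{x. f x \<noteq> \<zero>\<^bsub>M\<^esub>} \<subseteq> A" "f \<in> vecs M X" for A f
    using that
  proof (induction A arbitrary: f rule: finite_induct)
    case empty
    then have "f = (\<lambda>x. \<zero>\<^bsub>M\<^esub>)" by auto
    then show ?case using 0 by simp
  next
    case (insert b A)
    show ?case
    proof (cases "b \<in> X")
      case False
      then have "{x. f x \<noteq> \<zero>\<^bsub>M\<^esub>} \<subseteq> A" using insert.prems fsupp_outside by fastforce
      then show ?thesis using insert by blast
    next
      case True
      define g where "g = f(b := \<zero>\<^bsub>M\<^esub>)"
      have "{x. g x \<noteq> \<zero>\<^bsub>M\<^esub>} \<subseteq> {x. f x \<noteq> \<zero>\<^bsub>M\<^esub>}" by (auto simp: g_def)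
      then have g: "g \<in> vecs M X"
        using insert.prems(2) finite_subset[of "{x. g x \<noteq> \<zero>\<^bsub>M\<^esub>}"] unfolding fsupp_carrier
        by (auto simp: g_def)
      have Pg: "P g" by (rule insert.IH[OF _ g]) (use insert.prems in \<open>auto simp: g_def\<close>)
      have fb: "f b \<in> carrier M" by (rule fsupp_apply[OF insert.prems(2)])
      have "f = (\<lambda>x. single M b (f b) x \<oplus>\<^bsub>M\<^esub> g x)"
        using fsupp_apply[OF insert.prems(2)] by (auto simp: single_def g_def)
      then show ?thesis
        using a[OF single_closed[OF True fb] g s[OF True fb] Pg] by simp
    qed
  qed
  with f show ?thesis unfolding fsupp_carrier by blast
qed

text \<open>
  Homomorphisms out of a module of vectors are compared on vectors with a single nonzero entry; all
  identities between maps given by matrices are obtained in this way.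
\<close>

lemma fsupp_hom_eqI:
  assumes f: "f \<in> module_hom R (fsupp M X) W" and g: "g \<in> module_hom R (fsupp M X) W"
    and W: "module R W"
    and eq: "\<And>b n. b \<in> X \<Longrightarrow> n \<in> carrier M \<Longrightarrow> f (single M b n) = g (single M b n)"
    and v: "v \<in> vecs M X"
  shows "f v = g v"
  using v
proof (induction rule: fsupp_induct)
  case zero
  then show ?case
    using module_hom_zero[OF fsupp_module W f] module_hom_zero[OF fsupp_module W g] by simp
next
  case (add u v)
  then show ?case using module_homD(2)[OF f, of u v] module_homD(2)[OF g, of u v] by simp
qed (rule eq)

lemma dsum_ext_superset:
  assumes W: "module R W" and h: "\<And>x. x \<in> X \<Longrightarrow> h x \<in> module_hom R M W"
    and v: "v \<in> vecs M X" and A: "finite A" "{x. v x \<noteq> \<zero>\<^bsub>M\<^esub>} \<subseteq> A" "A \<subseteq> X"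
  shows "dsum_ext M W h v = (\<Oplus>\<^bsub>W\<^esub>x\<in>A. h x (v x))"
proof -
  interpret W: module R W by fact
  show ?thesis
    unfolding dsum_ext_def
  proof (rule W.M.add.finprod_mono_neutral_cong_left)
    show "h i (v i) = \<zero>\<^bsub>W\<^esub>" if "i \<in> A - {x. v x \<noteq> \<zero>\<^bsub>M\<^esub>}" for i
    proof -
      have "i \<in> X" "v i = \<zero>\<^bsub>M\<^esub>" using that A(3) by auto
      then show ?thesis using module_hom_zero[OF module_axioms W h] by simp
    qed
    show "(\<lambda>x. h x (v x)) \<in> A \<rightarrow> carrier W"
      using A(3) module_homD(1)[OF h fsupp_apply[OF v]] by (auto simp: subset_iff)
  qed (use A in auto)
qed

lemma dsum_ext_hom:
  assumes W: "module R W" and h: "\<And>x. x \<in> X \<Longrightarrow> h x \<in> module_hom R M W"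
  shows "dsum_ext M W h \<in> module_hom R (fsupp M X) W"
proof (rule module_homI)
  interpret W: module R W by fact
  note hD = module_homD[OF h]
  have sup: "dsum_ext M W h v = (\<Oplus>\<^bsub>W\<^esub>x\<in>A. h x (v x))"
    if "v \<in> vecs M X" "finite A" "{x. v x \<noteq> \<zero>\<^bsub>M\<^esub>} \<subseteq> A" "A \<subseteq> X" for v A
    using dsum_ext_superset[OF W _ that] h by blast
  {
    fix u v assume u: "u \<in> vecs M X" and v: "v \<in> vecs M X"
    define A where "A = {x. u x \<noteq> \<zero>\<^bsub>M\<^esub>} \<union> {x. v x \<noteq> \<zero>\<^bsub>M\<^esub>}"
    have A: "finite A" "A \<subseteq> X" "{x. u x \<noteq> \<zero>\<^bsub>M\<^esub>} \<subseteq> A" "{x. v x \<noteq> \<zero>\<^bsub>M\<^esub>} \<subseteq> A"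
        "{x. u x \<oplus>\<^bsub>M\<^esub> v x \<noteq> \<zero>\<^bsub>M\<^esub>} \<subseteq> A"
      using u v unfolding A_def fsupp_carrier by auto
    have "(\<Oplus>\<^bsub>W\<^esub>x\<in>A. h x (u x \<oplus>\<^bsub>M\<^esub> v x)) = (\<Oplus>\<^bsub>W\<^esub>x\<in>A. h x (u x) \<oplus>\<^bsub>W\<^esub> h x (v x))"
      using A(2) fsupp_apply[OF u] fsupp_apply[OF v]
      by (intro W.M.finsum_cong') (auto simp: hD subset_iff)
    also have "\<dots> = (\<Oplus>\<^bsub>W\<^esub>x\<in>A. h x (u x)) \<oplus>\<^bsub>W\<^esub> (\<Oplus>\<^bsub>W\<^esub>x\<in>A. h x (v x))"
      using A(2) fsupp_apply[OF u] fsupp_apply[OF v]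
      by (intro W.M.finsum_addf) (auto simp: hD subset_iff)
    finally have "dsum_ext M W h (\<lambda>x. u x \<oplus>\<^bsub>M\<^esub> v x) = dsum_ext M W h u \<oplus>\<^bsub>W\<^esub> dsum_ext M W h v"
      using sup[OF fsupp_add_closed[OF u v] A(1,5,2)] sup[OF u A(1,3,2)] sup[OF v A(1,4,2)]
      by simp
    then show "dsum_ext M W h (u \<oplus>\<^bsub>fsupp M X\<^esub> v) = dsum_ext M W h u \<oplus>\<^bsub>W\<^esub> dsum_ext M W h v"
      by simp
  next
    fix r u assume r: "r \<in> carrier R" and u: "u \<in> vecs M X"
    define A where "A = {x. u x \<noteq> \<zero>\<^bsub>M\<^esub>}"
    have A: "finite A" "A \<subseteq> X" "{x. u x \<noteq> \<zero>\<^bsub>M\<^esub>} \<subseteq> A" "{x. r \<odot>\<^bsub>M\<^esub> u x \<noteq> \<zero>\<^bsub>M\<^esub>} \<subseteq> A"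
      using u r unfolding A_def fsupp_carrier by auto
    have ru: "(\<lambda>x. r \<odot>\<^bsub>M\<^esub> u x) \<in> vecs M X"
      using r by (intro fsupp_map_closed[OF u]) auto
    have "r \<odot>\<^bsub>W\<^esub> (\<Oplus>\<^bsub>W\<^esub>x\<in>A. h x (u x)) = (\<Oplus>\<^bsub>W\<^esub>x\<in>A. r \<odot>\<^bsub>W\<^esub> h x (u x))"
      using A(1,2) r fsupp_apply[OF u]
      by (intro W.finsum_smult_ldistr) (auto simp: hD subset_iff)
    also have "\<dots> = (\<Oplus>\<^bsub>W\<^esub>x\<in>A. h x (r \<odot>\<^bsub>M\<^esub> u x))"
      using A(2) r fsupp_apply[OF u]
      by (intro W.M.finsum_cong') (auto simp: hD subset_iff)
    finally show "dsum_ext M W h (r \<odot>\<^bsub>fsupp M X\<^esub> u) = r \<odot>\<^bsub>W\<^esub> dsum_ext M W h u"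
      using sup[OF u A(1,3,2)] sup[OF ru A(1,4,2)] by simp
  next
    fix u assume u: "u \<in> vecs M X"
    then have "{x. u x \<noteq> \<zero>\<^bsub>M\<^esub>} \<subseteq> X" unfolding fsupp_carrier by blast
    then show "dsum_ext M W h u \<in> carrier W"
      unfolding dsum_ext_def using fsupp_apply[OF u]
      by (intro W.M.finsum_closed) (auto simp: hD subset_iff)
  }
qed

lemma dsum_ext_single:
  assumes W: "module R W" and h: "h b \<in> module_hom R M W" and n: "n \<in> carrier M"
  shows "dsum_ext M W h (single M b n) = h b n"
proof -
  interpret W: module R W by fact
  have "dsum_ext M W h (single M b n) = (\<Oplus>\<^bsub>W\<^esub>x\<in>{b}. h x (single M b n x))"
    by (rule dsum_ext_superset[OF W, of "{b}"]) (use h n single_closed[of b "{b}" n] in \<open>auto simp: single_def\<close>)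
  also have "\<dots> = h b n"
    using module_homD(1)[OF h n] by (simp add: single_def)
  finally show ?thesis .
qed

lemma smult_hom: "r \<in> carrier R \<Longrightarrow> (\<lambda>u. r \<odot>\<^bsub>M\<^esub> u) \<in> module_hom R M M"
  by (rule module_homI) (auto simp: smult_r_distr smult_assoc1[symmetric] R.m_comm)

lemma smult_left_hom: "u \<in> carrier M \<Longrightarrow> (\<lambda>r. r \<odot>\<^bsub>M\<^esub> u) \<in> module_hom R (self_module R) M"
  by (rule module_homI) (auto simp: smult_l_distr smult_assoc1)

lemma module_hom_add_closed:
  assumes "f \<in> module_hom R L M" "g \<in> module_hom R L M"
  shows "(\<lambda>u. f u \<oplus>\<^bsub>M\<^esub> g u) \<in> module_hom R L M"
  using module_homD[OF assms(1)] module_homD[OF assms(2)]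
  by (intro module_homI) (auto simp: smult_r_distr M.a_ac)

lemma fsupp_map_hom:
  assumes W: "module R W" and h: "h \<in> module_hom R M W"
  shows "(\<lambda>v x. h (v x)) \<in> module_hom R (fsupp M X) (fsupp W X)"
  using module_hom_zero[OF module_axioms W h] module_homD[OF h]
  by (intro module_homI) (auto intro!: fsupp_map_closed simp: fsupp_apply)

lemma scale_closed:
  assumes "f \<in> carrier (free_module R X)" "n \<in> carrier M"
  shows "scale M f n \<in> vecs M X"
  unfolding scale_def
  by (rule module.fsupp_map_closed[OF R.self_module_module assms(1)[unfolded free_module_eq]])
    (use assms in auto)

lemma scale_hom_left:
  assumes "n \<in> carrier M"
  shows "(\<lambda>f. scale M f n) \<in> module_hom R (free_module R X) (fsupp M X)"
  using assms scale_closed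
  by (intro module_homI) (auto simp: scale_def smult_l_distr smult_assoc1 R.free_module_apply)

lemma scale_hom_right:
  assumes "f \<in> carrier (free_module R X)"
  shows "scale M f \<in> module_hom R M (fsupp M X)"
  using scale_closed[OF assms] R.free_module_apply[OF assms]
  by (intro module_homI) (auto simp: scale_def smult_r_distr smult_assoc1[symmetric] R.m_comm)

lemma scale_free_basis: "n \<in> carrier M \<Longrightarrow> scale M (free_basis R b) n = single M b n"
  by (auto simp: scale_def free_basis_def single_def)

lemma is_mat_coeff: "is_mat R X C A \<Longrightarrow> b \<in> X \<Longrightarrow> A b c \<in> carrier R"
  unfolding is_mat_def by (blast intro: R.free_module_apply)

lemma mapp_single:
  assumes A: "is_mat R X C A" and b: "b \<in> X" and n: "n \<in> carrier M"
  shows "mapp M A (single M b n) = scale M (A b) n"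
  unfolding mapp_def scale_def
  by (rule ext, rule dsum_ext_single[OF module_axioms _ n]) (rule smult_hom[OF is_mat_coeff[OF A b]])

lemma mapp_hom:
  assumes A: "is_mat R X C A"
  shows "mapp M A \<in> module_hom R (fsupp M X) (fsupp M C)"
proof -
  have h: "dsum_ext M M (\<lambda>b n. A b c \<odot>\<^bsub>M\<^esub> n) \<in> module_hom R (fsupp M X) M" for c
    by (rule dsum_ext_hom[OF module_axioms smult_hom[OF is_mat_coeff[OF A]]])
  note hD = module_homD[OF h]
  have mapp_add: "mapp M A (\<lambda>x. u x \<oplus>\<^bsub>M\<^esub> v x) = (\<lambda>c. mapp M A u c \<oplus>\<^bsub>M\<^esub> mapp M A v c)"
    if "u \<in> vecs M X" "v \<in> vecs M X" for u v
    using hD(2)[OF that] unfolding mapp_def by simp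
  have "mapp M A u \<in> vecs M C" if "u \<in> vecs M X" for u
    using that
  proof (induction rule: fsupp_induct)
    case zero
    have "mapp M A (\<lambda>x. \<zero>\<^bsub>M\<^esub>) = (\<lambda>c. \<zero>\<^bsub>M\<^esub>)"
      using module_hom_zero[OF fsupp_module module_axioms h] unfolding mapp_def by simp
    then show ?case by (simp add: fsupp_carrier)
  next
    case (single b n)
    then show ?case
      using A by (auto simp: mapp_single[OF A] is_mat_def intro: scale_closed)
  next
    case (add u v)
    then show ?case by (simp add: mapp_add fsupp_add_closed)
  qed
  then show ?thesis
    using mapp_add hD(3) by (intro module_homI) (auto simp: mapp_def)
qed

lemma mapp_cong:
  assumes "\<And>b. b \<in> X \<Longrightarrow> A b = B b" "is_mat R X C A" "v \<in> vecs M X"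
  shows "mapp M A v = mapp M B v"
proof (rule fsupp_hom_eqI[OF mapp_hom[OF assms(2)] _ fsupp_module _ assms(3)])
  have B: "is_mat R X C B" using assms(1,2) by (simp add: is_mat_def)
  show "mapp M B \<in> module_hom R (fsupp M X) (fsupp M C)" by (rule mapp_hom[OF B])
  show "mapp M A (single M b n) = mapp M B (single M b n)" if "b \<in> X" "n \<in> carrier M" for b n
    using that by (simp add: mapp_single[OF assms(2)] mapp_single[OF B] assms(1))
qed

lemma mapp_free_basis:
  assumes "v \<in> vecs M X"
  shows "mapp M (free_basis R) v = v"
proof -
  have A: "is_mat R X X (free_basis R)" by (simp add: is_mat_def R.free_basis_closed)
  have id: "(\<lambda>v. v) \<in> module_hom R (fsupp M X) (fsupp M X)"
    by (rule module_homI) auto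
  show ?thesis
    by (rule fsupp_hom_eqI[OF mapp_hom[OF A] id fsupp_module _ assms])
      (simp add: mapp_single[OF A] scale_free_basis)
qed

lemma mapp_add_mat:
  assumes A: "is_mat R X C A" and B: "is_mat R X C B" and v: "v \<in> vecs M X"
  shows "mapp M (\<lambda>b c. A b c \<oplus> B b c) v = (\<lambda>c. mapp M A v c \<oplus>\<^bsub>M\<^esub> mapp M B v c)"
proof -
  interpret FC: module R "fsupp M C" by (rule fsupp_module)
  have AB: "is_mat R X C (\<lambda>b c. A b c \<oplus> B b c)"
    using A B R.free_module_add_closed unfolding is_mat_def by blast
  show ?thesis
    by (rule fsupp_hom_eqI[OF mapp_hom[OF AB]
          FC.module_hom_add_closed[OF mapp_hom[OF A] mapp_hom[OF B], simplified] fsupp_module _ v])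
      (simp add: mapp_single[OF AB] mapp_single[OF A] mapp_single[OF B] scale_def smult_l_distr
        is_mat_coeff[OF A] is_mat_coeff[OF B])
qed

text \<open>
  Application of a matrix commutes with homomorphisms of the coefficients. For \<open>r \<mapsto> r n\<close> this says
  how matrices act on pure tensors, and for a ring homomorphism how they are reduced.
\<close>

lemma mapp_coeff_change:
  assumes W: "module R W" and h: "h \<in> module_hom R M W" and A: "is_mat R X C A"
    and v: "v \<in> vecs M X"
  shows "mapp W A (\<lambda>x. h (v x)) = (\<lambda>c. h (mapp M A v c))"
proof -
  interpret W: module R W by fact
  have 1: "(\<lambda>v. mapp W A (\<lambda>x. h (v x))) \<in> module_hom R (fsupp M X) (fsupp W C)"
    by (rule module_hom_comp[OF fsupp_map_hom[OF W h] W.mapp_hom[OF A]])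
  have 2: "(\<lambda>v c. h (mapp M A v c)) \<in> module_hom R (fsupp M X) (fsupp W C)"
    by (rule module_hom_comp[OF mapp_hom[OF A] fsupp_map_hom[OF W h]])
  have s: "(\<lambda>x. h (single M b n x)) = single W b (h n)" for b n
    using module_hom_zero[OF module_axioms W h] by (auto simp: single_def)
  show ?thesis
    by (rule fsupp_hom_eqI[OF 1 2 W.fsupp_module _ v])
      (simp add: s W.mapp_single[OF A] mapp_single[OF A] module_homD[OF h] scale_def is_mat_coeff[OF A])
qed

lemma mapp_scale:
  assumes B: "is_mat R C D B" and f: "f \<in> carrier (free_module R C)" and n: "n \<in> carrier M"
  shows "mapp M B (scale M f n) = scale M (mapp (self_module R) B f) n"
  unfolding scale_def
  by (rule module.mapp_coeff_change[OF R.self_module_module module_axioms smult_left_hom[OF n] B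
        f[unfolded free_module_eq]])

lemma matmul_is_mat:
  assumes "is_mat R X C A" "is_mat R C D B"
  shows "is_mat R X D (matmul R B A)"
  using assms(1) module_homD(1)[OF module.mapp_hom[OF R.self_module_module assms(2)]]
  unfolding is_mat_def matmul_def free_module_eq by blast

lemma mapp_comp:
  assumes A: "is_mat R X C A" and B: "is_mat R C D B" and v: "v \<in> vecs M X"
  shows "mapp M B (mapp M A v) = mapp M (matmul R B A) v"
proof (rule fsupp_hom_eqI[OF module_hom_comp[OF mapp_hom[OF A] mapp_hom[OF B]]
      mapp_hom[OF matmul_is_mat[OF A B]] fsupp_module _ v])
  fix b n assume "b \<in> X" "n \<in> carrier M"
  then show "mapp M B (mapp M A (single M b n)) = mapp M (matmul R B A) (single M b n)"
    using A mapp_scale[OF B, of "A b" n]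
    by (simp add: mapp_single[OF A] mapp_single[OF matmul_is_mat[OF A B]])
      (simp add: is_mat_def matmul_def)
qed

end

lemma (in cring) mapp_self_basis:
  assumes A: "is_mat R X C A" and b: "b \<in> X"
  shows "mapp (self_module R) A (free_basis R b) = A b"
proof -
  interpret S: module R "self_module R" by (rule self_module_module)
  have "mapp (self_module R) A (free_basis R b) = scale (self_module R) (A b) \<one>"
    unfolding free_basis_eq_single by (rule S.mapp_single[OF A b]) simp
  also have "\<dots> = A b" using S.is_mat_coeff[OF A b] by (auto simp: scale_def)
  finally show ?thesis .
qed

lemma lin_ext_eq_dsum_ext: "lin_ext R M g = dsum_ext (self_module R) M (\<lambda>x r. r \<odot>\<^bsub>M\<^esub> g x)"
  by (simp add: lin_ext_def dsum_ext_def fun_eq_iff)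

lemma (in cring) lin_ext_eq_mapp:
  assumes A: "is_mat R X C A" and f: "f \<in> carrier (free_module R X)"
  shows "lin_ext R (free_module R C) A f = mapp (self_module R) A f"
proof -
  interpret S: module R "self_module R" by (rule self_module_module)
  interpret F: module R "free_module R C" by (rule free_module_module)
  have A': "A \<in> X \<rightarrow> carrier (free_module R C)" using A by (auto simp: is_mat_def)
  show ?thesis
  proof (rule S.fsupp_hom_eqI[of _ X])
    show "lin_ext R (free_module R C) A \<in> module_hom R (fsupp (self_module R) X) (free_module R C)"
      using F.lin_ext_hom[OF A'] by (simp add: free_module_eq)
    show "mapp (self_module R) A \<in> module_hom R (fsupp (self_module R) X) (free_module R C)"
      using S.mapp_hom[OF A] by (simp add: free_module_eq)
    fix b r assume b: "b \<in> X" and r: "r \<in> carrier (self_module R)"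
    have "A b \<in> carrier (free_module R C)" using A b by (simp add: is_mat_def)
    then have "lin_ext R (free_module R C) A (single (self_module R) b r) = (\<lambda>x. r \<otimes> A b x)"
      unfolding lin_ext_eq_dsum_ext
      by (subst S.dsum_ext_single[OF F.module_axioms _ r]) (use F.smult_left_hom[of "A b"] in simp_all)
    also have "\<dots> = mapp (self_module R) A (single (self_module R) b r)"
      using r S.is_mat_coeff[OF A b] by (simp add: S.mapp_single[OF A b r] scale_def m_comm)
    finally show "lin_ext R (free_module R C) A (single (self_module R) b r) =
      mapp (self_module R) A (single (self_module R) b r)" .
  qed (use f F.module_axioms in \<open>simp_all add: free_module_eq\<close>)
qed

section \<open>Tensor products\<close>

definition pure_tensor ::
    "('a, 'k) ring_scheme \<Rightarrow> ('a, 'm, 'p) module_scheme \<Rightarrow> ('a, 'n, 'q) module_scheme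
      \<Rightarrow> 'm \<Rightarrow> 'n \<Rightarrow> ('m \<times> 'n \<Rightarrow> 'a) set"
  where "pure_tensor R M N u v =
    tensor_ker R M N +>\<^bsub>free_module R (carrier M \<times> carrier N)\<^esub> free_basis R (u, v)"

lemma (in cring) free_hom_eqI:
  assumes f: "f \<in> module_hom R (free_module R X) W" and g: "g \<in> module_hom R (free_module R X) W"
    and W: "module R W"
    and eq: "\<And>b. b \<in> X \<Longrightarrow> f (free_basis R b) = g (free_basis R b)"
    and v: "v \<in> carrier (free_module R X)"
  shows "f v = g v"
proof -
  interpret S: module R "self_module R" by (rule self_module_module)
  show ?thesis
  proof (rule S.fsupp_hom_eqI[OF f[unfolded free_module_eq] g[unfolded free_module_eq] W _
        v[unfolded free_module_eq]])
    fix b r assume b: "b \<in> X" and r: "r \<in> carrier (self_module R)"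
    have "single (self_module R) b r = r \<odot>\<^bsub>free_module R X\<^esub> free_basis R b"
      using r by (auto simp: single_def free_basis_def)
    then show "f (single (self_module R) b r) = g (single (self_module R) b r)"
      using r free_basis_closed[OF b] eq[OF b] module_homD(3)[OF f] module_homD(3)[OF g]
      by (simp del: free_module_simps)
  qed
qed

lemma (in module) submodule_gen_submodule:
  assumes "A \<subseteq> carrier M"
  shows "submodule (submodule_gen R M A) R M"
proof -
  have c: "carrier M \<in> {H. submodule H R M \<and> A \<subseteq> H}"
    using assms carrier_is_submodule by simp
  show ?thesis
    unfolding submodule_gen_def
  proof (rule submoduleI)
    show "\<Inter> {H. submodule H R M \<and> A \<subseteq> H} \<subseteq> carrier M" using c by (rule Inter_lower)
    have z: "\<zero>\<^bsub>M\<^esub> \<in> H" if "submodule H R M" for H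
      using subgroup.one_closed[OF submodule.axioms(1)[OF that]] by simp
    then show "\<zero>\<^bsub>M\<^esub> \<in> \<Inter> {H. submodule H R M \<and> A \<subseteq> H}" by simp
  next
    fix a b assume "a \<in> \<Inter> {H. submodule H R M \<and> A \<subseteq> H}" "b \<in> \<Inter> {H. submodule H R M \<and> A \<subseteq> H}"
    then show "a \<oplus>\<^bsub>M\<^esub> b \<in> \<Inter> {H. submodule H R M \<and> A \<subseteq> H}" by (simp add: submoduleE(5))
  next
    fix a assume "a \<in> \<Inter> {H. submodule H R M \<and> A \<subseteq> H}"
    then show "\<ominus>\<^bsub>M\<^esub> a \<in> \<Inter> {H. submodule H R M \<and> A \<subseteq> H}" by (simp add: submoduleE(3))
  next
    fix r a assume "r \<in> carrier R" "a \<in> \<Inter> {H. submodule H R M \<and> A \<subseteq> H}"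
    then show "r \<odot>\<^bsub>M\<^esub> a \<in> \<Inter> {H. submodule H R M \<and> A \<subseteq> H}" by (simp add: submoduleE(4))
  qed
qed

lemma submodule_gen_least:
  assumes "submodule H R M" "A \<subseteq> H" shows "submodule_gen R M A \<subseteq> H"
  using assms unfolding submodule_gen_def by blast

lemma submodule_gen_superset: "A \<subseteq> submodule_gen R M A"
  unfolding submodule_gen_def by blast

locale two_modules = M: module R M + N: module R N for R (structure) and M and N
begin

abbreviation "F \<equiv> free_module R (carrier M \<times> carrier N)"
abbreviation "K \<equiv> tensor_ker R M N"

sublocale F: module R F by (rule M.R.free_module_module)

lemma e_closed [simp]: "u \<in> carrier M \<Longrightarrow> v \<in> carrier N \<Longrightarrow> free_basis R (u, v) \<in> carrier F"
  by (rule M.R.free_basis_closed) simp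

lemma tensor_rel_subset: "tensor_rel R M N \<subseteq> carrier F"
  unfolding tensor_rel_def Let_def
  by (intro Un_least subsetI; elim CollectE exE conjE; hypsubst;
      intro F.M.minus_closed F.M.a_closed F.smult_closed e_closed M.M.a_closed N.M.a_closed
        M.smult_closed N.smult_closed; assumption)

lemma tensor_ker_submodule: "submodule K R F"
  unfolding tensor_ker_def by (rule F.submodule_gen_submodule[OF tensor_rel_subset])

lemma tensor_module: "module R (tensor R M N)"
  unfolding tensor_def by (rule F.quot_module_module[OF tensor_ker_submodule])

lemma tensor_proj_hom: "(\<lambda>z. K +>\<^bsub>F\<^esub> z) \<in> module_hom R F (tensor R M N)"
  unfolding tensor_def by (rule F.quot_proj_hom[OF tensor_ker_submodule])

lemma tensor_carrier: "carrier (tensor R M N) = (\<lambda>z. K +>\<^bsub>F\<^esub> z) ` carrier F"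
  unfolding tensor_def by (rule F.quot_carrier)

lemma tensor_rel_eq:
  assumes "a \<ominus>\<^bsub>F\<^esub> b \<in> tensor_rel R M N" "a \<in> carrier F" "b \<in> carrier F"
  shows "K +>\<^bsub>F\<^esub> a = K +>\<^bsub>F\<^esub> b"
proof (subst F.quot_eq_iff[OF tensor_ker_submodule assms(2,3)], rule bexI)
  show "a \<ominus>\<^bsub>F\<^esub> b \<in> K" unfolding tensor_ker_def by (rule subsetD[OF submodule_gen_superset assms(1)])
  show "a = (a \<ominus>\<^bsub>F\<^esub> b) \<oplus>\<^bsub>F\<^esub> b"
    using F.M.minus_add_cancel[OF assms(2,3)] F.M.a_comm[of "a \<ominus>\<^bsub>F\<^esub> b" b] assms(2,3)
    by (simp del: free_module_simps)
qed

lemma pure_closed: "u \<in> carrier M \<Longrightarrow> v \<in> carrier N \<Longrightarrow> pure_tensor R M N u v \<in> carrier (tensor R M N)"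
  unfolding pure_tensor_def tensor_carrier by (rule imageI) simp

lemma
  assumes "u \<in> carrier M" "v \<in> carrier N"
  shows pure_add_left: "u' \<in> carrier M \<Longrightarrow>
      pure_tensor R M N (u \<oplus>\<^bsub>M\<^esub> u') v = pure_tensor R M N u v \<oplus>\<^bsub>tensor R M N\<^esub> pure_tensor R M N u' v"
    and pure_add_right: "v' \<in> carrier N \<Longrightarrow>
      pure_tensor R M N u (v \<oplus>\<^bsub>N\<^esub> v') = pure_tensor R M N u v \<oplus>\<^bsub>tensor R M N\<^esub> pure_tensor R M N u v'"
    and pure_smult_left: "r \<in> carrier R \<Longrightarrow>
      pure_tensor R M N (r \<odot>\<^bsub>M\<^esub> u) v = r \<odot>\<^bsub>tensor R M N\<^esub> pure_tensor R M N u v"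
    and pure_smult_right: "r \<in> carrier R \<Longrightarrow>
      pure_tensor R M N u (r \<odot>\<^bsub>N\<^esub> v) = r \<odot>\<^bsub>tensor R M N\<^esub> pure_tensor R M N u v"
proof -
  let ?e = "free_basis R" and ?T = "tensor R M N"
  note q = module_homD(2,3)[OF tensor_proj_hom]
  have c: "?e (u, v) \<in> carrier F" using assms by simp
  show "pure_tensor R M N (u \<oplus>\<^bsub>M\<^esub> u') v = pure_tensor R M N u v \<oplus>\<^bsub>?T\<^esub> pure_tensor R M N u' v" if h: "u' \<in> carrier M"
  proof -
    have "?e (u \<oplus>\<^bsub>M\<^esub> u', v) \<ominus>\<^bsub>F\<^esub> (?e (u, v) \<oplus>\<^bsub>F\<^esub> ?e (u', v)) \<in> tensor_rel R M N"
      unfolding tensor_rel_def Let_def using assms h by blast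
    moreover have "?e (u \<oplus>\<^bsub>M\<^esub> u', v) \<in> carrier F" using assms h by simp
    moreover have c': "?e (u', v) \<in> carrier F" using assms h by simp
    moreover from c c' have "?e (u, v) \<oplus>\<^bsub>F\<^esub> ?e (u', v) \<in> carrier F" using h by (simp del: free_module_simps)
    ultimately show ?thesis
      unfolding pure_tensor_def q(1)[OF c c', symmetric] by (intro tensor_rel_eq)
  qed
  show "pure_tensor R M N u (v \<oplus>\<^bsub>N\<^esub> v') = pure_tensor R M N u v \<oplus>\<^bsub>?T\<^esub> pure_tensor R M N u v'" if h: "v' \<in> carrier N"
  proof -
    have "?e (u, v \<oplus>\<^bsub>N\<^esub> v') \<ominus>\<^bsub>F\<^esub> (?e (u, v) \<oplus>\<^bsub>F\<^esub> ?e (u, v')) \<in> tensor_rel R M N"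
      unfolding tensor_rel_def Let_def using assms h by blast
    moreover have "?e (u, v \<oplus>\<^bsub>N\<^esub> v') \<in> carrier F" using assms h by simp
    moreover have c': "?e (u, v') \<in> carrier F" using assms h by simp
    moreover from c c' have "?e (u, v) \<oplus>\<^bsub>F\<^esub> ?e (u, v') \<in> carrier F" using h by (simp del: free_module_simps)
    ultimately show ?thesis
      unfolding pure_tensor_def q(1)[OF c c', symmetric] by (intro tensor_rel_eq)
  qed
  show "pure_tensor R M N (r \<odot>\<^bsub>M\<^esub> u) v = r \<odot>\<^bsub>?T\<^esub> pure_tensor R M N u v" if h: "r \<in> carrier R"
  proof -
    have "?e (r \<odot>\<^bsub>M\<^esub> u, v) \<ominus>\<^bsub>F\<^esub> (r \<odot>\<^bsub>F\<^esub> ?e (u, v)) \<in> tensor_rel R M N"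
      unfolding tensor_rel_def Let_def using assms h by blast
    moreover have "?e (r \<odot>\<^bsub>M\<^esub> u, v) \<in> carrier F" using assms h by simp
    moreover have c': "?e (u, v) \<in> carrier F" using assms h by simp
    moreover from c c' have "r \<odot>\<^bsub>F\<^esub> ?e (u, v) \<in> carrier F" using h by (simp del: free_module_simps)
    ultimately show ?thesis
      unfolding pure_tensor_def q(2)[OF h c, symmetric] by (intro tensor_rel_eq)
  qed
  show "pure_tensor R M N u (r \<odot>\<^bsub>N\<^esub> v) = r \<odot>\<^bsub>?T\<^esub> pure_tensor R M N u v" if h: "r \<in> carrier R"
  proof -
    have "?e (u, r \<odot>\<^bsub>N\<^esub> v) \<ominus>\<^bsub>F\<^esub> (r \<odot>\<^bsub>F\<^esub> ?e (u, v)) \<in> tensor_rel R M N"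
      unfolding tensor_rel_def Let_def using assms h by blast
    moreover have "?e (u, r \<odot>\<^bsub>N\<^esub> v) \<in> carrier F" using assms h by simp
    moreover have c': "?e (u, v) \<in> carrier F" using assms h by simp
    moreover from c c' have "r \<odot>\<^bsub>F\<^esub> ?e (u, v) \<in> carrier F" using h by (simp del: free_module_simps)
    ultimately show ?thesis
      unfolding pure_tensor_def q(2)[OF h c, symmetric] by (intro tensor_rel_eq)
  qed
qed

lemma pure_hom_left:
  "v \<in> carrier N \<Longrightarrow> (\<lambda>u. pure_tensor R M N u v) \<in> module_hom R M (tensor R M N)"
  by (rule module_homI) (simp_all add: pure_closed pure_add_left pure_smult_left)

lemma pure_hom_right:
  "u \<in> carrier M \<Longrightarrow> pure_tensor R M N u \<in> module_hom R N (tensor R M N)"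
  by (rule module_homI) (simp_all add: pure_closed pure_add_right pure_smult_right)

lemma tensor_hom_eqI:
  assumes W: "module R W"
    and f: "f \<in> module_hom R (tensor R M N) W" and g: "g \<in> module_hom R (tensor R M N) W"
    and eq: "\<And>u v. u \<in> carrier M \<Longrightarrow> v \<in> carrier N \<Longrightarrow>
      f (pure_tensor R M N u v) = g (pure_tensor R M N u v)"
    and t: "t \<in> carrier (tensor R M N)"
  shows "f t = g t"
proof -
  obtain z where z: "z \<in> carrier F" "t = K +>\<^bsub>F\<^esub> z" using t by (auto simp: tensor_carrier)
  show ?thesis
    unfolding z(2)
    by (rule M.R.free_hom_eqI[OF module_hom_comp[OF tensor_proj_hom f]
          module_hom_comp[OF tensor_proj_hom g] W _ z(1)])
      (use eq in \<open>auto simp: pure_tensor_def\<close>)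
qed

text \<open>
  The universal property: the linear extension of \<open>g\<close> to the free module on pairs kills the defining
  relations, hence the submodule that they generate.
\<close>

lemma tensor_lift:
  assumes W: "module R W"
    and gl: "\<And>v. v \<in> carrier N \<Longrightarrow> (\<lambda>u. g u v) \<in> module_hom R M W"
    and gr: "\<And>u. u \<in> carrier M \<Longrightarrow> g u \<in> module_hom R N W"
  obtains G where "G \<in> module_hom R (tensor R M N) W"
    and "\<And>u v. u \<in> carrier M \<Longrightarrow> v \<in> carrier N \<Longrightarrow> G (pure_tensor R M N u v) = g u v"
proof -
  interpret W: module R W by fact
  define l where "l = lin_ext R W (\<lambda>(u, v). g u v)"
  have gc: "(\<lambda>(u, v). g u v) \<in> carrier M \<times> carrier N \<rightarrow> carrier W"
    using module_homD(1)[OF gl] by auto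
  have l: "l \<in> module_hom R F W" unfolding l_def by (rule W.lin_ext_hom[OF gc])
  have le: "l (free_basis R (u, v)) = g u v" if "u \<in> carrier M" "v \<in> carrier N" for u v
    unfolding l_def using W.lin_ext_basis[OF gc, of "(u, v)"] that by simp
  note lm = module_hom_minus[OF F.module_axioms W l]
  have rel: "a \<ominus>\<^bsub>F\<^esub> b \<in> a_kernel F W l" if "a \<in> carrier F" "b \<in> carrier F" "l a = l b" for a b
    using that lm[OF that(1,2)] module_homD(1)[OF l that(2)] W.M.minus_eq_zero_iff
    unfolding a_kernel_def' by (simp del: free_module_simps)
  have "tensor_rel R M N \<subseteq> a_kernel F W l"
    unfolding tensor_rel_def Let_def
    by (intro Un_least subsetI; elim CollectE exE conjE; hypsubst; intro rel)
      (simp_all del: free_module_simps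
        add: le module_homD[OF l] module_homD[OF gl] module_homD[OF gr])
  then have "K \<subseteq> a_kernel F W l"
    unfolding tensor_ker_def by (rule submodule_gen_least[OF W.module_hom_kernel[OF F.module_axioms l]])
  then have "l h = \<zero>\<^bsub>W\<^esub>" if "h \<in> K" for h using that by (auto simp: a_kernel_def')
  then obtain G where G: "G \<in> module_hom R (quot_module F K) W"
    and Gq: "\<And>z. z \<in> carrier F \<Longrightarrow> G (K +>\<^bsub>F\<^esub> z) = l z"
    by (rule F.quot_lift[OF tensor_ker_submodule W l]) auto
  show ?thesis
  proof (rule that[of G])
    show "G \<in> module_hom R (tensor R M N) W" using G by (simp add: tensor_def)
  qed (auto simp: pure_tensor_def Gq le)
qed

end

text \<open>
  The linear extension in the definition of \<^const>\<open>tensor_map\<close> induces the map on tensor products given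
  by the universal property. Hence all members of the union in that definition are equal.
\<close>

lemma
  assumes R: "cring R" and M: "module R M" and M': "module R M'" and N: "module R N"
    and f: "f \<in> module_hom R M M'"
  shows tensor_map_hom: "tensor_map R M' N f \<in> module_hom R (tensor R M N) (tensor R M' N)"
    and tensor_map_pure: "\<And>u v. u \<in> carrier M \<Longrightarrow> v \<in> carrier N \<Longrightarrow>
      tensor_map R M' N f (pure_tensor R M N u v) = pure_tensor R M' N (f u) v"
proof -
  interpret MN: two_modules R M N using M N by (simp add: two_modules_def)
  interpret MN': two_modules R M' N using M' N by (simp add: two_modules_def)
  let ?l = "lin_ext R MN'.F (\<lambda>(u, v). free_basis R (f u, v))"
  have fc: "(\<lambda>(u, v). free_basis R (f u, v)) \<in> carrier M \<times> carrier N \<rightarrow> carrier MN'.F"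
    using module_homD(1)[OF f] by auto
  note l = MN'.F.lin_ext_hom[OF fc]
  obtain G where G: "G \<in> module_hom R (tensor R M N) (tensor R M' N)"
    and Gp: "\<And>u v. u \<in> carrier M \<Longrightarrow> v \<in> carrier N \<Longrightarrow>
      G (pure_tensor R M N u v) = pure_tensor R M' N (f u) v"
  proof (rule MN.tensor_lift[OF MN'.tensor_module, of "\<lambda>u v. pure_tensor R M' N (f u) v"])
    show "(\<lambda>u. pure_tensor R M' N (f u) v) \<in> module_hom R M (tensor R M' N)" if "v \<in> carrier N" for v
      by (rule module_hom_comp[OF f MN'.pure_hom_left[OF that]])
    show "pure_tensor R M' N (f u) \<in> module_hom R N (tensor R M' N)" if "u \<in> carrier M" for u
      by (rule MN'.pure_hom_right[OF module_homD(1)[OF f that]])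
  qed blast
  have lG: "MN'.K +>\<^bsub>MN'.F\<^esub> ?l z = G (MN.K +>\<^bsub>MN.F\<^esub> z)" if z: "z \<in> carrier MN.F" for z
  proof (rule MN.M.R.free_hom_eqI[OF module_hom_comp[OF l MN'.tensor_proj_hom]
        module_hom_comp[OF MN.tensor_proj_hom G] MN'.tensor_module _ z])
    fix b assume b: "b \<in> carrier M \<times> carrier N"
    then have "?l (free_basis R b) = (case b of (u, v) \<Rightarrow> free_basis R (f u, v))"
      by (rule MN'.F.lin_ext_basis[OF fc])
    then show "MN'.K +>\<^bsub>MN'.F\<^esub> ?l (free_basis R b) = G (MN.K +>\<^bsub>MN.F\<^esub> free_basis R b)"
      using b Gp unfolding pure_tensor_def by auto
  qed
  interpret K: abelian_subgroup MN.K MN.F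
    by (rule MN.F.submodule_abelian_subgroup[OF MN.tensor_ker_submodule])
  have eq: "tensor_map R M' N f t = G t" if t: "t \<in> carrier (tensor R M N)" for t
  proof -
    obtain z where z: "z \<in> carrier MN.F" "t = MN.K +>\<^bsub>MN.F\<^esub> z" using t by (auto simp: MN.tensor_carrier)
    have "MN'.K +>\<^bsub>MN'.F\<^esub> ?l w = G t" if w: "w \<in> t" for w
    proof -
      have wF: "w \<in> carrier MN.F"
        using w z(1) MN.F.M.a_r_coset_subset_G[OF K.a_subset] unfolding z(2) by blast
      have "MN.K +>\<^bsub>MN.F\<^esub> w = t"
        unfolding z(2) using MN.F.M.a_repr_independence[OF _ z(1) K.a_subgroup] w z(2) by simp
      then show ?thesis using lG[OF wF] by simp
    qed
    moreover have "z \<in> t" unfolding z(2) by (rule K.a_rcos_self[OF z(1)])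
    ultimately show ?thesis unfolding tensor_map_def Let_def by auto
  qed
  show "tensor_map R M' N f \<in> module_hom R (tensor R M N) (tensor R M' N)"
    using module_homD[OF G] MN.tensor_module
    by (intro module_homI) (simp_all add: eq module.smult_closed abelian_monoid.a_closed
        abelian_group.axioms(1) module.axioms(2))
  show "tensor_map R M' N f (pure_tensor R M N u v) = pure_tensor R M' N (f u) v"
    if "u \<in> carrier M" "v \<in> carrier N" for u v
    using that by (simp add: eq MN.pure_closed Gp)
qed

text \<open>
  The map that sends the vector with the single entry \<open>n\<close> at \<open>b\<close> to the tensor of \<open>b\<close> and \<open>n\<close>.
\<close>

definition free_tensor_iso ::
    "('a, 'k) ring_scheme \<Rightarrow> ('a, 'n, 'q) module_scheme \<Rightarrow> 'x set \<Rightarrow> ('x \<Rightarrow> 'n)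
      \<Rightarrow> (('x \<Rightarrow> 'a) \<times> 'n \<Rightarrow> 'a) set"
  where "free_tensor_iso R N X =
    dsum_ext N (tensor R (free_module R X) N) (\<lambda>b. pure_tensor R (free_module R X) N (free_basis R b))"

context module
begin

lemma two_modules_free: "two_modules R (free_module R X) M"
  by (simp add: two_modules_def R.free_module_module module_axioms)

text \<open>
  The inverse comes from the universal property applied to the bilinear map \<^const>\<open>scale\<close>; that the
  two maps are inverse to each other is checked on generators.
\<close>

lemma
  shows free_tensor_iso_hom:
      "free_tensor_iso R M X \<in> module_hom R (fsupp M X) (tensor R (free_module R X) M)"
    and free_tensor_iso_scale:
      "f \<in> carrier (free_module R X) \<Longrightarrow> n \<in> carrier M \<Longrightarrow>
        free_tensor_iso R M X (scale M f n) = pure_tensor R (free_module R X) M f n"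
    and free_tensor_iso_bij:
      "bij_betw (free_tensor_iso R M X) (vecs M X) (carrier (tensor R (free_module R X) M))"
proof -
  interpret T: two_modules R "free_module R X" M by (rule two_modules_free)
  let ?k = "free_tensor_iso R M X" and ?T = "tensor R (free_module R X) M"
  let ?p = "pure_tensor R (free_module R X) M"
  have h: "?p (free_basis R b) \<in> module_hom R M ?T" if "b \<in> X" for b
    by (rule T.pure_hom_right[OF R.free_basis_closed[OF that]])
  show k: "?k \<in> module_hom R (fsupp M X) ?T"
    unfolding free_tensor_iso_def by (rule dsum_ext_hom[OF T.tensor_module h])
  have ks: "?k (single M b n) = ?p (free_basis R b) n" if "b \<in> X" "n \<in> carrier M" for b n
    unfolding free_tensor_iso_def 
    by (rule dsum_ext_single[OF T.tensor_module _ that(2)]) (rule h[OF that(1)])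
  show kscale: "?k (scale M f n) = ?p f n"
    if f: "f \<in> carrier (free_module R X)" and n: "n \<in> carrier M" for f n
    by (rule R.free_hom_eqI[OF module_hom_comp[OF scale_hom_left[OF n] k] T.pure_hom_left[OF n]
          T.tensor_module _ f])
      (simp add: scale_free_basis n ks)
  obtain G where G: "G \<in> module_hom R ?T (fsupp M X)"
    and Gp: "\<And>f n. f \<in> carrier (free_module R X) \<Longrightarrow> n \<in> carrier M \<Longrightarrow> G (?p f n) = scale M f n"
    by (rule T.tensor_lift[OF fsupp_module, of "scale M"])
      (use scale_hom_left scale_hom_right in auto)
  have id: "(\<lambda>u. u) \<in> module_hom R W W" for W :: "('a, 'w) module" by (rule module_homI) auto
  have "G (?k v) = v" if "v \<in> vecs M X" for v
    by (rule fsupp_hom_eqI[OF module_hom_comp[OF k G] id fsupp_module _ that])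
      (simp add: ks Gp R.free_basis_closed scale_free_basis)
  moreover have "?k (G t) = t" if "t \<in> carrier ?T" for t
    by (rule T.tensor_hom_eqI[OF T.tensor_module module_hom_comp[OF G k] id _ that])
      (simp add: Gp kscale)
  ultimately show "bij_betw ?k (vecs M X) (carrier ?T)"
    using module_homD(1)[OF k] module_homD(1)[OF G]
    by (intro bij_betw_byWitness[where f' = G]) auto
qed

lemma free_tensor_iso_natural:
  assumes A: "is_mat R X C A" and f: "f \<in> module_hom R (free_module R X) (free_module R C)"
    and fA: "\<And>b. b \<in> X \<Longrightarrow> f (free_basis R b) = A b"
    and v: "v \<in> vecs M X"
  shows "tensor_map R (free_module R C) M f (free_tensor_iso R M X v) = free_tensor_iso R M C (mapp M A v)"
proof -
  interpret T: two_modules R "free_module R C" M by (rule two_modules_free)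
  note tm = R.is_cring R.free_module_module R.free_module_module module_axioms f
  show ?thesis
  proof (rule fsupp_hom_eqI[OF module_hom_comp[OF free_tensor_iso_hom tensor_map_hom[OF tm]]
        module_hom_comp[OF mapp_hom[OF A] free_tensor_iso_hom] T.tensor_module _ v])
    fix b n assume b: "b \<in> X" and n: "n \<in> carrier M"
    have "free_tensor_iso R M X (single M b n) = pure_tensor R (free_module R X) M (free_basis R b) n"
      using free_tensor_iso_scale[OF R.free_basis_closed[OF b] n] n by (simp add: scale_free_basis)
    moreover have "A b \<in> carrier (free_module R C)" using A b by (simp add: is_mat_def)
    ultimately show "tensor_map R (free_module R C) M f (free_tensor_iso R M X (single M b n)) =
        free_tensor_iso R M C (mapp M A (single M b n))"
      using b n by (simp add: tensor_map_pure[OF tm] R.free_basis_closed fA mapp_single[OF A]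
          free_tensor_iso_scale)
  qed
qed

end

section \<open>Free resolutions and Tor\<close>

abbreviation coeff_cycles where "coeff_cycles N B A \<equiv> cycles (\<lambda>i. fsupp N (B i)) (\<lambda>i. mapp N A)"

abbreviation coeff_boundaries
  where "coeff_boundaries N B A \<equiv> boundaries (\<lambda>i. fsupp N (B i)) (\<lambda>i. mapp N A)"

abbreviation coeff_homology
  where "coeff_homology N B A \<equiv> homology (\<lambda>i. fsupp N (B i)) (\<lambda>i. mapp N A)"

text \<open>
  A free resolution of \<open>M\<close> in coordinates: \<open>B i\<close> is a basis in degree \<open>i\<close>, the single matrix \<open>A\<close>
  describes the differentials in all degrees, and \<open>a\<close> is the augmentation on the basis in degree \<open>0\<close>.
\<close>

locale free_resolution = module R M for R (structure) and M (structure) +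
  fixes B :: "nat \<Rightarrow> 'x set" and A :: "'x \<Rightarrow> 'x \<Rightarrow> 'a" and a :: "'x \<Rightarrow> 'c"
  assumes mat: "is_mat R (B (Suc i)) (B i) A"
    and aug_closed: "a \<in> B 0 \<rightarrow> carrier M"
    and aug_surj: "carrier M \<subseteq> lin_ext R M a ` carrier (free_module R (B 0))"
    and exact: "mapp (self_module R) A ` carrier (free_module R (B (Suc i))) =
      {z \<in> carrier (free_module R (B i)). (i = 0 \<longrightarrow> lin_ext R M a z = \<zero>\<^bsub>M\<^esub>) \<and>
        (i \<noteq> 0 \<longrightarrow> mapp (self_module R) A z = (\<lambda>x. \<zero>))}"
begin

lemma mat_closed: "b \<in> B (Suc i) \<Longrightarrow> A b \<in> carrier (free_module R (B i))"
  using mat by (auto simp: is_mat_def)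

lemma boundary_of_basis: "b \<in> B (Suc i) \<Longrightarrow> A b \<in> mapp (self_module R) A ` carrier (free_module R (B (Suc i)))"
  using R.mapp_self_basis[OF mat, symmetric] R.free_basis_closed by (rule image_eqI)

lemma boundary_square: "b \<in> B (Suc (Suc i)) \<Longrightarrow> mapp (self_module R) A (A b) = (\<lambda>x. \<zero>)"
  using boundary_of_basis unfolding exact by auto

lemma aug_boundary: "b \<in> B (Suc 0) \<Longrightarrow> lin_ext R M a (A b) = \<zero>\<^bsub>M\<^esub>"
  using boundary_of_basis unfolding exact by auto

lemma aug_hom: "lin_ext R M a \<in> module_hom R (free_module R (B 0)) M"
  by (rule lin_ext_hom[OF aug_closed])

lemma coeff_complex:
  assumes N: "module R N"
  shows "chain_complex R (\<lambda>i. fsupp N (B i)) (\<lambda>i. mapp N A)"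
proof -
  interpret N: module R N by fact
  have "mapp N A (mapp N A z) = (\<lambda>x. \<zero>\<^bsub>N\<^esub>)" if z: "z \<in> vecs N (B (Suc (Suc i)))" for i z
  proof -
    have "is_mat R (B (Suc (Suc i))) (B i) (matmul R A A)" by (rule matmul_is_mat[OF mat mat])
    moreover have "matmul R A A b = (\<lambda>x. \<zero>)" if "b \<in> B (Suc (Suc i))" for b
      using boundary_square[OF that] by (simp add: matmul_def)
    ultimately have "mapp N (matmul R A A) z = mapp N (\<lambda>b x. \<zero>) z"
      using z by (intro N.mapp_cong[where X = "B (Suc (Suc i))"]) auto
    also have "\<dots> = (\<lambda>x. \<zero>\<^bsub>N\<^esub>)"
    proof -
      have 0: "is_mat R (B (Suc (Suc i))) (B i) (\<lambda>b x. \<zero>)" by (simp add: is_mat_def free_module_carrier)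
      have z0: "(\<lambda>u x. \<zero>\<^bsub>N\<^esub>) \<in> module_hom R (fsupp N (B (Suc (Suc i)))) (fsupp N (B i))"
        by (rule module_homI) (auto simp: fsupp_carrier)
      show ?thesis
        by (rule N.fsupp_hom_eqI[OF N.mapp_hom[OF 0] z0 N.fsupp_module _ z])
          (simp add: N.mapp_single[OF 0] scale_def)
    qed
    finally show ?thesis using N.mapp_comp[OF mat mat z] by simp
  qed
  then show ?thesis
    unfolding chain_complex_def using N.fsupp_module N.mapp_hom[OF mat] by auto
qed

text \<open>
  Right exactness of the tensor product. The inverse isomorphism sends \<open>u \<otimes> n\<close> to the class of
  \<open>z \<otimes> n\<close>, where \<open>z\<close> is any vector that the augmentation sends to \<open>u\<close>.
\<close>

lemma homology_zero_iso_tensor: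
  assumes N: "module R N"
  shows "module_iso R (coeff_homology N B A 0) (tensor R M N)"
proof -
  interpret N: module R N by fact
  interpret T: two_modules R M N using N by (simp add: two_modules_def module_axioms)
  interpret C0: module R "fsupp N (B 0)" by (rule N.fsupp_module)
  let ?T = "tensor R M N" and ?aug = "lin_ext R M a" and ?p = "pure_tensor R M N"
  define H where "H = mapp N A ` vecs N (B (Suc 0))"
  define Q where "Q = quot_module (fsupp N (B 0)) H"
  define q where "q = (\<lambda>z. H +>\<^bsub>fsupp N (B 0)\<^esub> z)"
  have H: "submodule H R (fsupp N (B 0))"
    unfolding H_def by (rule module_hom_image_submodule[OF N.fsupp_module N.fsupp_module N.mapp_hom[OF mat]])
  have Q: "module R Q" unfolding Q_def by (rule C0.quot_module_module[OF H])
  have q: "q \<in> module_hom R (fsupp N (B 0)) Q" unfolding Q_def q_def by (rule C0.quot_proj_hom[OF H])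
  interpret Q: module R Q by (rule Q)
  have q0: "q z = \<zero>\<^bsub>Q\<^esub> \<longleftrightarrow> z \<in> H" if "z \<in> vecs N (B 0)" for z
    unfolding Q_def q_def by (rule C0.quot_eq_zero_iff[OF H that])
  have ah: "?p (a b) \<in> module_hom R N ?T" if "b \<in> B 0" for b
    using T.pure_hom_right aug_closed that by auto
  define f where "f = dsum_ext N ?T (\<lambda>b. ?p (a b))"
  have f: "f \<in> module_hom R (fsupp N (B 0)) ?T"
    unfolding f_def by (rule N.dsum_ext_hom[OF T.tensor_module ah])
  have fs: "f (scale N z n) = ?p (?aug z) n"
    if z: "z \<in> carrier (free_module R (B 0))" and n: "n \<in> carrier N" for z n
  proof (rule R.free_hom_eqI[OF module_hom_comp[OF N.scale_hom_left[OF n] f]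
        module_hom_comp[OF aug_hom T.pure_hom_left[OF n]] T.tensor_module _ z])
    fix b assume b: "b \<in> B 0"
    have "f (single N b n) = ?p (a b) n"
      unfolding f_def by (rule N.dsum_ext_single[OF T.tensor_module _ n]) (rule ah[OF b])
    then show "f (scale N (free_basis R b) n) = ?p (?aug (free_basis R b)) n"
      using n lin_ext_basis[OF aug_closed b] by (simp add: N.scale_free_basis)
  qed
  have qs0: "q (scale N z n) = \<zero>\<^bsub>Q\<^esub>"
    if z: "z \<in> carrier (free_module R (B 0))" "?aug z = \<zero>\<^bsub>M\<^esub>" and n: "n \<in> carrier N" for z n
  proof -
    have "z \<in> mapp (self_module R) A ` carrier (free_module R (B (Suc 0)))"
      unfolding exact using z by simp
    then obtain w where w: "w \<in> carrier (free_module R (B (Suc 0)))" "z = mapp (self_module R) A w"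
      by auto
    then have "scale N z n = mapp N A (scale N w n)" using N.mapp_scale[OF mat w(1) n] by simp
    moreover have "scale N w n \<in> vecs N (B (Suc 0))" by (rule N.scale_closed[OF w(1) n])
    ultimately have "scale N z n \<in> H" by (auto simp: H_def)
    then show ?thesis using q0[OF N.scale_closed[OF z(1) n]] by simp
  qed
  have qs: "q (scale N z n) = q (scale N z' n)"
    if z: "z \<in> carrier (free_module R (B 0))" "z' \<in> carrier (free_module R (B 0))" "?aug z = ?aug z'"
      and n: "n \<in> carrier N" for z z' n
  proof -
    have F0: "module R (free_module R (B 0))" by (rule R.free_module_module)
    interpret F0: module R "free_module R (B 0)" by (rule F0)
    have h: "(\<lambda>z. q (scale N z n)) \<in> module_hom R (free_module R (B 0)) Q"
      by (rule module_hom_comp[OF N.scale_hom_left[OF n] q])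
    have "?aug (z \<ominus>\<^bsub>free_module R (B 0)\<^esub> z') = \<zero>\<^bsub>M\<^esub>"
      using z module_homD(1)[OF aug_hom z(2)] M.minus_eq_zero_iff
      by (simp add: module_hom_minus[OF F0 module_axioms aug_hom])
    then have "q (scale N (z \<ominus>\<^bsub>free_module R (B 0)\<^esub> z') n) = \<zero>\<^bsub>Q\<^esub>"
      using z n by (intro qs0) auto
    then show ?thesis
      using module_hom_minus[OF F0 Q h z(1,2)] module_homD(1)[OF h z(1)] module_homD(1)[OF h z(2)]
        Q.M.minus_eq_zero_iff by simp
  qed
  define s where "s u = (SOME z. z \<in> carrier (free_module R (B 0)) \<and> ?aug z = u)" for u
  have s: "s u \<in> carrier (free_module R (B 0))" "?aug (s u) = u" if "u \<in> carrier M" for u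
  proof -
    have "\<exists>z. z \<in> carrier (free_module R (B 0)) \<and> ?aug z = u" using aug_surj that by auto
    from someI_ex[OF this] show "s u \<in> carrier (free_module R (B 0))" "?aug (s u) = u"
      unfolding s_def by auto
  qed
  obtain G where G: "G \<in> module_hom R ?T Q"
    and Gp: "\<And>u n. u \<in> carrier M \<Longrightarrow> n \<in> carrier N \<Longrightarrow> G (?p u n) = q (scale N (s u) n)"
  proof (rule T.tensor_lift[OF Q, of "\<lambda>u n. q (scale N (s u) n)"])
    show "(\<lambda>n. q (scale N (s u) n)) \<in> module_hom R N Q" if "u \<in> carrier M" for u
      by (rule module_hom_comp[OF N.scale_hom_right[OF s(1)[OF that]] q])
    fix n assume n: "n \<in> carrier N"
    have h: "(\<lambda>z. q (scale N z n)) \<in> module_hom R (free_module R (B 0)) Q"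
      by (rule module_hom_comp[OF N.scale_hom_left[OF n] q])
    interpret F0: module R "free_module R (B 0)" by (rule R.free_module_module)
    show "(\<lambda>u. q (scale N (s u) n)) \<in> module_hom R M Q"
    proof (rule module_homI)
      fix u assume u: "u \<in> carrier M"
      show "q (scale N (s u) n) \<in> carrier Q" by (rule module_homD(1)[OF h s(1)[OF u]])
      show "q (scale N (s (r \<odot>\<^bsub>M\<^esub> u)) n) = r \<odot>\<^bsub>Q\<^esub> q (scale N (s u) n)" if r: "r \<in> carrier R" for r
        unfolding module_homD(3)[OF h r s(1)[OF u], symmetric]
        by (rule qs) (use r u s n module_homD(3)[OF aug_hom] in \<open>simp_all del: free_module_simps\<close>)
      show "q (scale N (s (u \<oplus>\<^bsub>M\<^esub> v)) n) = q (scale N (s u) n) \<oplus>\<^bsub>Q\<^esub> q (scale N (s v) n)"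
        if v: "v \<in> carrier M" for v
        unfolding module_homD(2)[OF h s(1)[OF u] s(1)[OF v], symmetric]
        by (rule qs) (use v u s n module_homD(2)[OF aug_hom] in \<open>simp_all del: free_module_simps\<close>)
    qed
  qed blast
  have fH: "f h = \<zero>\<^bsub>?T\<^esub>" if hH: "h \<in> H" for h
  proof -
    obtain w where w: "w \<in> vecs N (B (Suc 0))" "h = mapp N A w"
      using hH by (auto simp: H_def)
    have z0: "(\<lambda>u. \<zero>\<^bsub>?T\<^esub>) \<in> module_hom R (fsupp N (B (Suc 0))) ?T"
      using T.tensor_module
      by (intro module_homI) (auto simp: module.smult_r_null abelian_monoid.l_zero
          abelian_monoid.zero_closed abelian_group.axioms(1) module.axioms(2))
    have "f (mapp N A w) = \<zero>\<^bsub>?T\<^esub>"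
    proof (rule N.fsupp_hom_eqI[OF module_hom_comp[OF N.mapp_hom[OF mat] f] z0 T.tensor_module _ w(1)])
      fix b n assume b: "b \<in> B (Suc 0)" and n: "n \<in> carrier N"
      show "f (mapp N A (single N b n)) = \<zero>\<^bsub>?T\<^esub>"
        using module_hom_zero[OF module_axioms T.tensor_module T.pure_hom_left[OF n]]
        by (simp add: N.mapp_single[OF mat b n] fs[OF mat_closed[OF b] n] aug_boundary[OF b])
    qed
    then show ?thesis using w by simp
  qed
  obtain F where F: "F \<in> module_hom R Q ?T"
    and Fq: "\<And>z. z \<in> vecs N (B 0) \<Longrightarrow> F (q z) = f z"
    unfolding Q_def q_def by (rule C0.quot_lift[OF H T.tensor_module f fH]) auto
  have id: "(\<lambda>u. u) \<in> module_hom R W W" for W :: "('a, 'w) module" by (rule module_homI) auto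
  have "module_iso R Q ?T"
  proof (rule module_isoI[OF F G])
    fix t assume t: "t \<in> carrier ?T"
    show "F (G t) = t"
      by (rule T.tensor_hom_eqI[OF T.tensor_module module_hom_comp[OF G F] id _ t])
        (simp add: Gp Fq N.scale_closed s fs)
  next
    fix X assume "X \<in> carrier Q"
    then obtain z where z: "z \<in> vecs N (B 0)" "X = q z"
      by (auto simp: Q_def q_def C0.quot_carrier)
    have "G (F (q z)) = q z"
    proof (rule N.fsupp_hom_eqI[OF module_hom_comp[OF q module_hom_comp[OF F G]] q Q _ z(1)])
      fix b n assume b: "b \<in> B 0" and n: "n \<in> carrier N"
      note e = R.free_basis_closed[OF b]
      have ab: "a b \<in> carrier M" "?aug (free_basis R b) = a b"
        using aug_closed b lin_ext_basis[OF aug_closed b] by auto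
      have "G (F (q (scale N (free_basis R b) n))) = q (scale N (s (a b)) n)"
        using ab e n by (simp add: Fq N.scale_closed fs Gp)
      also have "\<dots> = q (scale N (free_basis R b) n)"
        by (rule qs) (use s ab e n in auto)
      finally show "G (F (q (single N b n))) = q (single N b n)" using n by (simp add: N.scale_free_basis)
    qed
    then show "G (F X) = X" using z by simp
  qed
  then show ?thesis by (simp add: Q_def H_def)
qed

end

definition syz_mat :: "('a, 'k) ring_scheme \<Rightarrow> ('a, 'm) syz \<Rightarrow> ('a, 'm) syz \<Rightarrow> 'a"
  where "syz_mat R b = (case b of Gen u \<Rightarrow> (\<lambda>x. \<zero>\<^bsub>R\<^esub>) | Rel l \<Rightarrow> formal_sum R l)"

definition syz_gen :: "('a, 'm, 'p) module_scheme \<Rightarrow> ('a, 'm) syz \<Rightarrow> 'm"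
  where "syz_gen M b = (case b of Gen u \<Rightarrow> u | Rel l \<Rightarrow> \<zero>\<^bsub>M\<^esub>)"

declare syz_basis.simps [simp del]

lemma syz_mat_eq:
  "(\<lambda>b. case b of Gen u \<Rightarrow> \<zero>\<^bsub>free_module R UNIV\<^esub> | Rel l \<Rightarrow> formal_sum R l) = syz_mat R"
  by (simp add: syz_mat_def fun_eq_iff split: syz.split)

lemma (in cring) syz_mat_is_mat: "is_mat R (syz_basis R M (Suc n)) (syz_basis R M n) (syz_mat R)"
  unfolding is_mat_def syz_mat_eq[symmetric] using formal_sum_Rel_closed[of _ M n]
  unfolding syz_module_def by blast

lemma (in cring) syz_bd_eq_mapp:
  assumes "f \<in> carrier (syz_module R M (Suc n))"
  shows "syz_bd R f = mapp (self_module R) (syz_mat R) f"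
  using syz_bd_eq[OF assms] lin_ext_eq_mapp[OF syz_mat_is_mat, of f M n] assms
  unfolding syz_mat_eq syz_module_def by simp

lemma (in module) syz_free_resolution:
  "free_resolution R M (syz_basis R M) (syz_mat R) (syz_gen M)"
proof
  show "is_mat R (syz_basis R M (Suc i)) (syz_basis R M i) (syz_mat R)" for i
    by (rule R.syz_mat_is_mat)
  show "syz_gen M \<in> syz_basis R M 0 \<rightarrow> carrier M" by (auto simp: syz_gen_def syz_basis.simps)
  have aug: "syz_aug R M = lin_ext R M (syz_gen M)" by (simp add: syz_aug_def syz_gen_def[abs_def])
  show "carrier M \<subseteq> lin_ext R M (syz_gen M) ` carrier (free_module R (syz_basis R M 0))"
    using syz_aug_surj unfolding aug syz_module_def by simp
  have im: "mapp (self_module R) (syz_mat R) ` carrier (free_module R (syz_basis R M (Suc i))) =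
      syz_bd R ` carrier (syz_module R M (Suc i))" for i
    by (rule image_cong) (simp_all only: syz_module_def R.syz_bd_eq_mapp[unfolded syz_module_def])
  show "mapp (self_module R) (syz_mat R) ` carrier (free_module R (syz_basis R M (Suc i))) =
      {z \<in> carrier (free_module R (syz_basis R M i)).
        (i = 0 \<longrightarrow> lin_ext R M (syz_gen M) z = \<zero>\<^bsub>M\<^esub>) \<and>
        (i \<noteq> 0 \<longrightarrow> mapp (self_module R) (syz_mat R) z = (\<lambda>x. \<zero>))}" for i
  proof (cases i)
    case 0
    then show ?thesis
      unfolding im using syz_resolution(4) by (simp add: a_kernel_def' aug syz_module_def)
  next
    case (Suc j)
    have "syz_bd R ` carrier (syz_module R M (Suc (Suc j))) =
        {z \<in> carrier (syz_module R M (Suc j)). syz_bd R z = (\<lambda>x. \<zero>)}"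
      using syz_resolution(5)[of j] by (simp add: a_kernel_def' syz_module_def)
    also have "\<dots> = {z \<in> carrier (free_module R (syz_basis R M (Suc j))).
        mapp (self_module R) (syz_mat R) z = (\<lambda>x. \<zero>)}"
      using R.syz_bd_eq_mapp[of _ M j] unfolding syz_module_def by auto
    finally show ?thesis unfolding im using Suc by simp
  qed
qed

text \<open>Tor, with its tensor products with free modules written as modules of vectors.\<close>

abbreviation syz_homology ::
    "('a, 'k) ring_scheme \<Rightarrow> ('a, 'm, 'p) module_scheme \<Rightarrow> ('a, 'n, 'q) module_scheme \<Rightarrow> nat
      \<Rightarrow> ('a, (('a, 'm) syz \<Rightarrow> 'n) set) module"
  where "syz_homology R M N \<equiv> coeff_homology N (syz_basis R M) (syz_mat R)"

text \<open>
  By naturality the isomorphisms \<^const>\<open>free_tensor_iso\<close> identify the complex that defines Tor with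
  the complex of vectors.
\<close>

lemma
  assumes M: "module R M" and N: "module R N"
  shows Tor_iso: "module_iso R (syz_homology R M N i) (Tor R M N i)"
    and Tor_module: "module R (Tor R M N i)"
    and syz_homology_module: "module R (syz_homology R M N i)"
proof -
  interpret M: module R M by fact
  interpret N: module R N by fact
  interpret P: free_resolution R M "syz_basis R M" "syz_mat R" "syz_gen M" by (rule M.syz_free_resolution)
  let ?C = "\<lambda>i. fsupp N (syz_basis R M i)" and ?d = "\<lambda>i::nat. mapp N (syz_mat R)"
  let ?C' = "\<lambda>i. tensor R (syz_module R M i) N"
  let ?d' = "\<lambda>i. tensor_map R (syz_module R M i) N (syz_bd R)"
  define k where "k i = free_tensor_iso R N (syz_basis R M i)" for i
  have C: "chain_complex R ?C ?d" by (rule P.coeff_complex[OF N])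
  have k: "k i \<in> module_hom R (?C i) (?C' i)" for i
    unfolding k_def syz_module_def by (rule N.free_tensor_iso_hom)
  have kb: "bij_betw (k i) (carrier (?C i)) (carrier (?C' i))" for i
    unfolding k_def syz_module_def by (rule N.free_tensor_iso_bij)
  have C'm: "module R (?C' i)" for i
    unfolding syz_module_def by (rule two_modules.tensor_module[OF N.two_modules_free])
  have Cm: "module R (?C i)" for i by (rule N.fsupp_module)
  have nat: "?d' i (k (Suc i) v) = k i (?d i v)" if v: "v \<in> carrier (?C (Suc i))" for i v
    unfolding k_def syz_module_def
  proof (rule N.free_tensor_iso_natural[OF M.R.syz_mat_is_mat _ _ v])
    show "syz_bd R \<in> module_hom R (free_module R (syz_basis R M (Suc i))) (free_module R (syz_basis R M i))"
      using M.R.syz_bd_hom unfolding syz_module_def by blast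
    fix b assume b: "b \<in> syz_basis R M (Suc i)"
    show "syz_bd R (free_basis R b) = syz_mat R b"
      using M.R.mapp_self_basis[OF M.R.syz_mat_is_mat b] M.R.free_basis_closed[OF b]
      by (subst M.R.syz_bd_eq_mapp[of _ M i]) (simp_all add: syz_module_def)
  qed
  have surj: "\<exists>v\<in>carrier (?C i). t = k i v" if "t \<in> carrier (?C' i)" for t i
    using kb[of i] that unfolding bij_betw_def by auto
  have d': "?d' i \<in> module_hom R (?C' (Suc i)) (?C' i)" for i
    by (rule tensor_map_hom[OF M.R.is_cring _ _ N M.R.syz_bd_hom]) (simp_all add: syz_module_def M.R.free_module_module)
  have k0: "k i v = \<zero>\<^bsub>?C' i\<^esub> \<longleftrightarrow> v = \<zero>\<^bsub>?C i\<^esub>" if "v \<in> carrier (?C i)" for i v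
  proof -
    interpret Ci: module R "?C i" by (rule Cm)
    have "k i \<zero>\<^bsub>?C i\<^esub> = \<zero>\<^bsub>?C' i\<^esub>" by (rule module_hom_zero[OF Cm C'm k])
    then show ?thesis
      using inj_onD[OF bij_betw_imp_inj_on[OF kb[of i]], of v "\<zero>\<^bsub>?C i\<^esub>"] that Ci.M.zero_closed by metis
  qed
  have C': "chain_complex R ?C' ?d'"
  proof -
    have "?d' i (?d' (Suc i) t) = \<zero>\<^bsub>?C' i\<^esub>" if t: "t \<in> carrier (?C' (Suc (Suc i)))" for i t
    proof -
      obtain v where v: "v \<in> carrier (?C (Suc (Suc i)))" "t = k (Suc (Suc i)) v" using surj[OF t] by blast
      have dv: "?d (Suc i) v \<in> carrier (?C (Suc i))" "?d i (?d (Suc i) v) = \<zero>\<^bsub>?C i\<^esub>"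
        using C v(1) module_homD(1)[of "?d (Suc i)" R "?C (Suc (Suc i))" "?C (Suc i)"]
        unfolding chain_complex_def by auto
      have "?d' i (?d' (Suc i) t) = k i (?d i (?d (Suc i) v))"
        unfolding v(2) nat[OF v(1)] by (rule nat[OF dv(1)])
      then show ?thesis using dv(2) module_hom_zero[OF Cm C'm k] by simp
    qed
    then show ?thesis unfolding chain_complex_def using C'm d' by blast
  qed
  have cyc: "k i v \<in> cycles ?C' ?d' i \<longleftrightarrow> v \<in> cycles ?C ?d i" if v: "v \<in> carrier (?C i)" for v
  proof (cases i)
    case 0
    then show ?thesis using v module_homD(1)[OF k v] by (simp add: cycles_def)
  next
    case (Suc j)
    have "?d j v \<in> carrier (?C j)" using N.mapp_hom[OF M.R.syz_mat_is_mat] v Suc module_homD(1) by fast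
    then show ?thesis
      using v module_homD(1)[OF k v] nat[of v j] k0[of "?d j v" j] unfolding cycles_def Suc by simp
  qed
  have cycC: "z \<in> carrier (?C i)" if "z \<in> cycles ?C ?d i" for z using that by (simp add: cycles_def)
  have iso: "module_iso R (syz_homology R M N i) (homology ?C' ?d' i)"
  proof (rule homology_isoI[OF C C' k])
    fix z assume z: "z \<in> cycles ?C ?d i"
    then show "k i z \<in> cycles ?C' ?d' i" using cyc cycC by blast
    show "k i z \<in> boundaries ?C' ?d' i \<longleftrightarrow> z \<in> boundaries ?C ?d i"
    proof
      assume "z \<in> boundaries ?C ?d i"
      then obtain w where w: "w \<in> carrier (?C (Suc i))" "z = ?d i w" by (auto simp: boundaries_def)
      then have "k i z = ?d' i (k (Suc i) w)" using nat by simp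
      then show "k i z \<in> boundaries ?C' ?d' i"
        unfolding boundaries_def using module_homD(1)[OF k w(1)] by blast
    next
      assume "k i z \<in> boundaries ?C' ?d' i"
      then obtain t where "t \<in> carrier (?C' (Suc i))" "k i z = ?d' i t" by (auto simp: boundaries_def)
      then obtain w where w: "w \<in> carrier (?C (Suc i))" "k i z = k i (?d i w)"
        using surj nat by metis
      moreover have "?d i w \<in> carrier (?C i)"
        using module_homD(1)[OF N.mapp_hom[OF M.R.syz_mat_is_mat] w(1)] .
      ultimately have "z = ?d i w"
        using inj_onD[OF bij_betw_imp_inj_on[OF kb[of i]]] cycC[OF z] by blast
      then show "z \<in> boundaries ?C ?d i" using w(1) by (auto simp: boundaries_def)
    qed
  next
    fix t assume t: "t \<in> cycles ?C' ?d' i"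
    then have "t \<in> carrier (?C' i)" by (simp add: cycles_def)
    then obtain v where v: "v \<in> carrier (?C i)" "t = k i v" using surj by blast
    interpret Ci: module R "?C' i" by (rule C'm)
    have "\<zero>\<^bsub>?C' i\<^esub> \<in> boundaries ?C' ?d' i"
      using subgroup.one_closed[OF submodule.axioms(1)[OF boundaries_submodule[OF C']]] by simp
    moreover have "t = \<zero>\<^bsub>?C' i\<^esub> \<oplus>\<^bsub>?C' i\<^esub> k i v" using v module_homD(1)[OF k v(1)] by simp
    moreover have "v \<in> cycles ?C ?d i" using cyc v t by blast
    ultimately show "\<exists>z\<in>cycles ?C ?d i. \<exists>h\<in>boundaries ?C' ?d' i. t = h \<oplus>\<^bsub>?C' i\<^esub> k i z" by blast
  qed
  show "module_iso R (syz_homology R M N i) (Tor R M N i)" unfolding Tor_def by (rule iso)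
  show "module R (Tor R M N i)" unfolding Tor_def by (rule homology_module[OF C'])
  show "module R (syz_homology R M N i)" by (rule homology_module[OF C])
qed

section \<open>Comparison of free resolutions\<close>

context free_resolution
begin

definition syzygies :: "nat \<Rightarrow> ('x \<Rightarrow> 'a) set"
  where "syzygies i = {z \<in> carrier (free_module R (B i)). (i = 0 \<longrightarrow> lin_ext R M a z = \<zero>\<^bsub>M\<^esub>) \<and>
    (i \<noteq> 0 \<longrightarrow> mapp (self_module R) A z = (\<lambda>x. \<zero>))}"

lemma syzygies_lift:
  assumes "z \<in> syzygies i"
  shows "\<exists>w\<in>carrier (free_module R (B (Suc i))). mapp (self_module R) A w = z"
  using assms exact[of i] unfolding syzygies_def by (metis (no_types, lifting) imageE)

lemma mat_lift:
  assumes "\<And>b. b \<in> X \<Longrightarrow> F b \<in> syzygies i"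
  shows "\<exists>G. is_mat R X (B (Suc i)) G \<and> (\<forall>b\<in>X. mapp (self_module R) A (G b) = F b)"
proof -
  have "\<forall>b\<in>X. \<exists>w. w \<in> carrier (free_module R (B (Suc i))) \<and> mapp (self_module R) A w = F b"
    using syzygies_lift[OF assms] by blast
  from bchoice[OF this] show ?thesis unfolding is_mat_def by blast
qed

lemma boundary_hom: "mapp (self_module R) A \<in> module_hom R (free_module R (B (Suc i))) (free_module R (B i))"
  using module.mapp_hom[OF R.self_module_module mat] by (simp add: free_module_eq)

end

lemma (in cring) mapp_self_hom:
  "is_mat R X C A \<Longrightarrow> mapp (self_module R) A \<in> module_hom R (free_module R X) (free_module R C)"
  using module.mapp_hom[OF self_module_module] by (simp add: free_module_eq)

locale two_resolutions =
  P: free_resolution R M B A a + Q: free_resolution R M B' A' a'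
  for R (structure) and M (structure) and B A a B' A' a'
begin

definition chain_lift :: "(nat \<Rightarrow> _ \<Rightarrow> _ \<Rightarrow> _) \<Rightarrow> bool"
  where "chain_lift f \<longleftrightarrow> (\<forall>i. is_mat R (B i) (B' i) (f i)) \<and>
    (\<forall>b\<in>B 0. lin_ext R M a' (f 0 b) = a b) \<and>
    (\<forall>i. \<forall>b\<in>B (Suc i). mapp (self_module R) A' (f (Suc i) b) = mapp (self_module R) (f i) (A b))"

lemma aug_lift_vec:
  assumes f: "is_mat R (B 0) (B' 0) f0" "\<forall>b\<in>B 0. lin_ext R M a' (f0 b) = a b"
    and z: "z \<in> carrier (free_module R (B 0))"
  shows "lin_ext R M a' (mapp (self_module R) f0 z) = lin_ext R M a z"
proof (rule P.R.free_hom_eqI[OF module_hom_comp[OF P.R.mapp_self_hom[OF f(1)] Q.aug_hom]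
      P.aug_hom P.module_axioms _ z])
  fix b assume b: "b \<in> B 0"
  show "lin_ext R M a' (mapp (self_module R) f0 (free_basis R b)) = lin_ext R M a (free_basis R b)"
    using f b P.lin_ext_basis[OF P.aug_closed b] P.R.mapp_self_basis[OF f(1) b] by simp
qed

text \<open>
  The columns are chosen degree by degree. The invariant kept is that the composite with the
  differential of the source consists of cycles; exactness of the target then gives the next step.
\<close>

lemma chain_lift_exists: "\<exists>f. chain_lift f"
proof -
  define ok where "ok i f \<longleftrightarrow> is_mat R (B i) (B' i) f \<and>
    (\<forall>b\<in>B (Suc i). mapp (self_module R) f (A b) \<in> Q.syzygies i) \<and>
    (i = 0 \<longrightarrow> (\<forall>b\<in>B 0. lin_ext R M a' (f b) = a b))" for i f
  have "\<exists>f. ok 0 f"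
  proof -
    have "\<forall>b\<in>B 0. \<exists>w. w \<in> carrier (free_module R (B' 0)) \<and> lin_ext R M a' w = a b"
      using Q.aug_surj P.aug_closed by (fastforce simp: Pi_iff)
    from bchoice[OF this] obtain f where f: "is_mat R (B 0) (B' 0) f" "\<forall>b\<in>B 0. lin_ext R M a' (f b) = a b"
      unfolding is_mat_def by blast
    have "mapp (self_module R) f (A b) \<in> Q.syzygies 0" if b: "b \<in> B (Suc 0)" for b
      using module_homD(1)[OF P.R.mapp_self_hom[OF f(1)] P.mat_closed[OF b]]
        aug_lift_vec[OF f P.mat_closed[OF b]] P.aug_boundary[OF b] by (simp add: Q.syzygies_def)
    with f show ?thesis unfolding ok_def by blast
  qed
  moreover have "\<exists>g. ok (Suc i) g \<and> (\<forall>b\<in>B (Suc i). mapp (self_module R) A' (g b) = mapp (self_module R) f (A b))"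
    if f: "ok i f" for i f
  proof -
    interpret S: module R "self_module R" by (rule P.R.self_module_module)
    have fm: "is_mat R (B i) (B' i) f" using f by (simp add: ok_def)
    obtain g where g: "is_mat R (B (Suc i)) (B' (Suc i)) g"
      and gA: "\<forall>b\<in>B (Suc i). mapp (self_module R) A' (g b) = mapp (self_module R) f (A b)"
      using Q.mat_lift[of "B (Suc i)" "\<lambda>b. mapp (self_module R) f (A b)" i] f unfolding ok_def by blast
    have gfA: "mapp (self_module R) A' (mapp (self_module R) g z) = mapp (self_module R) f (mapp (self_module R) A z)"
      if "z \<in> carrier (free_module R (B (Suc i)))" for z
    proof -
      note z = that[unfolded free_module_eq]
      have "mapp (self_module R) (matmul R A' g) z = mapp (self_module R) (matmul R f A) z"
        by (rule S.mapp_cong[OF _ S.matmul_is_mat[OF g Q.mat] z]) (use gA in \<open>simp add: matmul_def\<close>)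
      then show ?thesis by (simp add: S.mapp_comp[OF g Q.mat z] S.mapp_comp[OF P.mat fm z])
    qed
    have "mapp (self_module R) g (A b) \<in> Q.syzygies (Suc i)" if b: "b \<in> B (Suc (Suc i))" for b
      using gfA[OF P.mat_closed[OF b]] module_homD(1)[OF P.R.mapp_self_hom[OF g] P.mat_closed[OF b]]
        P.boundary_square[OF b] module_hom_zero[OF P.R.free_module_module P.R.free_module_module P.R.mapp_self_hom[OF fm]]
      by (simp add: Q.syzygies_def)
    with g gA show ?thesis unfolding ok_def by blast
  qed
  ultimately obtain f where "\<forall>i. ok i (f i) \<and>
      (\<forall>b\<in>B (Suc i). mapp (self_module R) A' (f (Suc i) b) = mapp (self_module R) (f i) (A b))"
    using dependent_nat_choice[of ok "\<lambda>i f g. \<forall>b\<in>B (Suc i). mapp (self_module R) A' (g b) = mapp (self_module R) f (A b)"]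
    by blast
  then show ?thesis unfolding ok_def chain_lift_def by blast
qed

lemma chain_lift_commute:
  assumes f: "chain_lift f" and N: "module R N" and v: "v \<in> vecs N (B (Suc i))"
  shows "mapp N A' (mapp N (f (Suc i)) v) = mapp N (f i) (mapp N A v)"
proof -
  interpret N: module R N by fact
  have m: "is_mat R (B i) (B' i) (f i)" for i using f by (simp add: chain_lift_def)
  have "mapp N (matmul R A' (f (Suc i))) v = mapp N (matmul R (f i) A) v"
    by (rule N.mapp_cong[OF _ N.matmul_is_mat[OF m Q.mat] v])
      (use f in \<open>simp add: matmul_def chain_lift_def\<close>)
  then show ?thesis by (simp add: N.mapp_comp[OF m Q.mat v] N.mapp_comp[OF P.mat m v])
qed

text \<open>
  The same recursion one degree higher: a chain map \<open>h\<close> over the zero map of \<open>M\<close> is null-homotopic,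
  since \<open>h\<close> minus the part of the homotopy already found has values in cycles.
\<close>

lemma null_homotopy:
  assumes hm: "\<And>i. is_mat R (B i) (B' i) (h i)"
    and h0: "\<And>b. b \<in> B 0 \<Longrightarrow> lin_ext R M a' (h 0 b) = \<zero>\<^bsub>M\<^esub>"
    and hc: "\<And>i b. b \<in> B (Suc i) \<Longrightarrow> mapp (self_module R) A' (h (Suc i) b) = mapp (self_module R) (h i) (A b)"
  obtains s where "\<And>i. is_mat R (B i) (B' (Suc i)) (s i)"
    and "\<And>b. b \<in> B 0 \<Longrightarrow> h 0 b = matmul R A' (s 0) b"
    and "\<And>i b. b \<in> B (Suc i) \<Longrightarrow>
      h (Suc i) b = (\<lambda>c. matmul R A' (s (Suc i)) b c \<oplus> matmul R (s i) A b c)"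
proof -
  interpret S: module R "self_module R" by (rule P.R.self_module_module)
  let ?F = "\<lambda>i. free_module R (B' i)" and ?m = "mapp (self_module R)"
  have F: "module R (?F i)" for i by (rule P.R.free_module_module)
  have hb: "h i b \<in> carrier (?F i)" if "b \<in> B i" for i b using hm that by (auto simp: is_mat_def)
  have A0: "?m (matmul R s A) (A b) = (\<lambda>c. \<zero>)"
    if s: "is_mat R (B i) (B' (Suc i)) s" and b: "b \<in> B (Suc (Suc i))" for i s b
    using S.mapp_comp[OF P.mat s P.mat_closed[OF b, unfolded free_module_eq]] P.boundary_square[OF b]
      module_hom_zero[OF P.R.free_module_module F P.R.mapp_self_hom[OF s]] by simp
  define ok where "ok i s \<longleftrightarrow> is_mat R (B i) (B' (Suc i)) s \<and>
    (\<forall>b\<in>B (Suc i). ?m A' (?m s (A b)) = ?m (h i) (A b)) \<and>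
    (i = 0 \<longrightarrow> (\<forall>b\<in>B 0. h 0 b = matmul R A' s b))" for i s
  define rel where "rel i s t \<longleftrightarrow> (\<forall>b\<in>B (Suc i).
    h (Suc i) b = (\<lambda>c. matmul R A' t b c \<oplus> matmul R s A b c))" for i s t
  have "\<exists>s. ok 0 s"
  proof -
    have "h 0 b \<in> Q.syzygies 0" if "b \<in> B 0" for b
      using hb[OF that] h0[OF that] by (simp add: Q.syzygies_def)
    then obtain s where s: "is_mat R (B 0) (B' (Suc 0)) s" "\<forall>b\<in>B 0. ?m A' (s b) = h 0 b"
      using Q.mat_lift[of "B 0" "h 0" 0] by blast
    have "?m A' (?m s (A b)) = ?m (h 0) (A b)" if b: "b \<in> B (Suc 0)" for b
    proof -
      note z = P.mat_closed[OF b, unfolded free_module_eq]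
      have "?m (matmul R A' s) (A b) = ?m (h 0) (A b)"
        by (rule S.mapp_cong[OF _ S.matmul_is_mat[OF s(1) Q.mat] z]) (use s(2) in \<open>simp add: matmul_def\<close>)
      then show ?thesis by (simp only: S.mapp_comp[OF s(1) Q.mat z])
    qed
    then show ?thesis using s by (auto simp: ok_def matmul_def)
  qed
  moreover have "\<exists>t. ok (Suc i) t \<and> rel i s t" if s: "ok i s" for i s
  proof -
    interpret Fi: module R "?F (Suc i)" by (rule F)
    interpret Fj: module R "?F i" by (rule F)
    have sm: "is_mat R (B i) (B' (Suc i)) s" using s by (simp add: ok_def)
    let ?k = "\<lambda>b. h (Suc i) b \<ominus>\<^bsub>?F (Suc i)\<^esub> ?m s (A b)"
    have sA: "?m s (A b) \<in> carrier (?F (Suc i))" if "b \<in> B (Suc i)" for b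
      by (rule module_homD(1)[OF P.R.mapp_self_hom[OF sm] P.mat_closed[OF that]])
    have kc: "?k b \<in> carrier (?F (Suc i))" if "b \<in> B (Suc i)" for b
      using hb[OF that] sA[OF that] by (rule Fi.M.minus_closed)
    have "?k b \<in> Q.syzygies (Suc i)" if b: "b \<in> B (Suc i)" for b
    proof -
      have "?m A' (?k b) = \<zero>\<^bsub>?F i\<^esub>"
        using module_hom_minus[OF F F Q.boundary_hom hb[OF b] sA[OF b]] hc[OF b] s b
          Fj.M.minus_eq_zero_iff module_homD(1)[OF Q.boundary_hom sA[OF b]] by (simp add: ok_def)
      then show ?thesis using kc[OF b] by (simp add: Q.syzygies_def)
    qed
    then obtain t where t: "is_mat R (B (Suc i)) (B' (Suc (Suc i))) t" "\<forall>b\<in>B (Suc i). ?m A' (t b) = ?k b"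
      using Q.mat_lift[of "B (Suc i)" ?k "Suc i"] by blast
    have rel: "h (Suc i) b = (\<lambda>c. matmul R A' t b c \<oplus> matmul R s A b c)" if b: "b \<in> B (Suc i)" for b
      using Fi.M.minus_add_cancel[OF hb[OF b] sA[OF b]] Fi.M.a_comm[OF sA[OF b] kc[OF b]] t(2) b
      by (simp add: matmul_def)
    have "?m A' (?m t (A b)) = ?m (h (Suc i)) (A b)" if b: "b \<in> B (Suc (Suc i))" for b
    proof -
      note z = P.mat_closed[OF b, unfolded free_module_eq]
      have "?m (h (Suc i)) (A b) = ?m (\<lambda>b c. matmul R A' t b c \<oplus> matmul R s A b c) (A b)"
        by (rule S.mapp_cong[OF rel hm z])
      also have "\<dots> = (\<lambda>c. ?m A' (?m t (A b)) c \<oplus> \<zero>)"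
        using S.mapp_add_mat[OF S.matmul_is_mat[OF t(1) Q.mat] S.matmul_is_mat[OF P.mat sm] z]
        by (simp add: A0[OF sm b] S.mapp_comp[OF t(1) Q.mat z])
      also have "\<dots> = ?m A' (?m t (A b))"
        using S.fsupp_apply[OF module_homD(1)[OF S.mapp_hom[OF Q.mat] module_homD(1)[OF S.mapp_hom[OF t(1)] z]]]
        by simp
      finally show ?thesis ..
    qed
    then show ?thesis using t rel unfolding ok_def rel_def by blast
  qed
  ultimately obtain s where s: "\<forall>i. ok i (s i) \<and> rel i (s i) (s (Suc i))"
    using dependent_nat_choice[of ok rel] by blast
  show ?thesis by (rule that[of s]) (use s in \<open>simp_all add: ok_def rel_def\<close>)
qed

text \<open>
  With coefficients, the term of the homotopy that starts with the differential vanishes on cycles,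
  so that two lifts differ by boundaries there.
\<close>

lemma chain_lift_homotopic:
  assumes f: "chain_lift f" and g: "chain_lift g" and N: "module R N"
    and v: "v \<in> coeff_cycles N B A i"
  shows "\<exists>u\<in>coeff_boundaries N B' A' i.
    mapp N (f i) v = u \<oplus>\<^bsub>fsupp N (B' i)\<^esub> mapp N (g i) v"
proof -
  interpret N: module R N by fact
  interpret S: module R "self_module R" by (rule P.R.self_module_module)
  let ?m = "mapp (self_module R)" and ?F = "\<lambda>i. free_module R (B' i)"
  have F: "module R (?F i)" for i by (rule P.R.free_module_module)
  have fm: "is_mat R (B i) (B' i) (f i)" and gm: "is_mat R (B i) (B' i) (g i)" for i
    using f g by (auto simp: chain_lift_def)
  have fc: "f i b \<in> carrier (?F i)" "g i b \<in> carrier (?F i)" if "b \<in> B i" for i b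
    using fm gm that by (auto simp: is_mat_def)
  define h where "h i b = f i b \<ominus>\<^bsub>?F i\<^esub> g i b" for i b
  have hm: "is_mat R (B i) (B' i) (h i)" for i
    using abelian_group.minus_closed[OF module.axioms(2)[OF F] fc] by (simp add: is_mat_def h_def)
  have fgh: "f i b = (\<lambda>c. g i b c \<oplus> h i b c)" if "b \<in> B i" for i b
    using abelian_group.minus_add_cancel[OF module.axioms(2)[OF F] fc[OF that]] by (simp add: h_def)
  have hv: "mapp W (f i) u = mapp W (g i) u \<oplus>\<^bsub>fsupp W (B' i)\<^esub> mapp W (h i) u"
    if W: "module R W" and u: "u \<in> vecs W (B i)" for i u and W :: "('a, 'w, 'l) module_scheme"
    using module.mapp_cong[OF W fgh fm u] module.mapp_add_mat[OF W gm hm u] by simp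
  have hF: "?m (h i) z = ?m (f i) z \<ominus>\<^bsub>?F i\<^esub> ?m (g i) z" if "z \<in> carrier (free_module R (B i))" for i z
    by (rule abelian_group.minus_unique[OF module.axioms(2)[OF F]])
      (use hv[OF S.module_axioms] that module_homD(1)[OF P.R.mapp_self_hom[OF gm] that]
        module_homD(1)[OF P.R.mapp_self_hom[OF hm] that] in \<open>auto simp: free_module_eq\<close>)
  have 0: "lin_ext R M a' (h 0 b) = \<zero>\<^bsub>M\<^esub>" if b: "b \<in> B 0" for b
    using module_hom_minus[OF F P.module_axioms Q.aug_hom fc[OF b]] f g b P.aug_closed
    by (simp add: h_def chain_lift_def Pi_iff P.M.minus_eq_zero_iff)
  have S: "?m A' (h (Suc i) b) = ?m (h i) (A b)" if b: "b \<in> B (Suc i)" for i b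
    using module_hom_minus[OF F F Q.boundary_hom fc[OF b]] f g b hF[OF P.mat_closed[OF b]]
    by (simp add: h_def chain_lift_def)
  obtain s where sm: "\<And>i. is_mat R (B i) (B' (Suc i)) (s i)"
    and s0: "\<And>b. b \<in> B 0 \<Longrightarrow> h 0 b = matmul R A' (s 0) b"
    and s1: "\<And>i b. b \<in> B (Suc i) \<Longrightarrow> h (Suc i) b = (\<lambda>c. matmul R A' (s (Suc i)) b c \<oplus> matmul R (s i) A b c)"
    using null_homotopy[OF hm 0 S] by blast
  have vc: "v \<in> vecs N (B i)" using v by (simp add: cycles_def)
  have As: "is_mat R (B i) (B' i) (matmul R A' (s i))" by (rule N.matmul_is_mat[OF sm Q.mat])
  have sv: "mapp N (s i) v \<in> vecs N (B' (Suc i))" by (rule module_homD(1)[OF N.mapp_hom[OF sm] vc])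
  have Asv: "mapp N A' (mapp N (s i) v) \<in> vecs N (B' i)"
    by (rule module_homD(1)[OF N.mapp_hom[OF Q.mat] sv])
  have "mapp N (h i) v = mapp N A' (mapp N (s i) v)"
  proof (cases i)
    case 0
    show ?thesis
      unfolding N.mapp_comp[OF sm Q.mat vc] by (rule N.mapp_cong[OF _ hm vc]) (simp add: s0 0)
  next
    case (Suc j)
    have sA: "is_mat R (B i) (B' i) (matmul R (s j) A)"
      using N.matmul_is_mat[OF P.mat sm] Suc by simp
    have sAv: "mapp N (s j) (mapp N A v) = mapp N (matmul R (s j) A) v"
      by (rule N.mapp_comp[OF P.mat sm]) (use vc Suc in simp)
    have "mapp N (h i) v = mapp N (\<lambda>b c. matmul R A' (s i) b c \<oplus> matmul R (s j) A b c) v"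
      by (rule N.mapp_cong[OF _ hm vc]) (simp add: s1 Suc)
    also have "\<dots> = (\<lambda>c. mapp N A' (mapp N (s i) v) c \<oplus>\<^bsub>N\<^esub> mapp N (s j) (mapp N A v) c)"
      by (simp only: N.mapp_add_mat[OF As sA vc] N.mapp_comp[OF sm Q.mat vc] sAv)
    also have "mapp N (s j) (mapp N A v) = (\<lambda>c. \<zero>\<^bsub>N\<^esub>)"
      using v Suc module_hom_zero[OF N.fsupp_module N.fsupp_module N.mapp_hom[OF sm]] by (simp add: cycles_def)
    finally show ?thesis using N.fsupp_apply[OF Asv] by simp
  qed
  then have "mapp N (f i) v = mapp N A' (mapp N (s i) v) \<oplus>\<^bsub>fsupp N (B' i)\<^esub> mapp N (g i) v"
    using hv[OF N vc] N.fsupp_apply[OF Asv] N.fsupp_apply[OF module_homD(1)[OF N.mapp_hom[OF gm] vc]]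
    by (simp add: N.M.a_comm)
  then show ?thesis unfolding boundaries_def using sv by blast
qed

end

lemma (in free_resolution) chain_lift_id:
  "two_resolutions.chain_lift R M B A a B A a (\<lambda>i. free_basis R)"
proof -
  interpret T: two_resolutions R M B A a B A a by unfold_locales
  interpret S: module R "self_module R" by (rule R.self_module_module)
  have "mapp (self_module R) A (free_basis R b) = A b" if "b \<in> B (Suc i)" for i b
    by (rule R.mapp_self_basis[OF mat that])
  moreover have "mapp (self_module R) (free_basis R) (A b) = A b" if "b \<in> B (Suc i)" for i b
    using S.mapp_free_basis mat_closed[OF that] by (simp add: free_module_eq)
  ultimately show ?thesis
    using lin_ext_basis[OF aug_closed] unfolding T.chain_lift_def
    by (auto simp: is_mat_def R.free_basis_closed)
qed

context two_resolutions
begin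

lemma chain_lift_comp:
  assumes f: "chain_lift f" and g: "two_resolutions.chain_lift R M B' A' a' B A a g"
  shows "two_resolutions.chain_lift R M B A a B A a (\<lambda>i. matmul R (g i) (f i))"
proof -
  interpret T: two_resolutions R M B' A' a' B A a by unfold_locales
  interpret PP: two_resolutions R M B A a B A a by unfold_locales
  interpret S: module R "self_module R" by (rule P.R.self_module_module)
  have fm: "is_mat R (B i) (B' i) (f i)" and gm: "is_mat R (B' i) (B i) (g i)" for i
    using f g by (auto simp: chain_lift_def T.chain_lift_def)
  have fc: "f i b \<in> carrier (free_module R (B' i))" if "b \<in> B i" for i b
    using fm that by (auto simp: is_mat_def)
  have "lin_ext R M a (mapp (self_module R) (g 0) (f 0 b)) = a b" if b: "b \<in> B 0" for b
    using T.aug_lift_vec[OF gm _ fc[OF b]] f g b by (simp add: chain_lift_def T.chain_lift_def)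
  moreover have "mapp (self_module R) A (mapp (self_module R) (g (Suc i)) (f (Suc i) b)) =
      mapp (self_module R) (matmul R (g i) (f i)) (A b)" if b: "b \<in> B (Suc i)" for i b
  proof -
    have "mapp (self_module R) A (mapp (self_module R) (g (Suc i)) (f (Suc i) b)) =
        mapp (self_module R) (g i) (mapp (self_module R) A' (f (Suc i) b))"
      using T.chain_lift_commute[OF g P.R.self_module_module] fc[OF b] by (simp add: free_module_eq)
    also have "mapp (self_module R) A' (f (Suc i) b) = mapp (self_module R) (f i) (A b)"
      using f b by (simp add: chain_lift_def)
    also have "mapp (self_module R) (g i) \<dots> = mapp (self_module R) (matmul R (g i) (f i)) (A b)"
      using S.mapp_comp[OF fm gm] P.mat_closed[OF b] by (simp add: free_module_eq)
    finally show ?thesis .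
  qed
  ultimately show ?thesis
    unfolding PP.chain_lift_def using S.matmul_is_mat[OF fm gm] by (simp add: matmul_def)
qed

lemma chain_lift_cycles:
  assumes f: "chain_lift f" and N: "module R N"
    and v: "v \<in> coeff_cycles N B A i"
  shows "mapp N (f i) v \<in> coeff_cycles N B' A' i"
proof -
  interpret N: module R N by fact
  have fm: "is_mat R (B i) (B' i) (f i)" for i using f by (auto simp: chain_lift_def)
  have vc: "v \<in> vecs N (B i)" using v by (simp add: cycles_def)
  have "mapp N A' (mapp N (f i) v) = (\<lambda>x. \<zero>\<^bsub>N\<^esub>)" if "i = Suc j" for j
    using chain_lift_commute[OF f N, of v j] v that vc
      module_hom_zero[OF N.fsupp_module N.fsupp_module N.mapp_hom[OF fm]] by (simp add: cycles_def)
  then show ?thesis using module_homD(1)[OF N.mapp_hom[OF fm] vc] by (auto simp: cycles_def)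
qed

lemma chain_lift_boundaries:
  assumes f: "chain_lift f" and N: "module R N"
    and v: "v \<in> coeff_boundaries N B A i"
  shows "mapp N (f i) v \<in> coeff_boundaries N B' A' i"
proof -
  interpret N: module R N by fact
  have fm: "is_mat R (B i) (B' i) (f i)" for i using f by (auto simp: chain_lift_def)
  obtain w where w: "w \<in> vecs N (B (Suc i))" "v = mapp N A w"
    using v by (auto simp: boundaries_def)
  then show ?thesis
    using chain_lift_commute[OF f N w(1)] module_homD(1)[OF N.mapp_hom[OF fm] w(1)]
    unfolding boundaries_def by (metis image_eqI)
qed

text \<open>
  Both composites of lifts in opposite directions are lifts of the identity, hence agree with the
  identity on cycles up to boundaries.
\<close>

theorem homology_iso:
  assumes N: "module R N"
  shows "module_iso R (coeff_homology N B A i)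
    (coeff_homology N B' A' i)"
proof -
  interpret T: two_resolutions R M B' A' a' B A a by unfold_locales
  interpret PP: two_resolutions R M B A a B A a by unfold_locales
  interpret QQ: two_resolutions R M B' A' a' B' A' a' by unfold_locales
  interpret N: module R N by fact
  obtain f where f: "chain_lift f" using chain_lift_exists by blast
  obtain g where g: "T.chain_lift g" using T.chain_lift_exists by blast
  have fm: "is_mat R (B i) (B' i) (f i)" and gm: "is_mat R (B' i) (B i) (g i)" for i
    using f g by (auto simp: chain_lift_def T.chain_lift_def)
  let ?C = "\<lambda>i. fsupp N (B i)" and ?d = "\<lambda>i::nat. mapp N A"
  let ?C' = "\<lambda>i. fsupp N (B' i)" and ?d' = "\<lambda>i::nat. mapp N A'"
  have C: "chain_complex R ?C ?d" and C': "chain_complex R ?C' ?d'"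
    by (rule P.coeff_complex[OF N], rule Q.coeff_complex[OF N])
  have cc: "z \<in> carrier (?C i)" if "z \<in> cycles ?C ?d i" for z using that by (simp add: cycles_def)
  have cc': "z \<in> carrier (?C' i)" if "z \<in> cycles ?C' ?d' i" for z using that by (simp add: cycles_def)
  have bc: "z \<in> carrier (?C i)" if "z \<in> boundaries ?C ?d i" for z
    using boundaries_subset_cycles[OF C] cc that by blast
  have bc': "z \<in> carrier (?C' i)" if "z \<in> boundaries ?C' ?d' i" for z
    using boundaries_subset_cycles[OF C'] cc' that by blast
  interpret Ci: module R "?C i" by (rule N.fsupp_module)
  interpret Ci': module R "?C' i" by (rule N.fsupp_module)
  have gf: "\<exists>h\<in>boundaries ?C ?d i. mapp N (g i) (mapp N (f i) z) = h \<oplus>\<^bsub>?C i\<^esub> z"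
    if z: "z \<in> cycles ?C ?d i" for z
    using PP.chain_lift_homotopic[OF chain_lift_comp[OF f g] P.chain_lift_id N z]
    by (simp add: N.mapp_comp[OF fm gm cc[OF z]] N.mapp_free_basis[OF cc[OF z]])
  have fg: "\<exists>h\<in>boundaries ?C' ?d' i. mapp N (f i) (mapp N (g i) z) = h \<oplus>\<^bsub>?C' i\<^esub> z"
    if z: "z \<in> cycles ?C' ?d' i" for z
    using QQ.chain_lift_homotopic[OF T.chain_lift_comp[OF g f] Q.chain_lift_id N z]
    by (simp add: N.mapp_comp[OF gm fm cc'[OF z]] N.mapp_free_basis[OF cc'[OF z]])
  have move: "z = (\<ominus>\<^bsub>?C i\<^esub> h) \<oplus>\<^bsub>?C i\<^esub> w" if "w = h \<oplus>\<^bsub>?C i\<^esub> z" "h \<in> carrier (?C i)" "z \<in> carrier (?C i)" for z w h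
    using that Ci.M.r_neg1 by metis
  have move': "z = (\<ominus>\<^bsub>?C' i\<^esub> h) \<oplus>\<^bsub>?C' i\<^esub> w" if "w = h \<oplus>\<^bsub>?C' i\<^esub> z" "h \<in> carrier (?C' i)" "z \<in> carrier (?C' i)" for z w h
    using that Ci'.M.r_neg1 by metis
  note sub = Ci.submoduleE(3,5)[OF boundaries_submodule[OF C, of i]]
    and sub' = Ci'.submoduleE(3,5)[OF boundaries_submodule[OF C', of i]]
  show ?thesis
  proof (rule homology_isoI[OF C C' N.mapp_hom[OF fm]])
    fix z assume z: "z \<in> cycles ?C ?d i"
    show "mapp N (f i) z \<in> cycles ?C' ?d' i" by (rule chain_lift_cycles[OF f N z])
    show "mapp N (f i) z \<in> boundaries ?C' ?d' i \<longleftrightarrow> z \<in> boundaries ?C ?d i"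
    proof
      assume "z \<in> boundaries ?C ?d i"
      then show "mapp N (f i) z \<in> boundaries ?C' ?d' i" by (rule chain_lift_boundaries[OF f N])
    next
      assume "mapp N (f i) z \<in> boundaries ?C' ?d' i"
      then have b: "mapp N (g i) (mapp N (f i) z) \<in> boundaries ?C ?d i"
        by (rule T.chain_lift_boundaries[OF g N])
      obtain h where h: "h \<in> boundaries ?C ?d i" "mapp N (g i) (mapp N (f i) z) = h \<oplus>\<^bsub>?C i\<^esub> z"
        using gf[OF z] by blast
      show "z \<in> boundaries ?C ?d i"
        by (subst move[OF h(2) bc[OF h(1)] cc[OF z]]) (rule sub(2)[OF sub(1)[OF h(1)] b])
    qed
  next
    fix z assume z: "z \<in> cycles ?C' ?d' i"
    obtain h where h: "h \<in> boundaries ?C' ?d' i" "mapp N (f i) (mapp N (g i) z) = h \<oplus>\<^bsub>?C' i\<^esub> z"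
      using fg[OF z] by blast
    show "\<exists>w\<in>cycles ?C ?d i. \<exists>h\<in>boundaries ?C' ?d' i. z = h \<oplus>\<^bsub>?C' i\<^esub> mapp N (f i) w"
      using move'[OF h(2) bc'[OF h(1)] cc'[OF z]] sub'(1)[OF h(1)] T.chain_lift_cycles[OF g N z] by blast
  qed
qed

end

section \<open>Restriction of scalars\<close>

lemma restrict_scalars_simps [simp]:
  "carrier (restrict_scalars \<phi> M) = carrier M" "\<zero>\<^bsub>restrict_scalars \<phi> M\<^esub> = \<zero>\<^bsub>M\<^esub>"
  "u \<oplus>\<^bsub>restrict_scalars \<phi> M\<^esub> v = u \<oplus>\<^bsub>M\<^esub> v"
  by (simp_all add: restrict_scalars_def)

lemma restrict_scalars_smult: "s \<odot>\<^bsub>restrict_scalars \<phi> M\<^esub> u = \<phi> s \<odot>\<^bsub>M\<^esub> u"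
  by (simp_all add: restrict_scalars_def)

lemma restrict_scalars_module:
  assumes S: "cring S" and \<phi>: "\<phi> \<in> ring_hom S R" and M: "module R M"
  shows "module S (restrict_scalars \<phi> M)"
proof -
  interpret M: module R M by fact
  note h = ring_hom_closed[OF \<phi>] ring_hom_mult[OF \<phi>] ring_hom_add[OF \<phi>] ring_hom_one[OF \<phi>]
  show ?thesis
  proof (rule moduleI[OF S])
    show "abelian_group (restrict_scalars \<phi> M)"
      by (rule abelian_groupI) (auto simp: M.a_ac intro: bexI[of _ "\<ominus>\<^bsub>M\<^esub> _"] M.l_neg)
  qed (auto simp: restrict_scalars_smult h M.smult_l_distr M.smult_r_distr M.smult_assoc1)
qed

lemma module_hom_restrict_scalars:
  assumes "\<phi> \<in> ring_hom S R" "f \<in> module_hom R L M"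
  shows "f \<in> module_hom S (restrict_scalars \<phi> L) (restrict_scalars \<phi> M)"
  using module_homD[OF assms(2)] ring_hom_closed[OF assms(1)]
  by (intro module_homI) (auto simp: restrict_scalars_smult)

lemma fsupp_restrict_scalars: "fsupp (restrict_scalars \<phi> N) X = restrict_scalars \<phi> (fsupp N X)"
  by (simp add: fsupp_def restrict_scalars_def)

lemma mapp_restrict_scalars:
  "mapp (restrict_scalars \<phi> N) A v = mapp N (\<lambda>b c. \<phi> (A b c)) v"
proof -
  have "add (restrict_scalars \<phi> N) = add N" by (simp add: restrict_scalars_def)
  then show ?thesis 
    by (simp add: mapp_def dsum_ext_def finsum_def finprod_def restrict_scalars_smult cong: if_cong)
qed

section \<open>Reduction modulo an exact zero-divisor\<close>

text \<open>
  A ring \<open>R\<close> that is the quotient of \<open>S\<close> by \<open>x\<close>, where \<open>(x, y)\<close> is a pair of exact zero-divisors,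
  and a free resolution of an \<open>R\<close>-module \<open>M\<close> over \<open>R\<close>.
\<close>

locale lifted_resolution = S: cring S + P: free_resolution R M B \<delta> a
  for S :: "('s, 'k) ring_scheme" (structure) and R :: "('r, 'l) ring_scheme"
    and M :: "('r, 'm, 'p) module_scheme" and B :: "nat \<Rightarrow> 'x set" and \<delta> and a +
  fixes \<pi> :: "'s \<Rightarrow> 'r" and x y :: 's
  assumes proj_hom: "\<pi> \<in> ring_hom S R"
    and proj_surj: "carrier R \<subseteq> \<pi> ` carrier S"
    and x_closed: "x \<in> carrier S" and y_closed: "y \<in> carrier S"
    and proj_ker: "s \<in> carrier S \<Longrightarrow> \<pi> s = \<zero>\<^bsub>R\<^esub> \<longleftrightarrow> (\<exists>t\<in>carrier S. s = x \<otimes> t)"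
    and ann_x: "s \<in> carrier S \<Longrightarrow> x \<otimes> s = \<zero> \<longleftrightarrow> (\<exists>t\<in>carrier S. s = y \<otimes> t)"
    and ann_y: "s \<in> carrier S \<Longrightarrow> y \<otimes> s = \<zero> \<longleftrightarrow> (\<exists>t\<in>carrier S. s = x \<otimes> t)"
begin

abbreviation "SS \<equiv> self_module S"

lemmas proj = ring_hom_closed[OF proj_hom] ring_hom_mult[OF proj_hom] ring_hom_add[OF proj_hom]
  ring_hom_one[OF proj_hom]

lemma proj_zero: "\<pi> \<zero> = \<zero>\<^bsub>R\<^esub>"
  using proj_ker[of \<zero>] x_closed S.r_null[OF x_closed] S.zero_closed by metis

lemma proj_x: "\<pi> x = \<zero>\<^bsub>R\<^esub>"
  using proj_ker[OF x_closed] S.r_one[OF x_closed] S.one_closed by metis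

lemma SS_module: "module S SS" by (rule S.self_module_module)

sublocale SS: module S SS by (rule SS_module)

lemma restrict_module: "module R N \<Longrightarrow> module S (restrict_scalars \<pi> N)"
  by (rule restrict_scalars_module[OF S.is_cring proj_hom])

lemma vector_divide:
  assumes v: "v \<in> vecs SS X"
    and ex: "\<And>b. b \<in> X \<Longrightarrow> \<exists>t\<in>carrier S. v b = c \<otimes> t" and c: "c \<in> carrier S"
  obtains w where "w \<in> vecs SS X" "\<And>b. v b = c \<otimes> w b"
proof -
  define w where "w b = (if v b = \<zero> then \<zero> else SOME t. t \<in> carrier S \<and> v b = c \<otimes> t)" for b
  have *: "w b \<in> carrier S \<and> v b = c \<otimes> w b" for b
  proof (cases "v b = \<zero>")
    case True
    then show ?thesis using c by (simp add: w_def)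
  next
    case False
    then have "b \<in> X" using fsupp_outside[OF v] by auto
    then have "\<exists>t. t \<in> carrier S \<and> v b = c \<otimes> t" using ex by blast
    from someI_ex[OF this] show ?thesis using False by (simp add: w_def)
  qed
  have "{b. w b \<noteq> \<zero>} \<subseteq> {b. v b \<noteq> \<zero>}" by (auto simp: w_def)
  then have "finite {b. w b \<noteq> \<zero>}" using v finite_subset by (auto simp: fsupp_carrier)
  moreover have "w b = \<zero>" if "b \<notin> X" for b using fsupp_outside[OF v that] by (simp add: w_def)
  ultimately have "w \<in> vecs SS X" using * by (simp add: fsupp_carrier)
  with * that show ?thesis by blast
qed

text \<open>
  The representative of zero is chosen to be zero, so that lifting the entries of a vector keeps its
  support finite.
\<close>

definition lift_scalar :: "'r \<Rightarrow> 's"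
  where "lift_scalar r = (if r = \<zero>\<^bsub>R\<^esub> then \<zero> else SOME s. s \<in> carrier S \<and> \<pi> s = r)"

lemma lift_scalar:
  assumes "r \<in> carrier R" shows "lift_scalar r \<in> carrier S" "\<pi> (lift_scalar r) = r"
proof -
  have "\<exists>s. s \<in> carrier S \<and> \<pi> s = r" using proj_surj assms by auto
  from someI_ex[OF this] show "lift_scalar r \<in> carrier S" "\<pi> (lift_scalar r) = r"
    by (auto simp: lift_scalar_def proj_zero)
qed

lemma lift_scalar_zero: "lift_scalar \<zero>\<^bsub>R\<^esub> = \<zero>" by (simp add: lift_scalar_def)

lemma vector_lift:
  assumes "w \<in> carrier (free_module R X)"
  shows "(\<lambda>b. lift_scalar (w b)) \<in> vecs SS X" "(\<lambda>b. \<pi> (lift_scalar (w b))) = w"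
proof -
  have c: "w b \<in> carrier R" for b by (rule P.R.free_module_apply[OF assms])
  show "(\<lambda>b. lift_scalar (w b)) \<in> vecs SS X"
    by (rule module.fsupp_map_closed[OF P.R.self_module_module assms[unfolded free_module_eq]])
      (simp_all add: lift_scalar_zero lift_scalar)
  show "(\<lambda>b. \<pi> (lift_scalar (w b))) = w" by (simp add: lift_scalar c)
qed

lemma vector_reduce:
  "v \<in> vecs SS X \<Longrightarrow> (\<lambda>b. \<pi> (v b)) \<in> carrier (free_module R X)"
  unfolding free_module_eq
  by (rule module.fsupp_map_closed[OF SS_module]) (simp_all add: proj_zero proj)

lemma proj_module_hom: "\<pi> \<in> module_hom S SS (restrict_scalars \<pi> (self_module R))"
  by (rule module_homI) (simp_all add: proj restrict_scalars_smult)

lemma vector_reduce_hom: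
  "(\<lambda>v b. \<pi> (v b)) \<in> module_hom S (fsupp SS X) (restrict_scalars \<pi> (free_module R X))"
  using module.fsupp_map_hom[OF SS_module restrict_module[OF P.R.self_module_module] proj_module_hom]
  by (simp add: free_module_eq fsupp_restrict_scalars)

text \<open>
  The lift of the differential of the resolution to \<open>S\<close>. Its square is only divisible by \<open>x\<close>.
\<close>

definition \<Delta> :: "'x \<Rightarrow> 'x \<Rightarrow> 's" where "\<Delta> b c = lift_scalar (\<delta> b c)"

lemma \<Delta>_mat: "is_mat S (B (Suc i)) (B i) \<Delta>"
  unfolding is_mat_def \<Delta>_def[abs_def] free_module_eq[of S]
  using vector_lift(1)[OF P.mat_closed] by blast

lemma proj_\<Delta>: "b \<in> B (Suc i) \<Longrightarrow> (\<lambda>c. \<pi> (\<Delta> b c)) = \<delta> b"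
  unfolding \<Delta>_def by (rule vector_lift(2)[OF P.mat_closed])

lemma mapp_\<Delta>_restrict:
  assumes N: "module R N" and v: "v \<in> vecs N (B (Suc i))"
  shows "mapp (restrict_scalars \<pi> N) \<Delta> v = mapp N \<delta> v"
  unfolding mapp_restrict_scalars
  by (rule module.mapp_cong[OF N _ _ v, of _ _ "B i", symmetric])
    (use P.mat proj_\<Delta> in auto)

lemma reduce_\<Delta>:
  assumes v: "v \<in> vecs SS (B (Suc i))"
  shows "(\<lambda>c. \<pi> (mapp SS \<Delta> v c)) = mapp (self_module R) \<delta> (\<lambda>b. \<pi> (v b))"
proof -
  have "mapp (restrict_scalars \<pi> (self_module R)) \<Delta> (\<lambda>b. \<pi> (v b)) = (\<lambda>c. \<pi> (mapp SS \<Delta> v c))"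
    by (rule module.mapp_coeff_change[OF SS_module restrict_module[OF P.R.self_module_module]
          proj_module_hom \<Delta>_mat v])
  then show ?thesis
    using mapp_\<Delta>_restrict[OF P.R.self_module_module] vector_reduce[OF v] by (simp add: free_module_eq)
qed

section \<open>Bigraded vectors\<close>

text \<open>
  Over \<open>S\<close> each basis element of the resolution of \<open>M\<close> is repeated in all degrees \<open>q\<close>, as in the
  periodic resolution \<open>\<dots> \<rightarrow> S \<rightarrow> S \<rightarrow> S\<close> of \<open>R\<close>, whose differentials are multiplication by \<open>x\<close> and
  by \<open>y\<close> in turn.
\<close>

definition D :: "nat \<Rightarrow> (nat \<times> nat \<times> 'x) set"
  where "D n = {(p, q, b). p + q = n \<and> b \<in> B p}"

text \<open>
  Multiplication by \<open>\<xi> q\<close> is the differential from degree \<open>q\<close> to degree \<open>q - 1\<close> of the periodic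
  resolution, so \<open>\<xi> 1 = x\<close>. The signs \<open>\<sigma> q\<close> make the two directions anticommute.
\<close>

definition \<xi> :: "nat \<Rightarrow> 's" where "\<xi> q = (if even q then y else x)"

definition \<sigma> :: "nat \<Rightarrow> 's" where "\<sigma> q = (if even q then \<one> else \<ominus> \<one>)"

lemma \<xi>_closed [simp]: "\<xi> q \<in> carrier S" by (simp add: \<xi>_def x_closed y_closed)

lemma \<sigma>_closed [simp]: "\<sigma> q \<in> carrier S" by (simp add: \<sigma>_def)

lemma \<sigma>_square: "\<sigma> q \<otimes> \<sigma> q = \<one>"
  by (simp add: \<sigma>_def S.l_minus S.r_minus)

lemma \<sigma>_Suc: "\<sigma> (Suc q) = \<ominus> \<sigma> q" by (simp add: \<sigma>_def)

lemma \<xi>_ann: "s \<in> carrier S \<Longrightarrow> \<xi> q \<otimes> s = \<zero> \<longleftrightarrow> (\<exists>t\<in>carrier S. s = \<xi> (Suc q) \<otimes> t)"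
  using ann_x ann_y by (simp add: \<xi>_def)

lemma \<xi>_mult_\<xi>: "\<xi> q \<otimes> \<xi> (Suc q) = \<zero>"
  using \<xi>_ann[OF \<xi>_closed, of q "Suc q"] S.r_one[OF \<xi>_closed] S.one_closed by metis

definition inc :: "('s, 'n, 'q) module_scheme \<Rightarrow> nat \<Rightarrow> nat \<Rightarrow> ('x \<Rightarrow> 'n) \<Rightarrow> nat \<times> nat \<times> 'x \<Rightarrow> 'n"
  where "inc N p q w = (\<lambda>(p', q', b). if p' = p \<and> q' = q then w b else \<zero>\<^bsub>N\<^esub>)"

text \<open>
  The filtration by \<open>p\<close>. The bound \<open>p < k\<close> is strict, so that \<open>Fil N n 0\<close> is zero and inductions on
  \<open>k\<close> start trivially.
\<close>

definition Fil :: "('s, 'n, 'q) module_scheme \<Rightarrow> nat \<Rightarrow> nat \<Rightarrow> (nat \<times> nat \<times> 'x \<Rightarrow> 'n) set"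
  where "Fil N n k = {z \<in> vecs N (D n). \<forall>p q b. k \<le> p \<longrightarrow> z (p, q, b) = \<zero>\<^bsub>N\<^esub>}"

text \<open>
  The two leading components of the differential on vectors in bidegree \<open>(p, q)\<close>. The remaining
  components will lie in bidegrees \<open>(p', q')\<close> with \<open>p' + 2 \<le> p\<close>.
\<close>

definition lead :: "('s, 'n, 'q) module_scheme \<Rightarrow> nat \<Rightarrow> nat \<Rightarrow> ('x \<Rightarrow> 'n) \<Rightarrow> nat \<times> nat \<times> 'x \<Rightarrow> 'n"
  where "lead N p q w = (\<lambda>(p', q', b).
    if p' = p \<and> Suc q' = q then \<xi> q \<odot>\<^bsub>N\<^esub> w b
    else if Suc p' = p \<and> q' = q then \<sigma> q \<odot>\<^bsub>N\<^esub> mapp N \<Delta> w b else \<zero>\<^bsub>N\<^esub>)"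

lemma D_iff: "(p, q, b) \<in> D n \<longleftrightarrow> p + q = n \<and> b \<in> B p" by (simp add: D_def)

lemma inc_closed:
  assumes N: "module S N" and w: "w \<in> vecs N (B p)" and n: "p + q = n"
  shows "inc N p q w \<in> vecs N (D n)"
proof -
  interpret N: module S N by (rule N)
  have "{t. inc N p q w t \<noteq> \<zero>\<^bsub>N\<^esub>} \<subseteq> (\<lambda>b. (p, q, b)) ` {b. w b \<noteq> \<zero>\<^bsub>N\<^esub>}"
    by (auto simp: inc_def split: if_splits)
  then have "finite {t. inc N p q w t \<noteq> \<zero>\<^bsub>N\<^esub>}"
    using w unfolding fsupp_carrier by (auto dest: finite_surj)
  moreover have "inc N p q w t \<in> carrier N" for t
    using N.fsupp_apply[OF w] by (auto simp: inc_def split: prod.splits)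
  moreover have "inc N p q w t = \<zero>\<^bsub>N\<^esub>" if "t \<notin> D n" for t
    using fsupp_outside[OF w] that n unfolding inc_def D_def by (auto split: prod.splits)
  ultimately show ?thesis unfolding fsupp_carrier by blast
qed

lemma comp_closed:
  assumes z: "z \<in> vecs N (D n)" and n: "p + q = n"
  shows "(\<lambda>b. z (p, q, b)) \<in> vecs N (B p)"
proof -
  have "{b. z (p, q, b) \<noteq> \<zero>\<^bsub>N\<^esub>} \<subseteq> (\<lambda>(p, q, b). b) ` {t. z t \<noteq> \<zero>\<^bsub>N\<^esub>}" by force
  then have "finite {b. z (p, q, b) \<noteq> \<zero>\<^bsub>N\<^esub>}"
    using z unfolding fsupp_carrier by (blast intro: finite_surj)
  then show ?thesis using z n unfolding fsupp_carrier by (auto simp: D_iff)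
qed

lemma lead_split:
  assumes N: "module S N" and w: "w \<in> vecs N (B p)"
  shows "lead N p q w =
    (\<lambda>t. (if q = 0 then \<zero>\<^bsub>N\<^esub> else inc N p (q - 1) (\<lambda>b. \<xi> q \<odot>\<^bsub>N\<^esub> w b) t) \<oplus>\<^bsub>N\<^esub>
      (if p = 0 then \<zero>\<^bsub>N\<^esub> else inc N (p - 1) q (\<lambda>b. \<sigma> q \<odot>\<^bsub>N\<^esub> mapp N \<Delta> w b) t))"
proof -
  interpret N: module S N by (rule N)
  have "mapp N \<Delta> w b \<in> carrier N" if "p \<noteq> 0" for b
    using module_homD(1)[OF N.mapp_hom[OF \<Delta>_mat, of "p - 1"], of w] w that N.fsupp_apply by fastforce
  then show ?thesis
    using N.fsupp_apply[OF w] by (auto simp: lead_def inc_def fun_eq_iff)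
qed

lemma lead_closed:
  assumes N: "module S N" and w: "w \<in> vecs N (B p)" and n: "p + q = Suc n"
  shows "lead N p q w \<in> Fil N n (Suc p)"
proof -
  interpret N: module S N by (rule N)
  have 0: "(\<lambda>t. \<zero>\<^bsub>N\<^esub>) \<in> vecs N (D n)" by (simp add: fsupp_carrier)
  have 1: "(\<lambda>t. if q = 0 then \<zero>\<^bsub>N\<^esub> else inc N p (q - 1) (\<lambda>b. \<xi> q \<odot>\<^bsub>N\<^esub> w b) t) \<in> vecs N (D n)"
    using n 0 inc_closed[OF N, of "\<lambda>b. \<xi> q \<odot>\<^bsub>N\<^esub> w b" p "q - 1" n]
      N.fsupp_map_closed[OF w, of "\<lambda>u. \<xi> q \<odot>\<^bsub>N\<^esub> u" N] by (cases "q = 0") auto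
  have 2: "(\<lambda>t. if p = 0 then \<zero>\<^bsub>N\<^esub> else inc N (p - 1) q (\<lambda>b. \<sigma> q \<odot>\<^bsub>N\<^esub> mapp N \<Delta> w b) t) \<in> vecs N (D n)"
  proof (cases p)
    case (Suc p')
    have "mapp N \<Delta> w \<in> vecs N (B p')" using module_homD(1)[OF N.mapp_hom[OF \<Delta>_mat]] w Suc by simp
    from N.fsupp_map_closed[OF this, of "\<lambda>u. \<sigma> q \<odot>\<^bsub>N\<^esub> u" N] show ?thesis
      using Suc n inc_closed[OF N, of _ p' q n] by simp
  qed (simp add: 0)
  have "lead N p q w \<in> vecs N (D n)" unfolding lead_split[OF N w] by (rule N.fsupp_add_closed[OF 1 2])
  then show ?thesis by (auto simp: Fil_def lead_def)
qed

lemma Fil_closed: "z \<in> Fil N n k \<Longrightarrow> z \<in> vecs N (D n)" by (simp add: Fil_def)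

lemma Fil_zero_above: "z \<in> Fil N n k \<Longrightarrow> k \<le> p \<Longrightarrow> z (p, q, b) = \<zero>\<^bsub>N\<^esub>" by (simp add: Fil_def)

lemma Fil_mono: "z \<in> Fil N n k \<Longrightarrow> k \<le> k' \<Longrightarrow> z \<in> Fil N n k'" by (auto simp: Fil_def)

lemma Fil_top:
  assumes z: "z \<in> vecs N (D n)" and k: "Suc n \<le> k"
  shows "z \<in> Fil N n k"
proof -
  have "z (p, q, b) = \<zero>\<^bsub>N\<^esub>" if "k \<le> p" for p q b
    by (rule fsupp_outside[OF z]) (use that k in \<open>simp add: D_iff\<close>)
  with z show ?thesis by (simp add: Fil_def)
qed

lemma Fil_0: "z \<in> Fil N n 0 \<Longrightarrow> z = (\<lambda>t. \<zero>\<^bsub>N\<^esub>)" by (auto simp: Fil_def fun_eq_iff)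

lemma Fil_add:
  assumes N: "module S N" and "z \<in> Fil N n k" "z' \<in> Fil N n k"
  shows "(\<lambda>t. z t \<oplus>\<^bsub>N\<^esub> z' t) \<in> Fil N n k"
proof -
  interpret N: module S N by (rule N)
  show ?thesis using assms N.fsupp_add_closed unfolding Fil_def by auto
qed

lemma Fil_smult:
  assumes N: "module S N" and "z \<in> Fil N n k" "s \<in> carrier S"
  shows "(\<lambda>t. s \<odot>\<^bsub>N\<^esub> z t) \<in> Fil N n k"
proof -
  interpret N: module S N by (rule N)
  show ?thesis
    using assms N.fsupp_map_closed[of z "D n" "\<lambda>u. s \<odot>\<^bsub>N\<^esub> u" N] unfolding Fil_def by auto
qed

lemma Fil_minus:
  assumes N: "module S N" and z: "z \<in> Fil N n k" "z' \<in> Fil N n k"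
  shows "z \<ominus>\<^bsub>fsupp N (D n)\<^esub> z' \<in> Fil N n k"
proof -
  interpret N: module S N by (rule N)
  interpret F: module S "fsupp N (D n)" by (rule N.fsupp_module)
  show ?thesis
    using z F.M.minus_closed[OF z[THEN Fil_closed]] N.fsupp_minus[OF z[THEN Fil_closed]]
    by (auto simp: Fil_def N.M.minus_eq_zero_iff)
qed

lemma Fil_lower:
  assumes z: "z \<in> Fil N n (Suc k)" and n: "k + q = n" and 0: "\<And>b. z (k, q, b) = \<zero>\<^bsub>N\<^esub>"
  shows "z \<in> Fil N n k"
proof -
  have "z (p, q', b) = \<zero>\<^bsub>N\<^esub>" if "k \<le> p" for p q' b
  proof (cases "p = k")
    case True
    then show ?thesis
      using 0 fsupp_outside[OF Fil_closed[OF z], of "(p, q', b)"] n by (cases "q' = q") (auto simp: D_iff)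
  next
    case False
    then show ?thesis using that by (intro Fil_zero_above[OF z]) simp
  qed
  with z show ?thesis by (simp add: Fil_def)
qed

text \<open>
  In fixed total degree there is exactly one bidegree with \<open>p = k\<close>; its component is split off.
\<close>

lemma Fil_split:
  assumes N: "module S N" and z: "z \<in> Fil N n (Suc k)" and n: "k + q = n"
  obtains z' where "z' \<in> Fil N n k"
    and "z = inc N k q (\<lambda>b. z (k, q, b)) \<oplus>\<^bsub>fsupp N (D n)\<^esub> z'"
proof -
  interpret N: module S N by (rule N)
  interpret F: module S "fsupp N (D n)" by (rule N.fsupp_module)
  let ?i = "inc N k q (\<lambda>b. z (k, q, b))"
  have ic: "?i \<in> vecs N (D n)" by (rule inc_closed[OF N comp_closed[OF Fil_closed[OF z] n] n])
  then have i: "?i \<in> Fil N n (Suc k)" by (auto simp: Fil_def inc_def)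
  have zc: "z t \<in> carrier N" for t by (rule N.fsupp_apply[OF Fil_closed[OF z]])
  have "z \<ominus>\<^bsub>fsupp N (D n)\<^esub> ?i \<in> Fil N n k"
    by (rule Fil_lower[OF Fil_minus[OF N z i] n])
      (simp only: N.fsupp_minus[OF Fil_closed[OF z] ic], simp add: inc_def N.M.minus_eq_zero_iff zc)
  then show ?thesis
    by (rule that[OF _ F.M.minus_add_cancel[OF Fil_closed[OF z] ic, symmetric]])
qed

lemma Fil_reduce_top: "z \<in> Fil N n (Suc k) \<Longrightarrow> n < k \<Longrightarrow> z \<in> Fil N n k"
  by (rule Fil_top[OF Fil_closed]) auto

section \<open>Matrices with prescribed leading components\<close>

text \<open>
  \<open>A\<close> maps degree \<open>m + 1\<close> to degree \<open>m\<close> with leading components as prescribed. The remainder lies in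
  \<open>p' < p - 1\<close>, where the subtraction is truncated: for \<open>p \<le> 1\<close> the remainder is zero.
\<close>

definition leading_form :: "nat \<Rightarrow> (nat \<times> nat \<times> 'x \<Rightarrow> nat \<times> nat \<times> 'x \<Rightarrow> 's) \<Rightarrow> bool"
  where "leading_form m A \<longleftrightarrow> (\<forall>p q b. p + q = Suc m \<longrightarrow> b \<in> B p \<longrightarrow>
    (\<exists>r\<in>Fil SS m (p - 1). A (p, q, b) = (\<lambda>t. lead SS p q (free_basis S b) t \<oplus> r t)))"

lemma leading_form_mat:
  assumes "leading_form m A" shows "is_mat S (D (Suc m)) (D m) A"
  unfolding is_mat_def
proof
  fix t assume "t \<in> D (Suc m)"
  then obtain p q b where t: "t = (p, q, b)" "p + q = Suc m" "b \<in> B p" by (auto simp: D_def)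
  then obtain r where r: "r \<in> Fil SS m (p - 1)" "A t = (\<lambda>t. lead SS p q (free_basis S b) t \<oplus> r t)"
    using assms unfolding leading_form_def by blast
  have "lead SS p q (free_basis S b) \<in> Fil SS m (Suc p)"
    using S.free_basis_closed[OF t(3)] t(2) by (intro lead_closed[OF SS_module]) (simp_all add: free_module_eq)
  from Fil_closed[OF Fil_add[OF SS_module this Fil_mono[OF r(1)]]]
  show "A t \<in> carrier (free_module S (D m))"
    unfolding r(2) free_module_eq by simp
qed

lemma lead_hom:
  assumes N: "module S N" and n: "p + q = Suc n"
  shows "lead N p q \<in> module_hom S (fsupp N (B p)) (fsupp N (D n))"
proof (rule module_homI)
  interpret N: module S N by (rule N)
  show "lead N p q u \<in> vecs N (D n)" if "u \<in> vecs N (B p)" for u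
    using lead_closed[OF N that n] by (rule Fil_closed)
  have \<Delta>: "mapp N \<Delta> \<in> module_hom S (fsupp N (B p)) (fsupp N (B p'))" if "Suc p' = p" for p'
    using N.mapp_hom[OF \<Delta>_mat[of p']] that by simp
  note h = module_homD[OF \<Delta>]
  note c = N.fsupp_apply
  {
    fix u v assume u: "u \<in> vecs N (B p)" and v: "v \<in> vecs N (B p)"
    show "lead N p q (u \<oplus>\<^bsub>fsupp N (B p)\<^esub> v) = lead N p q u \<oplus>\<^bsub>fsupp N (D n)\<^esub> lead N p q v"
      using u v h(2)[OF _ u v] c[OF u] c[OF v] c[OF h(1)[OF _ u]] c[OF h(1)[OF _ v]]
      by (auto simp: lead_def fun_eq_iff N.smult_r_distr)
  next
    fix r u assume r: "r \<in> carrier S" and u: "u \<in> vecs N (B p)"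
    show "lead N p q (r \<odot>\<^bsub>fsupp N (B p)\<^esub> u) = r \<odot>\<^bsub>fsupp N (D n)\<^esub> lead N p q u"
      using r u h(3)[OF _ r u] c[OF u] c[OF h(1)[OF _ u]]
      by (auto simp: lead_def fun_eq_iff N.smult_assoc1[symmetric] S.m_comm)
  }
qed

lemma inc_hom:
  assumes N: "module S N" and n: "p + q = n"
  shows "inc N p q \<in> module_hom S (fsupp N (B p)) (fsupp N (D n))"
proof -
  interpret N: module S N by (rule N)
  show ?thesis
    using inc_closed[OF N _ n] by (intro module_homI) (auto simp: inc_def)
qed

lemma lead_scale:
  assumes N: "module S N" and b: "b \<in> B p" and n: "n \<in> carrier N"
  shows "scale N (lead SS p q (free_basis S b)) n = lead N p q (single N b n)"
proof -
  interpret N: module S N by (rule N)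
  have e: "mapp SS \<Delta> (free_basis S b) = \<Delta> b" "mapp N \<Delta> (single N b n) = scale N (\<Delta> b) n"
    if "Suc p' = p" for p'
  proof -
    have b': "b \<in> B (Suc p')" using b that by simp
    show "mapp SS \<Delta> (free_basis S b) = \<Delta> b" by (rule S.mapp_self_basis[OF \<Delta>_mat b'])
    show "mapp N \<Delta> (single N b n) = scale N (\<Delta> b) n" by (rule N.mapp_single[OF \<Delta>_mat b' n])
  qed
  have c: "\<Delta> b c \<in> carrier S" if "Suc p' = p" for p' c
    using SS.is_mat_coeff[OF \<Delta>_mat[of p']] b that by auto
  show ?thesis
    using n e c by (auto simp: scale_def lead_def fun_eq_iff single_def free_basis_def N.smult_assoc1)
qed

text \<open>
  A condition on the columns of \<open>A\<close> becomes a statement about vectors with arbitrary coefficients,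
  because the remainders of the columns again form a matrix.
\<close>

lemma leading_form_apply:
  assumes A: "leading_form m A" and N: "module S N" and n: "p + q = Suc m"
    and w: "w \<in> vecs N (B p)"
  shows "\<exists>r\<in>Fil N m (p - 1). mapp N A (inc N p q w) = (\<lambda>t. lead N p q w t \<oplus>\<^bsub>N\<^esub> r t)"
proof -
  interpret N: module S N by (rule N)
  interpret FD: module S "fsupp N (D m)" by (rule N.fsupp_module)
  have "\<forall>b\<in>B p. \<exists>r. r \<in> Fil SS m (p - 1) \<and> A (p, q, b) = (\<lambda>t. lead SS p q (free_basis S b) t \<oplus> r t)"
    using A n by (fastforce simp: leading_form_def)
  from bchoice[OF this] obtain E where E: "\<And>b. b \<in> B p \<Longrightarrow> E b \<in> Fil SS m (p - 1)"
    and AE: "\<And>b. b \<in> B p \<Longrightarrow> A (p, q, b) = (\<lambda>t. lead SS p q (free_basis S b) t \<oplus> E b t)" by blast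
  have Em: "is_mat S (B p) (D m) E" using Fil_closed[OF E] by (simp add: is_mat_def free_module_eq)
  have "mapp N A (inc N p q w) = lead N p q w \<oplus>\<^bsub>fsupp N (D m)\<^esub> mapp N E w"
  proof (rule N.fsupp_hom_eqI[OF module_hom_comp[OF inc_hom[OF N n] N.mapp_hom[OF leading_form_mat[OF A]]]
        FD.module_hom_add_closed[OF lead_hom[OF N n] N.mapp_hom[OF Em]] N.fsupp_module _ w])
    fix b u assume b: "b \<in> B p" and u: "u \<in> carrier N"
    have l: "lead SS p q (free_basis S b) \<in> vecs SS (D m)"
      using module_homD(1)[OF lead_hom[OF SS_module n]] S.free_basis_closed[OF b] by (simp add: free_module_eq)
    have "inc N p q (single N b u) = single N (p, q, b) u"
      by (auto simp: inc_def single_def fun_eq_iff)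
    then have "mapp N A (inc N p q (single N b u)) = scale N (A (p, q, b)) u"
      using N.mapp_single[OF leading_form_mat[OF A]] b u n by (simp add: D_iff)
    also have "\<dots> = (\<lambda>t. scale N (lead SS p q (free_basis S b)) u t \<oplus>\<^bsub>N\<^esub> scale N (E b) u t)"
      using u SS.fsupp_apply[OF l] SS.fsupp_apply[OF Fil_closed[OF E[OF b]]]
      by (simp add: AE[OF b] scale_def N.smult_l_distr)
    finally show "mapp N A (inc N p q (single N b u)) =
        lead N p q (single N b u) \<oplus>\<^bsub>fsupp N (D m)\<^esub> mapp N E (single N b u)"
      by (simp add: lead_scale[OF N b u] N.mapp_single[OF Em b u])
  qed
  moreover have "mapp N E w (p1, q1, b1) = \<zero>\<^bsub>N\<^esub>" if "p - 1 \<le> p1" for p1 q1 b1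
  proof -
    have "E b (p1, q1, b1) \<odot>\<^bsub>N\<^esub> w b = \<zero>\<^bsub>N\<^esub>" if "w b \<noteq> \<zero>\<^bsub>N\<^esub>" for b
    proof -
      have "b \<in> B p" using that fsupp_outside[OF w] by blast
      then show ?thesis
        using Fil_zero_above[OF E \<open>p - 1 \<le> p1\<close>] N.fsupp_apply[OF w] by simp
    qed
    then show ?thesis unfolding mapp_def dsum_ext_def by (intro N.M.add.finprod_one_eqI) simp
  qed
  ultimately show ?thesis
    using module_homD(1)[OF N.mapp_hom[OF Em] w] by (intro bexI[of _ "mapp N E w"]) (simp_all add: Fil_def)
qed

lemma leading_form_Fil:
  assumes A: "leading_form m A" and N: "module S N" and z: "z \<in> Fil N (Suc m) k"
  shows "mapp N A z \<in> Fil N m k"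
  using z
proof (induction k arbitrary: z)
  interpret N: module S N by (rule N)
  note hA = N.mapp_hom[OF leading_form_mat[OF A]]
  case 0
  then have "mapp N A z = (\<lambda>t. \<zero>\<^bsub>N\<^esub>)"
    using module_hom_zero[OF N.fsupp_module N.fsupp_module hA] Fil_0[OF 0] by simp
  then show ?case by (simp add: Fil_def fsupp_carrier)
next
  interpret N: module S N by (rule N)
  note hA = N.mapp_hom[OF leading_form_mat[OF A]]
  case (Suc k)
  show ?case
  proof (cases "Suc m < k")
    case True
    then show ?thesis by (intro Fil_mono[OF Suc.IH[OF Fil_reduce_top[OF Suc.prems True]]]) simp
  next
    case False
    then obtain q where q: "k + q = Suc m" using le_Suc_ex not_less by metis
    let ?w = "\<lambda>b. z (k, q, b)"
    obtain z' where z': "z' \<in> Fil N (Suc m) k" and zz: "z = inc N k q ?w \<oplus>\<^bsub>fsupp N (D (Suc m))\<^esub> z'"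
      using Fil_split[OF N Suc.prems q] by blast
    have w: "?w \<in> vecs N (B k)" by (rule comp_closed[OF Fil_closed[OF Suc.prems] q])
    obtain r where r: "r \<in> Fil N m (k - 1)" "mapp N A (inc N k q ?w) = (\<lambda>t. lead N k q ?w t \<oplus>\<^bsub>N\<^esub> r t)"
      using leading_form_apply[OF A N q w] by blast
    have "mapp N A z = (\<lambda>t. mapp N A (inc N k q ?w) t \<oplus>\<^bsub>N\<^esub> mapp N A z' t)"
      using module_homD(2)[OF hA inc_closed[OF N w q] Fil_closed[OF z'], folded zz] by simp
    moreover have "mapp N A (inc N k q ?w) \<in> Fil N m (Suc k)"
      unfolding r(2) by (rule Fil_add[OF N lead_closed[OF N w q] Fil_mono[OF r(1)]]) simp
    moreover have "mapp N A z' \<in> Fil N m (Suc k)" using Fil_mono[OF Suc.IH[OF z']] by simp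
    ultimately show ?thesis using Fil_add[OF N] by simp
  qed
qed

lemma leading_value:
  assumes A: "leading_form m A" and N: "module S N" and n: "p + q = Suc m"
    and w: "w \<in> vecs N (B p)" and p1: "p - 1 \<le> p1"
  shows "mapp N A (inc N p q w) (p1, q1, b) = lead N p q w (p1, q1, b)"
proof -
  interpret N: module S N by (rule N)
  obtain r where r: "r \<in> Fil N m (p - 1)" "mapp N A (inc N p q w) = (\<lambda>t. lead N p q w t \<oplus>\<^bsub>N\<^esub> r t)"
    using leading_form_apply[OF A N n w] by blast
  then show ?thesis
    using Fil_zero_above[OF r(1) p1] N.fsupp_apply[OF Fil_closed[OF lead_closed[OF N w n]]] by simp
qed

text \<open>
  The differential preserves the filtration, so the parts of \<open>z\<close> below \<open>p = k\<close> do not contribute to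
  the components of its image with \<open>p \<ge> k\<close>.
\<close>

lemma top_value:
  assumes A: "leading_form m A" and N: "module S N" and n: "k + q = Suc m"
    and z: "z \<in> Fil N (Suc m) (Suc k)" and p1: "k \<le> p1"
  shows "mapp N A z (p1, q1, b) = lead N k q (\<lambda>b. z (k, q, b)) (p1, q1, b)"
proof -
  interpret N: module S N by (rule N)
  let ?w = "\<lambda>b. z (k, q, b)"
  have w: "?w \<in> vecs N (B k)" by (rule comp_closed[OF Fil_closed[OF z] n])
  obtain z' where z': "z' \<in> Fil N (Suc m) k" and zz: "z = inc N k q ?w \<oplus>\<^bsub>fsupp N (D (Suc m))\<^esub> z'"
    using Fil_split[OF N z n] by blast
  have "mapp N A z (p1, q1, b) = mapp N A (inc N k q ?w) (p1, q1, b) \<oplus>\<^bsub>N\<^esub> mapp N A z' (p1, q1, b)"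
    using module_homD(2)[OF N.mapp_hom[OF leading_form_mat[OF A]] inc_closed[OF N w n] Fil_closed[OF z'], folded zz]
    by simp
  moreover have "mapp N A z' (p1, q1, b) = \<zero>\<^bsub>N\<^esub>"
    by (rule Fil_zero_above[OF leading_form_Fil[OF A N z'] p1])
  moreover have "mapp N A (inc N k q ?w) (p1, q1, b) = lead N k q ?w (p1, q1, b)"
    by (rule leading_value[OF A N n w]) (use p1 in simp)
  ultimately show ?thesis using N.fsupp_apply[OF Fil_closed[OF lead_closed[OF N w n]]] by simp
qed

end

section \<open>The resolution over the larger ring\<close>

context lifted_resolution
begin

lemma square_zero:
  assumes A: "leading_form m A" "leading_form (Suc m) A"
    and sq: "\<And>t. t \<in> D (Suc (Suc m)) \<Longrightarrow> mapp SS A (A t) = (\<lambda>t. \<zero>)"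
    and w: "w \<in> vecs SS (D (Suc (Suc m)))"
  shows "mapp SS A (mapp SS A w) = (\<lambda>t. \<zero>)"
proof -
  note mat = leading_form_mat[OF A(1)] leading_form_mat[OF A(2)]
  have z: "(\<lambda>w t. \<zero>) \<in> module_hom S (fsupp SS (D (Suc (Suc m)))) (fsupp SS (D m))"
    by (rule module_homI) (auto simp: fsupp_carrier)
  show ?thesis
  proof (rule SS.fsupp_hom_eqI[OF module_hom_comp[OF SS.mapp_hom[OF mat(2)] SS.mapp_hom[OF mat(1)]] z
        SS.fsupp_module _ w])
    fix t s assume t: "t \<in> D (Suc (Suc m))" and s: "s \<in> carrier SS"
    have At: "A t \<in> carrier (free_module S (D (Suc m)))" using mat(2) t by (simp add: is_mat_def)
    have "mapp SS A (mapp SS A (single SS t s)) = scale SS (mapp SS A (A t)) s"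
      unfolding SS.mapp_single[OF mat(2) t s] by (rule SS.mapp_scale[OF mat(1) At s])
    then show "mapp SS A (mapp SS A (single SS t s)) = (\<lambda>t. \<zero>)"
      using s by (simp add: sq[OF t] scale_def)
  qed
qed

text \<open>
  The periodic complexes in direction \<open>q\<close> are exact, except that in degree \<open>q = 0\<close> only the
  multiples of \<open>x\<close> are boundaries. Removing the component with the largest \<open>p\<close> repeatedly, one
  sees that a cycle is a boundary if its component in \<open>q = 0\<close>, if there is one, vanishes modulo
  \<open>x\<close>; moreover the filtration degree is preserved.
\<close>

lemma cycle_is_boundary:
  assumes A: "leading_form m A" and A': "\<And>m'. m = Suc m' \<Longrightarrow> leading_form m' A"
    and sq: "\<And>t. t \<in> D (Suc m) \<Longrightarrow> m \<noteq> 0 \<Longrightarrow> mapp SS A (A t) = (\<lambda>t. \<zero>)"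
    and z: "z \<in> Fil SS m k" and k: "k \<le> Suc m"
    and top: "k = Suc m \<Longrightarrow> (\<And>b. \<pi> (z (m, 0, b)) = \<zero>\<^bsub>R\<^esub>)"
    and cyc: "m \<noteq> 0 \<Longrightarrow> mapp SS A z = (\<lambda>t. \<zero>)"
  shows "\<exists>w\<in>Fil SS (Suc m) k. mapp SS A w = z"
  using z k top cyc
proof (induction k arbitrary: z)
  case 0
  have "mapp SS A (\<lambda>t. \<zero>) = (\<lambda>t. \<zero>)"
    using module_hom_zero[OF SS.fsupp_module SS.fsupp_module SS.mapp_hom[OF leading_form_mat[OF A]]] by simp
  then show ?case
    using Fil_0[OF 0(1)] by (intro bexI[of _ "\<lambda>t. \<zero>"]) (simp_all add: Fil_def fsupp_carrier)
next
  interpret F: module S "fsupp SS (D m)" by (rule SS.fsupp_module)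
  case (Suc k)
  obtain q where q: "k + q = m" using Suc.prems(2) le_Suc_ex by auto
  note hA = SS.mapp_hom[OF leading_form_mat[OF A]]
  note zF = Fil_closed[OF Suc.prems(1)]
  have zc: "z t \<in> carrier S" for t using SS.fsupp_apply[OF zF] by simp
  have "\<exists>t\<in>carrier S. z (k, q, b) = \<xi> (Suc q) \<otimes> t" for b
  proof (cases q)
    case 0
    then have "\<pi> (z (k, q, b)) = \<zero>\<^bsub>R\<^esub>" using Suc.prems(3) q by simp
    then show ?thesis using proj_ker[OF zc] 0 by (simp add: \<xi>_def)
  next
    case (Suc q')
    then obtain m' where m': "m = Suc m'" using q by auto
    have "mapp SS A z (k, q', b) = lead SS k q (\<lambda>b. z (k, q, b)) (k, q', b)"
      by (rule top_value[OF A'[OF m'] SS_module]) (use q m' \<open>z \<in> Fil SS m (Suc k)\<close> in simp_all)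
    then have "\<xi> q \<otimes> z (k, q, b) = \<zero>" using Suc.prems(4) m' Suc by (simp add: lead_def)
    then show ?thesis using \<xi>_ann zc by blast
  qed
  then obtain v where v: "v \<in> vecs SS (B k)" "\<And>b. z (k, q, b) = \<xi> (Suc q) \<otimes> v b"
    using vector_divide[OF comp_closed[OF zF q], of "\<xi> (Suc q)"] by auto
  have q1: "k + Suc q = Suc m" using q by simp
  define w1 where "w1 = inc SS k (Suc q) v"
  have w1c: "w1 \<in> vecs SS (D (Suc m))"
    unfolding w1_def by (rule inc_closed[OF SS_module v(1) q1])
  have w1: "w1 \<in> Fil SS (Suc m) (Suc k)" using w1c by (auto simp: Fil_def w1_def inc_def)
  have Aw1: "mapp SS A w1 \<in> Fil SS m (Suc k)" by (rule leading_form_Fil[OF A SS_module w1])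
  define z2 where "z2 = z \<ominus>\<^bsub>fsupp SS (D m)\<^esub> mapp SS A w1"
  have z2k: "z2 \<in> Fil SS m k"
  proof (rule Fil_lower[OF _ q])
    show "z2 \<in> Fil SS m (Suc k)" unfolding z2_def by (rule Fil_minus[OF SS_module Suc.prems(1) Aw1])
    have "mapp SS A w1 (k, q, b) = z (k, q, b)" for b
      using leading_value[OF A SS_module q1 v(1), of k q b] v(2) by (simp add: w1_def lead_def)
    then show "z2 (k, q, b) = \<zero>\<^bsub>SS\<^esub>" for b
      using zc SS.M.minus_eq_zero_iff by (simp add: z2_def SS.fsupp_minus[OF zF Fil_closed[OF Aw1]])
  qed
  have "mapp SS A z2 = (\<lambda>t. \<zero>)" if m: "m \<noteq> 0"
  proof -
    obtain m' where m': "m = Suc m'" using m by (cases m) auto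
    interpret F': module S "fsupp SS (D m')" by (rule SS.fsupp_module)
    have "mapp SS A (mapp SS A w1) = (\<lambda>t. \<zero>)"
      using square_zero[of m' A w1] A A' sq m' w1c by auto
    moreover have h: "mapp SS A \<in> module_hom S (fsupp SS (D m)) (fsupp SS (D m'))"
      using SS.mapp_hom[OF leading_form_mat[OF A'[OF m']]] m' by simp
    ultimately show ?thesis
      unfolding z2_def
      using module_hom_minus[OF SS.fsupp_module SS.fsupp_module h zF Fil_closed[OF Aw1]]
        Suc.prems(4)[OF m] F'.M.minus_eq_zero_iff[OF F'.M.zero_closed F'.M.zero_closed] by simp
  qed
  then obtain w2 where w2: "w2 \<in> Fil SS (Suc m) k" "mapp SS A w2 = z2"
    using Suc.IH[OF z2k] Suc.prems(2) by auto
  have "mapp SS A (\<lambda>t. w1 t \<oplus> w2 t) = z"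
    using module_homD(2)[OF hA w1c Fil_closed[OF w2(1)]] w2(2)
      F.M.minus_add_cancel[OF zF Fil_closed[OF Aw1]] unfolding z2_def by simp
  moreover have "(\<lambda>t. w1 t \<oplus> w2 t) \<in> Fil SS (Suc m) (Suc k)"
    using Fil_add[OF SS_module w1 Fil_mono[OF w2(1)]] by simp
  ultimately show ?case by blast
qed

definition aug :: "(nat \<times> nat \<times> 'x \<Rightarrow> 's) \<Rightarrow> 'm"
  where "aug = lin_ext S (restrict_scalars \<pi> M) (\<lambda>(p, q, b). a b)"

lemma aug_gen: "(\<lambda>(p, q, b). a b) \<in> D 0 \<rightarrow> carrier (restrict_scalars \<pi> M)"
  using P.aug_closed by (auto simp: D_def)

lemma aug_hom: "aug \<in> module_hom S (fsupp SS (D 0)) (restrict_scalars \<pi> M)"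
  unfolding aug_def free_module_eq[symmetric]
  by (rule module.lin_ext_hom[OF restrict_module[OF P.module_axioms] aug_gen])

text \<open>
  The augmentation over \<open>S\<close> factors through reduction modulo \<open>x\<close>, which reduces statements about its
  kernel to the given resolution over \<open>R\<close>.
\<close>

lemma aug_eq:
  assumes z: "z \<in> vecs SS (D 0)"
  shows "aug z = lin_ext R M a (\<lambda>b. \<pi> (z (0, 0, b)))"
proof (rule S.free_hom_eqI[OF _ _ restrict_module[OF P.module_axioms] _ z[folded free_module_eq]])
  show "aug \<in> module_hom S (free_module S (D 0)) (restrict_scalars \<pi> M)"
    using aug_hom by (simp add: free_module_eq)
  have c: "(\<lambda>z b. z (0, 0, b)) \<in> module_hom S (fsupp SS (D 0)) (fsupp SS (B 0))"
    using comp_closed[of _ SS 0 0 0] by (intro module_homI) auto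
  show "(\<lambda>z. lin_ext R M a (\<lambda>b. \<pi> (z (0, 0, b)))) \<in> module_hom S (free_module S (D 0)) (restrict_scalars \<pi> M)"
    using module_hom_comp[OF module_hom_comp[OF c vector_reduce_hom] module_hom_restrict_scalars[OF proj_hom P.aug_hom]]
    by (simp add: free_module_eq)
  fix t assume t: "t \<in> D 0"
  then obtain b where b: "t = (0, 0, b)" "b \<in> B 0" by (auto simp: D_def)
  have "(\<lambda>c. \<pi> (free_basis S t (0, 0, c))) = free_basis R b"
    by (auto simp: free_basis_def b proj proj_zero fun_eq_iff)
  moreover have "aug (free_basis S t) = a b"
    unfolding aug_def
    using module.lin_ext_basis[OF restrict_module[OF P.module_axioms] aug_gen t] by (simp add: b)
  ultimately show "aug (free_basis S t) = lin_ext R M a (\<lambda>c. \<pi> (free_basis S t (0, 0, c)))"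
    using P.lin_ext_basis[OF P.aug_closed b(2)] by simp
qed

definition is_cycle :: "nat \<Rightarrow> (nat \<times> nat \<times> 'x \<Rightarrow> nat \<times> nat \<times> 'x \<Rightarrow> 's) \<Rightarrow> (nat \<times> nat \<times> 'x \<Rightarrow> 's) \<Rightarrow> bool"
  where "is_cycle m A z \<longleftrightarrow> (m = 0 \<longrightarrow> aug z = \<zero>\<^bsub>M\<^esub>) \<and> (m \<noteq> 0 \<longrightarrow> mapp SS A z = (\<lambda>t. \<zero>))"

text \<open>
  The property maintained when the columns are constructed degree by degree. It involves the columns
  in degrees \<open>m\<close> and \<open>m + 1\<close> only.
\<close>

definition good :: "nat \<Rightarrow> (nat \<times> nat \<times> 'x \<Rightarrow> nat \<times> nat \<times> 'x \<Rightarrow> 's) \<Rightarrow> bool"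
  where "good m A \<longleftrightarrow> leading_form m A \<and> (\<forall>t\<in>D (Suc m). is_cycle m A (A t))"

text \<open>
  The image \<open>u\<close> of the prescribed leading part has no components with \<open>p' \<ge> p - 1\<close>: they cancel
  because \<open>x y = 0\<close> and because of the signs. For \<open>q = 0\<close> the component of \<open>u\<close> next to these is given
  by the square of \<open>\<Delta>\<close>, which is divisible by \<open>x\<close>. In both cases \<open>cycle_is_boundary\<close> shows that \<open>u\<close>
  is the image of a vector in lower filtration, and subtracting this vector leaves a cycle.
\<close>

lemma column_exists:
  assumes good: "\<And>m. m < n \<Longrightarrow> good m A" and n: "p + q = Suc n" and b: "b \<in> B p"
  shows "\<exists>r\<in>Fil SS n (p - 1). is_cycle n A (\<lambda>t. lead SS p q (free_basis S b) t \<oplus> r t)"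
proof -
  let ?e = "free_basis S b"
  have e: "?e \<in> vecs SS (B p)" using S.free_basis_closed[OF b] by (simp add: free_module_eq)
  have ec: "?e c \<in> carrier S" for c by (simp add: free_basis_def)
  let ?c = "lead SS p q ?e"
  have c: "?c \<in> vecs SS (D n)" by (rule Fil_closed[OF lead_closed[OF SS_module e n]])
  have cc: "?c t \<in> carrier S" for t using SS.fsupp_apply[OF c] by simp
  have \<Delta>e: "mapp SS \<Delta> ?e = \<Delta> b" if "p = Suc p'" for p'
    using S.mapp_self_basis[OF \<Delta>_mat[of p']] b that by simp
  have \<Delta>b: "\<Delta> b \<in> vecs SS (B p')" if "p = Suc p'" for p'
    using \<Delta>_mat[of p'] b that by (auto simp: is_mat_def free_module_eq)
  show ?thesis
  proof (cases n)
    case 0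
    have "aug ?c = \<zero>\<^bsub>M\<^esub>"
    proof -
      have "lin_ext R M a (\<lambda>c. \<pi> (?c (0, 0, c))) = \<zero>\<^bsub>M\<^esub>"
      proof (cases p)
        case (Suc p')
        then have p: "p = Suc 0" "q = 0" using n 0 by auto
        have "\<Delta> b c \<in> carrier S" for c using SS.fsupp_apply[OF \<Delta>b[OF p(1)]] by simp
        then have "(\<lambda>c. \<pi> (?c (0, 0, c))) = \<delta> b"
          using \<Delta>e[OF p(1)] proj_\<Delta>[of b 0] b p by (simp add: lead_def \<sigma>_def)
        then show ?thesis using P.aug_boundary b p by simp
      next
        case p0: 0
        then have "q = Suc 0" using n 0 by simp
        then have "(\<lambda>c. \<pi> (?c (0, 0, c))) = (\<lambda>c. \<zero>\<^bsub>R\<^esub>)"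
          using p0 by (simp add: lead_def \<xi>_def proj ec x_closed proj_x)
        then show ?thesis
          using module_hom_zero[OF P.R.free_module_module P.module_axioms P.aug_hom] by simp
      qed
      then show ?thesis using aug_eq c 0 by simp
    qed
    then have "is_cycle n A (\<lambda>t. ?c t \<oplus> \<zero>)" using 0 cc by (simp add: is_cycle_def)
    moreover have "(\<lambda>t. \<zero>) \<in> Fil SS n (p - 1)" by (simp add: Fil_def fsupp_carrier)
    ultimately show ?thesis by (intro bexI[of _ "\<lambda>t. \<zero>"])
  next
    case (Suc m)
    have gm: "leading_form m A" and sqm: "\<forall>t\<in>D (Suc m). is_cycle m A (A t)"
      using good[of m] Suc by (auto simp: good_def)
    have A': "leading_form m' A" if "m = Suc m'" for m' using good[of m'] Suc that by (auto simp: good_def)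
    have hA: "mapp SS A \<in> module_hom S (fsupp SS (D n)) (fsupp SS (D m))"
      using SS.mapp_hom[OF leading_form_mat[OF gm]] Suc by simp
    define u where "u = mapp SS A ?c"
    have uc: "u \<in> vecs SS (D m)" unfolding u_def by (rule module_homD(1)[OF hA c])
    \<comment> \<open>the images of the two leading components\<close>
    define u1 where "u1 = (if q = 0 then (\<lambda>t. \<zero>) else mapp SS A (inc SS p (q - 1) (\<lambda>c. \<xi> q \<otimes> ?e c)))"
    define u2 where "u2 = (if p = 0 then (\<lambda>t. \<zero>) else mapp SS A (inc SS (p - 1) q (\<lambda>c. \<sigma> q \<otimes> \<Delta> b c)))"
    have w1: "(\<lambda>c. \<xi> q \<otimes> ?e c) \<in> vecs SS (B p)"
      using SS.fsupp_map_closed[OF e, of "\<lambda>s. \<xi> q \<otimes> s" SS] by simp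
    have w2: "(\<lambda>c. \<sigma> q \<otimes> \<Delta> b c) \<in> vecs SS (B p')" if "p = Suc p'" for p'
      using SS.fsupp_map_closed[OF \<Delta>b[OF that], of "\<lambda>s. \<sigma> q \<otimes> s" SS] by simp
    have z0: "(\<lambda>t. \<zero>) \<in> vecs SS (D n)" by (simp add: fsupp_carrier)
    have i1: "(if q = 0 then (\<lambda>t. \<zero>) else inc SS p (q - 1) (\<lambda>c. \<xi> q \<otimes> ?e c)) \<in> vecs SS (D n)"
      using inc_closed[OF SS_module w1, of "q - 1" n] n z0 by auto
    have i2: "(if p = 0 then (\<lambda>t. \<zero>) else inc SS (p - 1) q (\<lambda>c. \<sigma> q \<otimes> \<Delta> b c)) \<in> vecs SS (D n)"
      using inc_closed[OF SS_module w2[of "p - 1"], of q n] n z0 by auto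
    have A0: "mapp SS A (\<lambda>t. \<zero>) = (\<lambda>t. \<zero>)"
      using module_hom_zero[OF SS.fsupp_module SS.fsupp_module hA] by simp
    have u: "u = (\<lambda>t. u1 t \<oplus> u2 t)"
    proof -
      have "?c = (\<lambda>t. (if q = 0 then (\<lambda>t. \<zero>) else inc SS p (q - 1) (\<lambda>c. \<xi> q \<otimes> ?e c)) t \<oplus>
          (if p = 0 then (\<lambda>t. \<zero>) else inc SS (p - 1) q (\<lambda>c. \<sigma> q \<otimes> \<Delta> b c)) t)"
        unfolding lead_split[OF SS_module e] using \<Delta>e[of "p - 1"] by (auto simp: fun_eq_iff)
      then have "u = (\<lambda>t. mapp SS A (if q = 0 then (\<lambda>t. \<zero>) else inc SS p (q - 1) (\<lambda>c. \<xi> q \<otimes> ?e c)) t \<oplus>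
          mapp SS A (if p = 0 then (\<lambda>t. \<zero>) else inc SS (p - 1) q (\<lambda>c. \<sigma> q \<otimes> \<Delta> b c)) t)"
        using module_homD(2)[OF hA i1 i2] unfolding u_def by simp
      then show ?thesis using A0 unfolding u1_def u2_def by (simp split: if_splits)
    qed
    have \<Delta>bc: "\<Delta> b c \<in> carrier S" if "p = Suc p'" for p' c
      using SS.fsupp_apply[OF \<Delta>b[OF that]] by simp
    have \<Delta>w1: "mapp SS \<Delta> (\<lambda>c. \<xi> q \<otimes> ?e c) = (\<lambda>c. \<xi> q \<otimes> \<Delta> b c)" if "p = Suc p'" for p'
      using module_homD(3)[OF SS.mapp_hom[OF \<Delta>_mat[of p']], of "\<xi> q" ?e] e \<Delta>e[OF that] that by simp
    \<comment> \<open>the leading parts cancel because the signs alternate and \<open>x y = 0\<close>\<close>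
    have uz: "u (p1, q1, b1) = \<zero>" if p1: "p - 1 \<le> p1" for p1 q1 b1
    proof -
      have 1: "u1 (p1, q1, b1) = (if Suc p1 = p \<and> Suc q1 = q then \<sigma> q1 \<otimes> (\<xi> q \<otimes> \<Delta> b b1) else \<zero>)"
      proof (cases q)
        case (Suc q')
        have "u1 (p1, q1, b1) = lead SS p q' (\<lambda>c. \<xi> q \<otimes> ?e c) (p1, q1, b1)"
          using leading_value[OF gm SS_module _ w1 p1, of q'] n \<open>n = Suc m\<close> Suc by (simp add: u1_def)
        moreover have "\<xi> q' \<otimes> (\<xi> q \<otimes> ?e b1) = \<zero>"
          using \<xi>_mult_\<xi>[of q'] Suc ec by (simp add: S.m_assoc[symmetric])
        ultimately show ?thesis using Suc \<Delta>w1[of p1] by (auto simp: lead_def)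
      qed (simp add: u1_def)
      have 2: "u2 (p1, q1, b1) = (if Suc p1 = p \<and> Suc q1 = q then \<xi> q \<otimes> (\<sigma> q \<otimes> \<Delta> b b1) else \<zero>)"
      proof (cases p)
        case (Suc p')
        have "u2 (p1, q1, b1) = lead SS p' q (\<lambda>c. \<sigma> q \<otimes> \<Delta> b c) (p1, q1, b1)"
          using leading_value[OF gm SS_module _ w2[OF Suc], of q p1] n \<open>n = Suc m\<close> Suc p1 by (simp add: u2_def)
        then show ?thesis using Suc p1 by (auto simp: lead_def)
      qed (simp add: u2_def)
      have "\<sigma> q1 \<otimes> (\<xi> q \<otimes> \<Delta> b b1) \<oplus> \<xi> q \<otimes> (\<sigma> q \<otimes> \<Delta> b b1) = \<zero>" if "p = Suc p1" "q = Suc q1"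
        using \<Delta>bc[OF that(1)] by (simp add: that(2) \<sigma>_Suc S.l_minus S.r_minus S.m_lcomm S.r_neg)
      then show ?thesis unfolding u 1 2 by auto
    qed
    have uF: "u \<in> Fil SS m (p - 1)" using uc uz by (simp add: Fil_def)
    have top: "\<pi> (u (m, 0, c)) = \<zero>\<^bsub>R\<^esub>" if pm: "p - 1 = Suc m" for c
    proof -
      have p: "p = Suc (Suc m)" "q = 0" using pm n Suc by auto
      have bb: "b \<in> B (Suc (Suc m))" using b p by simp
      have s0: "(\<lambda>c. \<sigma> q \<otimes> \<Delta> b c) = \<Delta> b" using p(2) \<Delta>bc[OF p(1)] by (simp add: \<sigma>_def)
      have \<Delta>\<Delta>: "mapp SS \<Delta> (\<Delta> b) c \<in> carrier S"
        using module_homD(1)[OF SS.mapp_hom[OF \<Delta>_mat] \<Delta>b[OF p(1)]] SS.fsupp_apply by fastforce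
      have "u2 (m, 0, c) = lead SS (Suc m) 0 (\<Delta> b) (m, 0, c)"
        using leading_value[OF gm SS_module _ w2[OF p(1)], of q m] p s0 by (simp add: u2_def)
      then have "u (m, 0, c) = mapp SS \<Delta> (\<Delta> b) c"
        unfolding u using \<Delta>\<Delta> p(2) by (simp add: u1_def lead_def \<sigma>_def)
      moreover have "(\<lambda>c. \<pi> (mapp SS \<Delta> (\<Delta> b) c)) = mapp (self_module R) \<delta> (\<delta> b)"
        using reduce_\<Delta>[OF \<Delta>b[OF p(1)]] proj_\<Delta>[OF bb] by simp
      ultimately show ?thesis using P.boundary_square[OF bb] by (metis (no_types))
    qed
    have sq: "mapp SS A (A t) = (\<lambda>t. \<zero>)" if "t \<in> D (Suc m)" "m \<noteq> 0" for t
      using sqm that by (simp add: is_cycle_def)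
    have cyc: "mapp SS A u = (\<lambda>t. \<zero>)" if m0: "m \<noteq> 0"
    proof -
      obtain m' where m': "m = Suc m'" using m0 by (cases m) auto
      show ?thesis
        unfolding u_def by (rule square_zero[of m']) (use gm A' sq m' c Suc in auto)
    qed
    obtain w where w: "w \<in> Fil SS n (p - 1)" "mapp SS A w = u"
    proof -
      have "p - 1 \<le> Suc m" using n Suc by simp
      then show ?thesis using cycle_is_boundary[OF gm A' sq uF _ top cyc] that Suc by blast
    qed
    define r where "r = (\<lambda>t. \<ominus> \<one> \<otimes> w t)"
    have r: "r \<in> Fil SS n (p - 1)" unfolding r_def using Fil_smult[OF SS_module w(1), of "\<ominus> \<one>"] by simp
    have "mapp SS A r = (\<lambda>t. \<ominus> \<one> \<otimes> u t)"
      using module_homD(3)[OF hA, of "\<ominus> \<one>" w] Fil_closed[OF w(1)] w(2) by (simp add: r_def)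
    then have "mapp SS A (\<lambda>t. ?c t \<oplus> r t) = (\<lambda>t. u t \<oplus> \<ominus> \<one> \<otimes> u t)"
      using module_homD(2)[OF hA c Fil_closed[OF r]] by (simp add: u_def)
    also have "\<dots> = (\<lambda>t. \<zero>)" using SS.fsupp_apply[OF uc] by (simp add: S.l_minus S.r_neg)
    finally show ?thesis using r Suc by (intro bexI[of _ r]) (simp_all add: is_cycle_def)
  qed
qed

lemma good_cong:
  assumes "\<And>t. t \<in> D m \<union> D (Suc m) \<Longrightarrow> A t = A' t" and g: "good m A" and g': "\<And>m'. m = Suc m' \<Longrightarrow> good m' A"
  shows "good m A'"
proof -
  have lf: "leading_form m A'" if "leading_form m A"
    using that assms(1) unfolding leading_form_def by (metis D_iff UnCI)
  have "is_cycle m A' (A' t)" if t: "t \<in> D (Suc m)" for t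
  proof -
    have c: "is_cycle m A (A t)" using g t by (simp add: good_def)
    have At: "A t \<in> vecs SS (D m)"
      using leading_form_mat[of m A] g t by (auto simp: is_mat_def good_def free_module_eq)
    have "mapp SS A (A t) = mapp SS A' (A t)" if "m = Suc m'" for m'
      by (rule SS.mapp_cong[of "D m" _ _ "D m'"])
        (use assms(1) g'[OF that] At that leading_form_mat[of m' A] in \<open>auto simp: good_def\<close>)
    then show ?thesis using c assms(1)[of t] t by (cases m) (auto simp: is_cycle_def)
  qed
  with lf g show ?thesis by (simp add: good_def)
qed

text \<open>
  Columns in degree at most \<open>n\<close> are not changed after step \<open>n\<close>, so the approximations have a limit.
\<close>

lemma matrix_exists: "\<exists>A. \<forall>m. good m A"
proof -
  define deg where "deg = (\<lambda>t :: nat \<times> nat \<times> 'x. fst t + fst (snd t))"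
  have deg: "deg t = n" if "t \<in> D n" for t n using that by (auto simp: deg_def D_def)
  define ok where "ok n A \<longleftrightarrow> (\<forall>m<n. good m A)" for n A
  have "\<exists>A. ok 0 A" by (simp add: ok_def)
  moreover have "\<exists>A'. ok (Suc n) A' \<and> (\<forall>t. deg t \<le> n \<longrightarrow> A' t = A t)" if A: "ok n A" for n A
  proof -
    have "\<forall>t\<in>D (Suc n). \<exists>r. case t of (p, q, b) \<Rightarrow>
        r \<in> Fil SS n (p - 1) \<and> is_cycle n A (\<lambda>t. lead SS p q (free_basis S b) t \<oplus> r t)"
      using column_exists[of n A] A unfolding ok_def D_def by fastforce
    from bchoice[OF this] obtain r where r: "\<forall>t\<in>D (Suc n). case t of (p, q, b) \<Rightarrow>
        r t \<in> Fil SS n (p - 1) \<and> is_cycle n A (\<lambda>t'. lead SS p q (free_basis S b) t' \<oplus> r t t')" ..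
    define A' where "A' t = (if deg t = Suc n
      then (case t of (p, q, b) \<Rightarrow> \<lambda>t'. lead SS p q (free_basis S b) t' \<oplus> r t t') else A t)" for t
    have eq: "A' t = A t" if "deg t \<le> n" for t using that by (simp add: A'_def)
    have old: "good m A'" if "m < n" for m
    proof (rule good_cong[of m A])
      show "A t = A' t" if "t \<in> D m \<union> D (Suc m)" for t using eq[of t] deg that \<open>m < n\<close> by fastforce
    qed (use A that in \<open>auto simp: ok_def\<close>)
    have "leading_form n A'"
      unfolding leading_form_def
    proof (intro allI impI)
      fix p q b assume "p + q = Suc n" "b \<in> B p"
      then have "(p, q, b) \<in> D (Suc n)" "deg (p, q, b) = Suc n" by (auto simp: D_iff deg_def)
      then show "\<exists>ra\<in>Fil SS n (p - 1). A' (p, q, b) = (\<lambda>t. lead SS p q (free_basis S b) t \<oplus> ra t)"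
        using r by (intro bexI[of _ "r (p, q, b)"]) (auto simp: A'_def)
    qed
    moreover have "is_cycle n A' (A' t)" if t: "t \<in> D (Suc n)" for t
    proof -
      have c: "is_cycle n A (A' t)" using r t deg[OF t] by (auto simp: A'_def)
      have At: "A' t \<in> vecs SS (D n)"
        using leading_form_mat[OF \<open>leading_form n A'\<close>] t by (auto simp: is_mat_def free_module_eq)
      have "mapp SS A' (A' t) = mapp SS A (A' t)" if "n = Suc m" for m
        by (rule SS.mapp_cong[of "D n" _ _ "D m"])
          (use eq deg At that old[of m] leading_form_mat[of m A'] in \<open>auto simp: good_def\<close>)
      then show ?thesis using c by (cases n) (auto simp: is_cycle_def)
    qed
    ultimately have "ok (Suc n) A'" using old by (auto simp: ok_def good_def less_Suc_eq)
    with eq show ?thesis by blast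
  qed
  ultimately obtain f where f: "\<And>n. ok n (f n)" and agree: "\<And>n t. deg t \<le> n \<Longrightarrow> f (Suc n) t = f n t"
    using dependent_nat_choice[of ok "\<lambda>n A A'. \<forall>t. deg t \<le> n \<longrightarrow> A' t = A t"] by metis
  define A where "A t = f (deg t) t" for t
  have A: "f (deg t + k) t = A t" for t k by (induction k) (simp_all add: A_def agree)
  have "good m A" for m
  proof (rule good_cong[of m "f (Suc m)"])
    fix t assume "t \<in> D m \<union> D (Suc m)"
    then have "deg t \<le> Suc m" using deg by fastforce
    then show "f (Suc m) t = A t" using A[of t "Suc m - deg t"] by simp
  qed (use f[of "Suc m"] in \<open>auto simp: ok_def\<close>)
  then show ?thesis by blast
qed

end

context lifted_resolution
begin

text \<open>
  A cycle of degree \<open>m\<close> has a component in bidegree \<open>(m, 0)\<close> whose reduction modulo \<open>x\<close> is a cycle of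
  the resolution over \<open>R\<close>, hence a boundary there. Subtracting the image of a lift makes the component
  vanish modulo \<open>x\<close>, and then \<open>cycle_is_boundary\<close> applies.
\<close>

lemma total_free_resolution:
  assumes good: "\<And>m. good m A"
  shows "free_resolution S (restrict_scalars \<pi> M) D A (\<lambda>(p, q, b). a b)"
proof -
  interpret MS: module S "restrict_scalars \<pi> M" by (rule restrict_module[OF P.module_axioms])
  have lf: "leading_form m A" and cyc: "t \<in> D (Suc m) \<Longrightarrow> is_cycle m A (A t)" for m t
    using good by (auto simp: good_def)
  have sq: "mapp SS A (A t) = (\<lambda>t. \<zero>)" if "t \<in> D (Suc m)" "m \<noteq> 0" for t m
    using cyc[OF that(1)] that(2) by (simp add: is_cycle_def)
  note mat = leading_form_mat[OF lf]
  note dhom = SS.mapp_hom[OF mat]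
  have bd: "is_cycle m A (mapp SS A w)" if w: "w \<in> vecs SS (D (Suc m))" for m w
  proof (cases m)
    case 0
    have d0: "mapp SS A \<in> module_hom S (free_module S (D (Suc 0))) (fsupp SS (D 0))"
      using dhom[of 0] by (simp add: free_module_eq)
    have z: "(\<lambda>w. \<zero>\<^bsub>M\<^esub>) \<in> module_hom S (free_module S (D (Suc 0))) (restrict_scalars \<pi> M)"
      by (rule module_homI) (auto simp: proj restrict_scalars_smult)
    have "aug (mapp SS A w) = \<zero>\<^bsub>M\<^esub>"
    proof (rule S.free_hom_eqI[OF module_hom_comp[OF d0 aug_hom] z MS.module_axioms])
      fix t assume "t \<in> D (Suc 0)"
      then show "aug (mapp SS A (free_basis S t)) = \<zero>\<^bsub>M\<^esub>"
        using cyc[of t 0] S.mapp_self_basis[OF mat] by (simp add: is_cycle_def)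
    qed (use w 0 in \<open>simp add: free_module_eq\<close>)
    then show ?thesis by (simp add: is_cycle_def 0)
  next
    case (Suc m')
    then show ?thesis using square_zero[of m' A w, OF lf lf] sq w by (simp add: is_cycle_def)
  qed
  have ex: "\<exists>w\<in>vecs SS (D (Suc m)). mapp SS A w = z"
    if z: "z \<in> vecs SS (D m)" and c: "is_cycle m A z" for m z
  proof -
    interpret FD: module S "fsupp SS (D m)" by (rule SS.fsupp_module)
    let ?zm = "\<lambda>b. z (m, 0, b)"
    have zm: "?zm \<in> vecs SS (B m)" by (rule comp_closed[OF z]) simp
    have zc: "z t \<in> carrier S" for t using SS.fsupp_apply[OF z] by simp
    \<comment> \<open>modulo \<open>x\<close>, the component in bidegree \<open>(m, 0)\<close> is a cycle of the given resolution\<close>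
    have "(\<lambda>b. \<pi> (?zm b)) \<in> P.syzygies m"
    proof (cases m)
      case 0
      then show ?thesis
        using c z aug_eq[of z] vector_reduce[OF zm] by (simp add: P.syzygies_def is_cycle_def)
    next
      case (Suc m')
      have "\<pi> (mapp SS \<Delta> ?zm b) = \<zero>\<^bsub>R\<^esub>" for b
      proof -
        have \<Delta>c: "mapp SS \<Delta> ?zm b \<in> carrier S"
          using module_homD(1)[OF SS.mapp_hom[OF \<Delta>_mat[of m']], of ?zm] zm Suc SS.fsupp_apply by fastforce
        obtain z1 where z1: "z1 \<in> Fil SS m m" "z = inc SS m 0 ?zm \<oplus>\<^bsub>fsupp SS (D m)\<^esub> z1"
          using Fil_split[OF SS_module Fil_top[OF z], of m 0] by auto
        let ?w = "\<lambda>b. z1 (m', 1, b)"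
        have wc: "?w b \<in> carrier S" using SS.fsupp_apply[OF Fil_closed[OF z1(1)]] by simp
        have "mapp SS A (inc SS m 0 ?zm) (m', 0, b) = lead SS m 0 ?zm (m', 0, b)"
          by (rule leading_value[OF lf SS_module _ zm]) (simp_all add: Suc)
        moreover have "mapp SS A z1 (m', 0, b) = lead SS m' 1 ?w (m', 0, b)"
          by (rule top_value[OF lf SS_module]) (use z1(1) Suc in simp_all)
        moreover have "mapp SS A z = (\<lambda>t. mapp SS A (inc SS m 0 ?zm) t \<oplus> mapp SS A z1 t)"
          using module_homD(2)[of "mapp SS A" S "fsupp SS (D m)" "fsupp SS (D m')" "inc SS m 0 ?zm" z1, folded z1(2)]
            dhom[of m'] inc_closed[OF SS_module zm, of 0 m] Fil_closed[OF z1(1)] Suc by simp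
        moreover have "mapp SS A z (m', 0, b) = \<zero>" using c Suc by (simp add: is_cycle_def)
        ultimately have "mapp SS \<Delta> ?zm b \<oplus> x \<otimes> ?w b = \<zero>"
          using \<Delta>c Suc by (simp add: lead_def \<sigma>_def \<xi>_def)
        moreover have "\<pi> (mapp SS \<Delta> ?zm b \<oplus> x \<otimes> ?w b) = \<pi> (mapp SS \<Delta> ?zm b)"
          using \<Delta>c wc x_closed by (simp add: proj proj_x)
        ultimately show ?thesis by (simp add: proj_zero)
      qed
      then show ?thesis
        using reduce_\<Delta>[of ?zm m'] zm Suc vector_reduce[OF zm] by (simp add: P.syzygies_def)
    qed
    then obtain u where u: "u \<in> carrier (free_module R (B (Suc m)))" "mapp (self_module R) \<delta> u = (\<lambda>b. \<pi> (?zm b))"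
      using P.syzygies_lift by blast
    define v where "v = (\<lambda>b. lift_scalar (u b))"
    have v: "v \<in> vecs SS (B (Suc m))" "(\<lambda>b. \<pi> (v b)) = u"
      unfolding v_def using vector_lift[OF u(1)] by auto
    define w where "w = inc SS (Suc m) 0 v"
    have w: "w \<in> vecs SS (D (Suc m))" unfolding w_def by (rule inc_closed[OF SS_module v(1)]) simp
    have Aw: "mapp SS A w \<in> vecs SS (D m)" by (rule module_homD(1)[OF dhom w])
    define z' where "z' = z \<ominus>\<^bsub>fsupp SS (D m)\<^esub> mapp SS A w"
    have z'c: "z' \<in> vecs SS (D m)" unfolding z'_def using z Aw by (rule FD.M.minus_closed)
    have top: "\<pi> (z' (m, 0, b)) = \<zero>\<^bsub>R\<^esub>" for b
    proof -
      have "mapp SS \<Delta> v b \<in> carrier S"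
        using SS.fsupp_apply[OF module_homD(1)[OF SS.mapp_hom[OF \<Delta>_mat] v(1)]] by simp
      then have "mapp SS A w (m, 0, b) = mapp SS \<Delta> v b"
        using leading_value[OF lf SS_module _ v(1), of 0 m m 0 b] by (simp add: w_def lead_def \<sigma>_def)
      moreover have "\<pi> (mapp SS \<Delta> v b) = \<pi> (z (m, 0, b))"
        using fun_cong[OF reduce_\<Delta>[OF v(1)], of b] u(2) v(2) by (simp add: fun_eq_iff)
      moreover have "mapp SS A w (m, 0, b) \<oplus> z' (m, 0, b) = z (m, 0, b)"
        using fun_cong[OF FD.M.minus_add_cancel[OF z Aw], of "(m, 0, b)"] by (simp add: z'_def)
      then have "\<pi> (mapp SS A w (m, 0, b)) \<oplus>\<^bsub>R\<^esub> \<pi> (z' (m, 0, b)) = \<pi> (z (m, 0, b))"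
        using proj(3)[of "mapp SS A w (m, 0, b)" "z' (m, 0, b)"] SS.fsupp_apply[OF z'c] SS.fsupp_apply[OF Aw]
        by simp
      ultimately have "\<pi> (z (m, 0, b)) \<oplus>\<^bsub>R\<^esub> \<pi> (z' (m, 0, b)) = \<pi> (z (m, 0, b))" by simp
      then show ?thesis by (rule P.R.add_eq_self) (use proj(1) zc SS.fsupp_apply[OF z'c] in simp_all)
    qed
    have "mapp SS A z' = (\<lambda>t. \<zero>)" if m: "m \<noteq> 0"
    proof -
      obtain m' where m': "m = Suc m'" using m by (cases m) auto
      interpret F: module S "fsupp SS (D m')" by (rule SS.fsupp_module)
      have h: "mapp SS A \<in> module_hom S (fsupp SS (D m)) (fsupp SS (D m'))" using dhom m' by simp
      show ?thesis
        using module_hom_minus[OF SS.fsupp_module SS.fsupp_module h z Aw] bd[OF w] c m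
          F.M.minus_eq_zero_iff[OF F.M.zero_closed F.M.zero_closed] by (simp add: is_cycle_def z'_def)
    qed
    then obtain w' where w': "w' \<in> Fil SS (Suc m) (Suc m)" "mapp SS A w' = z'"
    proof -
      have sqm: "mapp SS A (A t) = (\<lambda>t. \<zero>)" if "t \<in> D (Suc m)" "m \<noteq> 0" for t by (rule sq[OF that])
      show ?thesis
        using cycle_is_boundary[OF lf lf sqm Fil_top[OF z'c order_refl] order_refl top]
          \<open>m \<noteq> 0 \<Longrightarrow> mapp SS A z' = (\<lambda>t. \<zero>)\<close> that by blast
    qed
    have "mapp SS A (w \<oplus>\<^bsub>fsupp SS (D (Suc m))\<^esub> w') = mapp SS A w \<oplus>\<^bsub>fsupp SS (D m)\<^esub> z'"
      using module_homD(2)[OF dhom w Fil_closed[OF w'(1)]] w'(2) by simp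
    also have "\<dots> = z" unfolding z'_def by (rule FD.M.minus_add_cancel[OF z Aw])
    finally show ?thesis
      using SS.fsupp_add_closed[OF w Fil_closed[OF w'(1)]] by auto
  qed
  show ?thesis
  proof (intro free_resolution.intro free_resolution_axioms.intro MS.module_axioms mat aug_gen)
    show "carrier (restrict_scalars \<pi> M) \<subseteq> lin_ext S (restrict_scalars \<pi> M) (\<lambda>(p, q, b). a b) ` carrier (free_module S (D 0))"
    proof
      fix u assume "u \<in> carrier (restrict_scalars \<pi> M)"
      then obtain w where w: "w \<in> carrier (free_module R (B 0))" "lin_ext R M a w = u"
        using P.aug_surj by auto
      define v where "v = (\<lambda>b. lift_scalar (w b))"
      have v: "v \<in> vecs SS (B 0)" "(\<lambda>b. \<pi> (v b)) = w"
        unfolding v_def using vector_lift[OF w(1)] by auto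
      have i: "inc SS 0 0 v \<in> vecs SS (D 0)" by (rule inc_closed[OF SS_module v(1)]) simp
      have "aug (inc SS 0 0 v) = u" using aug_eq[OF i] v(2) w(2) by (simp add: inc_def)
      then show "u \<in> lin_ext S (restrict_scalars \<pi> M) (\<lambda>(p, q, b). a b) ` carrier (free_module S (D 0))"
        using i unfolding aug_def free_module_eq by blast
    qed
    show "mapp SS A ` carrier (free_module S (D (Suc i))) = {z \<in> carrier (free_module S (D i)).
        (i = 0 \<longrightarrow> lin_ext S (restrict_scalars \<pi> M) (\<lambda>(p, q, b). a b) z = \<zero>\<^bsub>restrict_scalars \<pi> M\<^esub>) \<and>
        (i \<noteq> 0 \<longrightarrow> mapp SS A z = (\<lambda>x. \<zero>))}" for i
      using bd ex module_homD(1)[OF dhom]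
      unfolding free_module_eq is_cycle_def aug_def restrict_scalars_simps by blast
  qed
qed

section \<open>Coefficients annihilated by both zero-divisors\<close>

text \<open>
  Since \<open>x\<close> and \<open>y\<close> annihilate \<open>N\<close>, the differential with coefficients in \<open>N\<close> lowers \<open>p\<close>, and its leading
  component is, up to sign, the differential of the resolution over \<open>R\<close> with coefficients in \<open>N\<close>.
  The latter is assumed to be exact in degrees \<open>1, \<dots>, n\<close>.
\<close>

context
  fixes N :: "('r, 'n, 'q) module_scheme" and A and n :: nat
  assumes N: "module R N" and yN: "\<And>v. v \<in> carrier N \<Longrightarrow> \<pi> y \<odot>\<^bsub>N\<^esub> v = \<zero>\<^bsub>N\<^esub>"
    and good: "\<And>m. good m A"
    and vanish: "\<And>i. 1 \<le> i \<Longrightarrow> i \<le> n \<Longrightarrow>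
      coeff_cycles N B \<delta> i \<subseteq> coeff_boundaries N B \<delta> i"
begin

abbreviation "NS \<equiv> restrict_scalars \<pi> N"

interpretation NS: module S NS by (rule restrict_module[OF N])

lemma lf: "leading_form m A" using good by (simp add: good_def)

lemma dhom: "mapp NS A \<in> module_hom S (fsupp NS (D (Suc m))) (fsupp NS (D m))"
  by (rule NS.mapp_hom[OF leading_form_mat[OF lf]])

lemma \<Delta>hom: "mapp NS \<Delta> \<in> module_hom S (fsupp NS (B (Suc m))) (fsupp NS (B m))"
  by (rule NS.mapp_hom[OF \<Delta>_mat])

lemma \<xi>_zero: "v \<in> carrier N \<Longrightarrow> \<xi> q \<odot>\<^bsub>NS\<^esub> v = \<zero>\<^bsub>N\<^esub>"
  using yN module.smult_l_null[OF N] by (simp add: \<xi>_def proj_x restrict_scalars_smult)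

lemma \<sigma>_cancel: "v \<in> carrier N \<Longrightarrow> \<sigma> q \<odot>\<^bsub>NS\<^esub> (\<sigma> q \<odot>\<^bsub>NS\<^esub> v) = v"
  using NS.smult_assoc1[of "\<sigma> q" "\<sigma> q" v] NS.smult_one[of v] by (simp add: \<sigma>_square)

lemma lead_N:
  assumes w: "w \<in> vecs NS (B p)"
  shows "lead NS p q w = (\<lambda>(p', q', b).
    if Suc p' = p \<and> q' = q then \<sigma> q \<odot>\<^bsub>NS\<^esub> mapp NS \<Delta> w b else \<zero>\<^bsub>N\<^esub>)"
  using NS.fsupp_apply[OF w] \<xi>_zero by (auto simp: lead_def fun_eq_iff)

lemma exact_N:
  assumes "1 \<le> p" "p \<le> n" and w: "w \<in> vecs NS (B p)" "mapp NS \<Delta> w = (\<lambda>b. \<zero>\<^bsub>N\<^esub>)"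
  shows "\<exists>v\<in>vecs NS (B (Suc p)). w = mapp NS \<Delta> v"
proof -
  obtain p' where p': "p = Suc p'" using assms(1) by (cases p) auto
  have wN: "w \<in> vecs N (B p)" using w by (simp add: fsupp_restrict_scalars)
  then have "mapp N \<delta> w = (\<lambda>b. \<zero>\<^bsub>N\<^esub>)" using mapp_\<Delta>_restrict[OF N, of w p'] w(2) p' by simp
  then have "w \<in> coeff_cycles N B \<delta> p" using wN p' by (simp add: cycles_def)
  then obtain v where v: "v \<in> vecs N (B (Suc p))" "w = mapp N \<delta> v"
    using vanish[OF assms(1,2)] by (auto simp: boundaries_def)
  then have "w = mapp NS \<Delta> v" using mapp_\<Delta>_restrict[OF N v(1)] by simp
  with v(1) show ?thesis by (auto simp: fsupp_restrict_scalars)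
qed

lemma boundary_drops:
  assumes z: "z \<in> Fil NS (Suc m) (Suc k)"
  shows "mapp NS A z \<in> Fil NS m k"
proof (cases "Suc m < k")
  case True
  then show ?thesis using leading_form_Fil[OF lf NS.module_axioms Fil_reduce_top[OF z]] by simp
next
  case False
  then obtain q where q: "k + q = Suc m" using le_Suc_ex not_less by metis
  let ?w = "\<lambda>b. z (k, q, b)"
  have w: "?w \<in> vecs NS (B k)" by (rule comp_closed[OF Fil_closed[OF z] q])
  have "mapp NS A z (p1, q1, b) = \<zero>\<^bsub>N\<^esub>" if "k \<le> p1" for p1 q1 b
    using top_value[OF lf NS.module_axioms q z that] that by (simp add: lead_N[OF w])
  then show ?thesis using Fil_closed[OF leading_form_Fil[OF lf NS.module_axioms z]] by (simp add: Fil_def)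
qed

text \<open>
  If the differential of \<open>z\<close> vanishes one step below the top component of \<open>z\<close>, then this component is
  a cycle for the leading differential, hence a boundary if its \<open>p\<close> is between \<open>1\<close> and \<open>n\<close>, and it can
  be removed from \<open>z\<close> at the cost of a boundary.
\<close>

lemma descend_step:
  assumes z: "z \<in> Fil NS (Suc j) (Suc k)" and k: "1 \<le> k" "k \<le> n" "k \<le> Suc j"
    and dz: "mapp NS A z \<in> Fil NS j (k - 1)"
  shows "\<exists>V\<in>vecs NS (D (Suc (Suc j))). \<exists>z'\<in>Fil NS (Suc j) k.
    z = (\<lambda>t. mapp NS A V t \<oplus>\<^bsub>N\<^esub> z' t)"
proof -
  obtain q where q: "k + q = Suc j" using k(3) le_Suc_ex by metis
  obtain k' where k': "k = Suc k'" using k(1) by (cases k) auto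
  let ?w = "\<lambda>b. z (k, q, b)"
  obtain z0 where z0: "z0 \<in> Fil NS (Suc j) k" and zz: "z = inc NS k q ?w \<oplus>\<^bsub>fsupp NS (D (Suc j))\<^esub> z0"
    using Fil_split[OF NS.module_axioms z q] by blast
  have w: "?w \<in> vecs NS (B k)" by (rule comp_closed[OF Fil_closed[OF z] q])
  have iw: "inc NS k q ?w \<in> vecs NS (D (Suc j))" by (rule inc_closed[OF NS.module_axioms w q])
  have \<Delta>w: "mapp NS \<Delta> ?w b \<in> carrier N" for b
    using NS.fsupp_apply[OF module_homD(1)[OF \<Delta>hom, of ?w k']] w k' by simp
  have dz0: "mapp NS A z0 \<in> Fil NS j k'" using boundary_drops z0 k' by simp
  have "mapp NS \<Delta> ?w b = \<zero>\<^bsub>N\<^esub>" for b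
  proof -
    have "mapp NS A z (k', q, b) = mapp NS A (inc NS k q ?w) (k', q, b) \<oplus>\<^bsub>N\<^esub> mapp NS A z0 (k', q, b)"
      using module_homD(2)[OF dhom iw Fil_closed[OF z0], folded zz] by simp
    moreover have "mapp NS A z (k', q, b) = \<zero>\<^bsub>N\<^esub>" "mapp NS A z0 (k', q, b) = \<zero>\<^bsub>N\<^esub>"
      using Fil_zero_above[OF dz, of k'] Fil_zero_above[OF dz0, of k'] k' by simp_all
    moreover have "mapp NS A (inc NS k q ?w) (k', q, b) = lead NS k q ?w (k', q, b)"
      by (rule leading_value[OF lf NS.module_axioms q w]) (simp add: k')
    moreover have "\<sigma> q \<odot>\<^bsub>NS\<^esub> mapp NS \<Delta> ?w b \<in> carrier N" using NS.smult_closed \<Delta>w by simp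
    moreover have "lead NS k q ?w (k', q, b) = \<sigma> q \<odot>\<^bsub>NS\<^esub> mapp NS \<Delta> ?w b"
      unfolding lead_N[OF w] using k' by simp
    ultimately have "\<sigma> q \<odot>\<^bsub>NS\<^esub> mapp NS \<Delta> ?w b = \<zero>\<^bsub>N\<^esub>"
      using NS.M.r_zero[of "\<sigma> q \<odot>\<^bsub>NS\<^esub> mapp NS \<Delta> ?w b"]
      by simp
    then have "\<sigma> q \<odot>\<^bsub>NS\<^esub> (\<sigma> q \<odot>\<^bsub>NS\<^esub> mapp NS \<Delta> ?w b) = \<zero>\<^bsub>N\<^esub>"
      using NS.smult_r_null[OF \<sigma>_closed, of q] by simp
    then show ?thesis using \<sigma>_cancel[OF \<Delta>w] by simp
  qed
  then obtain v where v: "v \<in> vecs NS (B (Suc k))" "?w = mapp NS \<Delta> v"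
    using exact_N[OF k(1,2) w] by blast
  define v' where "v' = (\<lambda>b. \<sigma> q \<odot>\<^bsub>NS\<^esub> v b)"
  have v': "v' \<in> vecs NS (B (Suc k))"
    using NS.fsupp_map_closed[OF v(1), of "\<lambda>u. \<sigma> q \<odot>\<^bsub>NS\<^esub> u" NS] NS.smult_r_null[OF \<sigma>_closed, of q] NS.smult_closed[OF \<sigma>_closed, of _ q]
    unfolding v'_def by simp
  have wv: "z (k, q, b) = mapp NS \<Delta> v b" for b using fun_cong[OF v(2), of b] .
  have \<Delta>v': "mapp NS \<Delta> v' = (\<lambda>b. \<sigma> q \<odot>\<^bsub>NS\<^esub> ?w b)"
    using module_homD(3)[OF \<Delta>hom \<sigma>_closed v(1), of q] unfolding wv v'_def by simp
  have q1: "Suc k + q = Suc (Suc j)" using q by simp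
  define V where "V = inc NS (Suc k) q v'"
  have V: "V \<in> vecs NS (D (Suc (Suc j)))" unfolding V_def by (rule inc_closed[OF NS.module_axioms v' q1])
  obtain s where s: "s \<in> Fil NS (Suc j) k" "mapp NS A V = (\<lambda>t. lead NS (Suc k) q v' t \<oplus>\<^bsub>N\<^esub> s t)"
    using leading_form_apply[OF lf NS.module_axioms q1 v'] by (auto simp: V_def)
  have l: "lead NS (Suc k) q v' = inc NS k q ?w"
  proof -
    have "\<sigma> q \<odot>\<^bsub>NS\<^esub> (\<sigma> q \<odot>\<^bsub>NS\<^esub> ?w b) = ?w b" for b using \<sigma>_cancel NS.fsupp_apply[OF w] by simp
    then show ?thesis
      unfolding lead_N[OF v'] \<Delta>v' by (auto simp: inc_def fun_eq_iff)
  qed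
  show ?thesis
  proof (intro bexI[OF _ V] bexI[OF _ Fil_minus[OF NS.module_axioms z0 s(1)]] ext)
    fix t
    have c: "inc NS k q ?w t \<in> carrier NS" "s t \<in> carrier NS" "z0 t \<in> carrier NS"
      using NS.fsupp_apply[OF iw] NS.fsupp_apply[OF Fil_closed[OF s(1)]] NS.fsupp_apply[OF Fil_closed[OF z0]] by blast+
    have "(inc NS k q ?w t \<oplus>\<^bsub>NS\<^esub> s t) \<oplus>\<^bsub>NS\<^esub> (z0 t \<ominus>\<^bsub>NS\<^esub> s t) = inc NS k q ?w t \<oplus>\<^bsub>NS\<^esub> z0 t"
      using c NS.M.minus_add_cancel[OF c(3,2)] NS.M.a_assoc[OF c(1,2) NS.M.minus_closed[OF c(3,2)]] by simp
    then show "z t = mapp NS A V t \<oplus>\<^bsub>N\<^esub> (z0 \<ominus>\<^bsub>fsupp NS (D (Suc j))\<^esub> s) t"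
      using fun_cong[OF zz, of t] by (simp add: s(2) l NS.fsupp_minus[OF Fil_closed[OF z0] Fil_closed[OF s(1)]])
  qed
qed

lemma total_complex: "chain_complex S (\<lambda>i. fsupp NS (D i)) (\<lambda>i. mapp NS A)"
  by (rule free_resolution.coeff_complex[OF total_free_resolution[OF good] NS.module_axioms])

lemma descend_trivial:
  assumes z: "z \<in> Fil NS (Suc j) l"
  shows "\<exists>V\<in>vecs NS (D (Suc (Suc j))). \<exists>z'\<in>Fil NS (Suc j) l.
    z = (\<lambda>t. mapp NS A V t \<oplus>\<^bsub>N\<^esub> z' t)"
proof (intro bexI[OF _ z] bexI)
  interpret F: module S "fsupp NS (D (Suc (Suc j)))" by (rule NS.fsupp_module)
  show "(\<lambda>t. \<zero>\<^bsub>N\<^esub>) \<in> vecs NS (D (Suc (Suc j)))" using F.M.zero_closed by simp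
  have "mapp NS A (\<lambda>t. \<zero>\<^bsub>N\<^esub>) = (\<lambda>t. \<zero>\<^bsub>N\<^esub>)"
    using module_hom_zero[OF NS.fsupp_module NS.fsupp_module dhom] by simp
  then show "z = (\<lambda>t. mapp NS A (\<lambda>t. \<zero>\<^bsub>N\<^esub>) t \<oplus>\<^bsub>N\<^esub> z t)"
    using NS.fsupp_apply[OF Fil_closed[OF z]] NS.M.l_zero by simp
qed

text \<open>
  Iterating the step removes all components with \<open>p > l\<close>. It is used with \<open>l = 0\<close> for cycles, and with
  \<open>l = 1\<close> for vectors whose differential lies in \<open>p = 0\<close>.
\<close>

lemma descend:
  assumes "z \<in> Fil NS (Suc j) K" "K \<le> Suc n" "mapp NS A z \<in> Fil NS j l"
  shows "\<exists>V\<in>vecs NS (D (Suc (Suc j))). \<exists>z'\<in>Fil NS (Suc j) (Suc l).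
    z = (\<lambda>t. mapp NS A V t \<oplus>\<^bsub>N\<^esub> z' t)"
  using assms
proof (induction K arbitrary: z)
  case base: 0
  have "z \<in> Fil NS (Suc j) (Suc l)" by (rule Fil_mono[OF base(1)]) simp
  then show ?case by (rule descend_trivial)
next
  case (Suc k)
  consider "k \<le> l" | "l < k" "Suc j < k" | "l < k" "k \<le> Suc j" by linarith
  then show ?case
  proof cases
    case 1
    have "z \<in> Fil NS (Suc j) (Suc l)" by (rule Fil_mono[OF Suc.prems(1)]) (use 1 in simp)
    then show ?thesis by (rule descend_trivial)
  next
    case 2
    then show ?thesis using Suc.IH[OF Fil_reduce_top[OF Suc.prems(1)]] Suc.prems by simp
  next
    case 3
    have "mapp NS A z \<in> Fil NS j (k - 1)" by (rule Fil_mono[OF Suc.prems(3)]) (use 3 in simp)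
    then obtain V z' where V: "V \<in> vecs NS (D (Suc (Suc j)))" and z': "z' \<in> Fil NS (Suc j) k"
      and zz: "z = (\<lambda>t. mapp NS A V t \<oplus>\<^bsub>N\<^esub> z' t)"
    proof -
      have "1 \<le> k" "k \<le> n" using 3 Suc.prems(2) by simp_all
      from descend_step[OF Suc.prems(1) this 3(2) \<open>mapp NS A z \<in> Fil NS j (k - 1)\<close>] show ?thesis
        using that by blast
    qed
    note AV = module_homD(1)[OF dhom V]
    have "mapp NS A (mapp NS A V) = (\<lambda>t. \<zero>\<^bsub>N\<^esub>)" using total_complex V by (simp add: chain_complex_def)
    then have "mapp NS A z = mapp NS A z'"
      using module_homD(2)[OF dhom AV Fil_closed[OF z']] NS.M.l_zero
        NS.fsupp_apply[OF module_homD(1)[OF dhom Fil_closed[OF z']]] by (simp add: zz)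
    then obtain V' z'' where V': "V' \<in> vecs NS (D (Suc (Suc j)))" and z'': "z'' \<in> Fil NS (Suc j) (Suc l)"
      and zz': "z' = (\<lambda>t. mapp NS A V' t \<oplus>\<^bsub>N\<^esub> z'' t)"
      using Suc.IH[OF z'] Suc.prems by auto
    note AV' = module_homD(1)[OF dhom V']
    have "z = (\<lambda>t. mapp NS A (V \<oplus>\<^bsub>fsupp NS (D (Suc (Suc j)))\<^esub> V') t \<oplus>\<^bsub>N\<^esub> z'' t)"
      using module_homD(2)[OF dhom V V'] NS.M.a_assoc NS.fsupp_apply[OF AV] NS.fsupp_apply[OF AV']
        NS.fsupp_apply[OF Fil_closed[OF z'']] by (simp add: zz zz')
    moreover have "V \<oplus>\<^bsub>fsupp NS (D (Suc (Suc j)))\<^esub> V' \<in> vecs NS (D (Suc (Suc j)))"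
      using NS.fsupp_add_closed[OF V V'] by simp
    ultimately show ?thesis using z'' by blast
  qed
qed

text \<open>
  Up to boundaries every cycle of degree \<open>i\<close> is concentrated in \<open>p = 0\<close>, where the only boundaries are
  those coming from \<open>p = 1\<close>. For the second claim vectors of degree \<open>i + 1\<close> are descended, with \<open>p\<close> up
  to \<open>i + 1\<close>; this is where \<open>i < n\<close> is used.
\<close>

lemma homology_iso_cokernel:
  assumes i: "i < n"
  shows "module_iso S (quot_module (fsupp NS (B 0)) (mapp NS \<Delta> ` vecs NS (B (Suc 0))))
    (coeff_homology NS D A i)"
proof -
  let ?C = "\<lambda>i. fsupp NS (D i)" and ?d = "\<lambda>i::nat. mapp NS A"
  let ?H = "mapp NS \<Delta> ` vecs NS (B (Suc 0))"
  note ih = inc_hom[OF NS.module_axioms, of 0 i i, simplified]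
  have vec0: "inc NS 0 i w \<in> Fil NS i 1" if "w \<in> vecs NS (B 0)" for w
    using module_homD(1)[OF ih that] by (auto simp: Fil_def inc_def)
  have split0: "z = inc NS 0 i (\<lambda>b. z (0, i, b))" if z: "z \<in> Fil NS i 1" for z
  proof -
    obtain z' where z': "z' \<in> Fil NS i 0" "z = inc NS 0 i (\<lambda>b. z (0, i, b)) \<oplus>\<^bsub>fsupp NS (D i)\<^esub> z'"
      using Fil_split[OF NS.module_axioms, of z i 0 i] z by auto
    have "inc NS 0 i (\<lambda>b. z (0, i, b)) t \<in> carrier NS" for t
      using NS.fsupp_apply[OF Fil_closed[OF z]] NS.M.zero_closed by (auto simp: inc_def split: prod.splits)
    then show ?thesis
      using NS.M.r_zero by (subst z'(2)) (simp add: Fil_0[OF z'(1)])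
  qed
  have d1: "mapp NS A (inc NS 1 i w) = (\<lambda>t. inc NS 0 i (\<lambda>b. \<sigma> i \<odot>\<^bsub>NS\<^esub> mapp NS \<Delta> w b) t)"
    if w: "w \<in> vecs NS (B (Suc 0))" for w
  proof -
    have w1: "w \<in> vecs NS (B 1)" using w by simp
    have "mapp NS A (inc NS 1 i w) (p1, q1, b) = lead NS 1 i w (p1, q1, b)" for p1 q1 b
      by (rule leading_value[OF lf NS.module_axioms _ w1]) simp_all
    then have "mapp NS A (inc NS 1 i w) = lead NS 1 i w" by auto
    also have "\<dots> = (\<lambda>t. inc NS 0 i (\<lambda>b. \<sigma> i \<odot>\<^bsub>NS\<^esub> mapp NS \<Delta> w b) t)"
      unfolding lead_N[OF w1] by (auto simp: inc_def fun_eq_iff)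
    finally show ?thesis .
  qed
  have \<sigma>w: "(\<lambda>b. \<sigma> i \<odot>\<^bsub>NS\<^esub> w b) \<in> vecs NS X" if "w \<in> vecs NS X" for w and X :: "'x set"
    using NS.fsupp_map_closed[OF that, of "\<lambda>u. \<sigma> i \<odot>\<^bsub>NS\<^esub> u" NS] NS.smult_r_null[OF \<sigma>_closed, of i] NS.smult_closed[OF \<sigma>_closed, of _ i]
    by simp
  have \<Delta>\<sigma>: "(\<lambda>b. \<sigma> i \<odot>\<^bsub>NS\<^esub> mapp NS \<Delta> (\<lambda>b. \<sigma> i \<odot>\<^bsub>NS\<^esub> w b) b) = mapp NS \<Delta> w"
    if w: "w \<in> vecs NS (B (Suc 0))" for w
  proof -
    have "mapp NS \<Delta> (\<lambda>b. \<sigma> i \<odot>\<^bsub>NS\<^esub> w b) = (\<lambda>b. \<sigma> i \<odot>\<^bsub>NS\<^esub> mapp NS \<Delta> w b)"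
      using module_homD(3)[OF \<Delta>hom \<sigma>_closed w, of i] by simp
    then show ?thesis
      using \<sigma>_cancel NS.fsupp_apply[OF module_homD(1)[OF \<Delta>hom w]] by simp
  qed
  show ?thesis
    unfolding homology_eq
  proof (rule quot_module_iso[OF NS.fsupp_module cycles_module[OF total_complex] _
        module_hom_image_submodule[OF NS.fsupp_module NS.fsupp_module \<Delta>hom]
        boundaries_submodule_cycles[OF total_complex]])
    have ic: "inc NS 0 i w \<in> cycles ?C ?d i" if w: "w \<in> vecs NS (B 0)" for w
    proof -
      have "mapp NS A (inc NS 0 i w) = (\<lambda>t. \<zero>\<^bsub>N\<^esub>)" if "i = Suc j" for j
        using Fil_0[OF boundary_drops[of _ j 0]] vec0[OF w] that by simp
      then show ?thesis using module_homD(1)[OF ih w] by (auto simp: cycles_def)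
    qed
    show "inc NS 0 i \<in> module_hom S (fsupp NS (B 0)) ((?C i)\<lparr>carrier := cycles ?C ?d i\<rparr>)"
      using ic module_homD(2,3)[OF ih] by (intro module_homI) simp_all
    fix z assume z: "z \<in> vecs NS (B 0)"
    show "inc NS 0 i z \<in> boundaries ?C ?d i \<longleftrightarrow> z \<in> ?H"
    proof
      assume "z \<in> ?H"
      then obtain w where w: "w \<in> vecs NS (B (Suc 0))" "z = mapp NS \<Delta> w" by auto
      have "inc NS 0 i z = mapp NS A (inc NS 1 i (\<lambda>b. \<sigma> i \<odot>\<^bsub>NS\<^esub> w b))"
        unfolding d1[OF \<sigma>w[OF w(1)]] \<Delta>\<sigma>[OF w(1)] w(2) ..
      moreover have "inc NS 1 i (\<lambda>b. \<sigma> i \<odot>\<^bsub>NS\<^esub> w b) \<in> carrier (?C (Suc i))"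
        using inc_closed[OF NS.module_axioms, of "\<lambda>b. \<sigma> i \<odot>\<^bsub>NS\<^esub> w b" 1 i] \<sigma>w[OF w(1)] by simp
      ultimately show "inc NS 0 i z \<in> boundaries ?C ?d i" by (auto simp: boundaries_def)
    next
      assume "inc NS 0 i z \<in> boundaries ?C ?d i"
      then obtain W where W: "W \<in> carrier (?C (Suc i))" "inc NS 0 i z = mapp NS A W" by (auto simp: boundaries_def)
      have "\<exists>V\<in>vecs NS (D (Suc (Suc i))). \<exists>W'\<in>Fil NS (Suc i) (Suc 1).
          W = (\<lambda>t. mapp NS A V t \<oplus>\<^bsub>N\<^esub> W' t)"
        by (rule descend[OF Fil_top[OF W(1) order_refl]]) (use i vec0[OF z] W(2) in simp_all)
      then obtain V W' where V: "V \<in> carrier (?C (Suc (Suc i)))" and W': "W' \<in> Fil NS (Suc i) (Suc 1)"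
        and WW: "W = (\<lambda>t. mapp NS A V t \<oplus>\<^bsub>N\<^esub> W' t)" by blast
      have "mapp NS A (mapp NS A V) = (\<lambda>t. \<zero>\<^bsub>N\<^esub>)" using total_complex V by (simp add: chain_complex_def)
      then have e: "mapp NS A W = mapp NS A W'"
        using module_homD(2)[OF dhom module_homD(1)[OF dhom V] Fil_closed[OF W']] NS.M.l_zero
          NS.fsupp_apply[OF module_homD(1)[OF dhom Fil_closed[OF W']]] by (simp add: WW)
      let ?w = "\<lambda>b. W' (1, i, b)"
      have w: "?w \<in> vecs NS (B (Suc 0))" using comp_closed[OF Fil_closed[OF W'], of 1 i] by simp
      obtain W0 where W0: "W0 \<in> Fil NS (Suc i) 1" "W' = inc NS 1 i ?w \<oplus>\<^bsub>fsupp NS (D (Suc i))\<^esub> W0"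
        using Fil_split[OF NS.module_axioms W', of i] by auto
      have "mapp NS A W0 = (\<lambda>t. \<zero>\<^bsub>N\<^esub>)" using Fil_0[OF boundary_drops[of W0 i 0]] W0(1) by simp
      moreover have iw: "inc NS 1 i ?w \<in> carrier (?C (Suc i))"
        using inc_closed[OF NS.module_axioms, of ?w 1 i "Suc i"] w by simp
      ultimately have "mapp NS A W' = mapp NS A (inc NS 1 i ?w)"
        using module_homD(2)[OF dhom iw Fil_closed[OF W0(1)], folded W0(2)] NS.M.r_zero
          NS.fsupp_apply[OF module_homD(1)[OF dhom iw]] by simp
      then have "inc NS 0 i z (0, i, b) = inc NS 0 i (\<lambda>b. \<sigma> i \<odot>\<^bsub>NS\<^esub> mapp NS \<Delta> ?w b) (0, i, b)" for b
        unfolding W(2) e d1[OF w] by simp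
      then have "z = (\<lambda>b. \<sigma> i \<odot>\<^bsub>NS\<^esub> mapp NS \<Delta> ?w b)"
        by (simp add: inc_def fun_eq_iff)
      also have "\<dots> = mapp NS \<Delta> (\<lambda>b. \<sigma> i \<odot>\<^bsub>NS\<^esub> ?w b)"
        using module_homD(3)[OF \<Delta>hom \<sigma>_closed w, of i] by simp
      finally show "z \<in> ?H" using \<sigma>w[OF w] by blast
    qed
  next
    fix z assume "z \<in> carrier ((?C i)\<lparr>carrier := cycles ?C ?d i\<rparr>)"
    then have z: "z \<in> carrier (?C i)" and cyc: "\<And>j. i = Suc j \<Longrightarrow> mapp NS A z = (\<lambda>t. \<zero>\<^bsub>N\<^esub>)"
      by (auto simp: cycles_def)
    have "\<exists>h\<in>boundaries ?C ?d i. \<exists>z'\<in>Fil NS i 1. z = (\<lambda>t. h t \<oplus>\<^bsub>N\<^esub> z' t)"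
    proof (cases i)
      case 0
      have "(\<lambda>t. \<zero>\<^bsub>N\<^esub>) \<in> boundaries ?C ?d i"
        using subgroup.one_closed[OF submodule.axioms(1)[OF boundaries_submodule[OF total_complex, of i]]] by simp
      moreover have "z \<in> Fil NS i 1" by (rule Fil_top[OF z]) (simp add: 0)
      moreover have "z = (\<lambda>t. \<zero>\<^bsub>N\<^esub> \<oplus>\<^bsub>N\<^esub> z t)" using NS.fsupp_apply[OF z] NS.M.l_zero by simp
      ultimately show ?thesis by (intro bexI[of _ "\<lambda>t. \<zero>\<^bsub>N\<^esub>"] bexI[of _ z])
    next
      case (Suc j)
      have zc: "z \<in> vecs NS (D (Suc j))" using z Suc by simp
      have "(\<lambda>t. \<zero>\<^bsub>N\<^esub>) \<in> Fil NS j 0" using NS.M.zero_closed by (simp add: Fil_def fsupp_carrier)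
      then have "\<exists>V\<in>vecs NS (D (Suc (Suc j))). \<exists>z'\<in>Fil NS (Suc j) (Suc 0).
          z = (\<lambda>t. mapp NS A V t \<oplus>\<^bsub>N\<^esub> z' t)"
        using i Suc cyc[OF Suc] by (intro descend[OF Fil_top[OF zc order_refl]]) simp_all
      then show ?thesis unfolding Suc boundaries_def by auto
    qed
    then obtain h z' where h: "h \<in> boundaries ?C ?d i" and z': "z' \<in> Fil NS i 1" and zz: "z = (\<lambda>t. h t \<oplus>\<^bsub>N\<^esub> z' t)"
      by blast
    have "(\<lambda>b. z' (0, i, b)) \<in> vecs NS (B 0)" by (rule comp_closed[OF Fil_closed[OF z']]) simp
    moreover have "z = h \<oplus>\<^bsub>(?C i)\<lparr>carrier := cycles ?C ?d i\<rparr>\<^esub> inc NS 0 i (\<lambda>b. z' (0, i, b))"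
      using zz split0[OF z'] by simp
    ultimately show "\<exists>w\<in>vecs NS (B 0). \<exists>h\<in>boundaries ?C ?d i.
        z = h \<oplus>\<^bsub>(?C i)\<lparr>carrier := cycles ?C ?d i\<rparr>\<^esub> inc NS 0 i w"
      using h by blast
  qed
qed

end

end

section \<open>Tensor products over local rings\<close>

lemma (in local_ring) proper_ideal_subset_max_ideal:
  assumes I: "ideal I R" and 1: "\<one> \<notin> I"
  shows "I \<subseteq> max_ideal R"
proof -
  define \<A> where "\<A> = {J. ideal J R \<and> I \<subseteq> J \<and> \<one> \<notin> J}"
  have "\<exists>J\<in>\<A>. \<forall>X\<in>\<A>. J \<subseteq> X \<longrightarrow> X = J"
  proof (rule subset_Zorn_nonempty)
    show "\<A> \<noteq> {}" using I 1 by (auto simp: \<A>_def)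
    fix C assume C: "C \<noteq> {}" "subset.chain \<A> C"
    then have "C \<subseteq> \<A>" "subset.chain {J. ideal J R} C" by (auto simp: pred_on.chain_def \<A>_def)
    then show "\<Union>C \<in> \<A>" using chain_Union_is_ideal[of C] C(1) by (auto simp: \<A>_def)
  qed
  then obtain J where J: "ideal J R" "I \<subseteq> J" "\<one> \<notin> J" and max: "\<And>X. X \<in> \<A> \<Longrightarrow> J \<subseteq> X \<Longrightarrow> X = J"
    by (auto simp: \<A>_def)
  have "maximalideal J R"
  proof (rule maximalidealI[OF J(1)])
    show "carrier R \<noteq> J" using J(3) by blast
    fix X assume X: "ideal X R" "J \<subseteq> X" "X \<subseteq> carrier R"
    show "X = J \<or> X = carrier R"
    proof (cases "\<one> \<in> X")
      case True
      then show ?thesis using ideal.one_imp_carrier[OF X(1)] by blast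
    next
      case False
      then show ?thesis using max[of X] X J(2) by (auto simp: \<A>_def)
    qed
  qed
  moreover have "maximalideal (max_ideal R) R"
    unfolding max_ideal_def by (rule theI'[OF unique_maximal])
  ultimately have "J = max_ideal R" using unique_maximal by blast
  with J(2) show ?thesis by simp
qed

lemma (in cring) ideal_submodule_self:
  assumes I: "ideal I R" shows "submodule I R (self_module R)"
proof -
  interpret I: ideal I R by fact
  interpret S: module R "self_module R" by (rule self_module_module)
  have "\<ominus>\<^bsub>self_module R\<^esub> u = \<ominus> u" if "u \<in> carrier R" for u
    using that by (intro S.M.minus_equality) (auto simp: l_neg)
  then show ?thesis by (intro S.submoduleI) (auto simp: I.I_l_closed)
qed

lemma (in cring) submodule_self_ideal:
  assumes I: "submodule I R (self_module R)" shows "ideal I R"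
proof -
  interpret S: module R "self_module R" by (rule self_module_module)
  note E = S.submoduleE[OF I]
  have IR: "I \<subseteq> carrier R" using E(1) by simp
  show ?thesis
  proof (rule idealI[OF ring_axioms])
    have "\<ominus> a \<in> I" if "a \<in> I" for a using E(4)[of "\<ominus> \<one>" a] that IR by (auto simp: l_minus)
    then show "subgroup I (add_monoid R)" using E(2,5) IR by (intro add.subgroupI) auto
    show "r \<otimes> a \<in> I" if "a \<in> I" "r \<in> carrier R" for a r using E(4)[of r a] that by simp
    then show "a \<otimes> r \<in> I" if "a \<in> I" "r \<in> carrier R" for a r
      using that IR m_comm[of a r] by auto
  qed
qed

text \<open>
  Removing one element from a minimal finite set of generators leaves a proper submodule, and the
  quotient by it is cyclic and nonzero, hence of the form \<open>R / I\<close> with \<open>I\<close> proper. As \<open>\<mm>\<close> contains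
  all proper ideals, this maps onto \<open>R / \<mm>\<close>.
\<close>

lemma (in module) residue_surjection:
  assumes fg: "fin_gen_module R M" and nz: "\<not> zero_module M"
    and m: "ideal \<mm> R" and above: "\<And>I. ideal I R \<Longrightarrow> \<one> \<notin> I \<Longrightarrow> I \<subseteq> \<mm>"
  shows "\<exists>f\<in>module_hom R M (quot_module (self_module R) \<mm>).
    carrier (quot_module (self_module R) \<mm>) \<subseteq> f ` carrier M"
proof -
  interpret S: module R "self_module R" by (rule R.self_module_module)
  have ms: "submodule \<mm> R (self_module R)" by (rule R.ideal_submodule_self[OF m])
  define gen where "gen A \<longleftrightarrow> finite A \<and> A \<subseteq> carrier M \<and> submodule_gen R M A = carrier M" for A
  have "\<exists>A. gen A" using fg by (auto simp: fin_gen_module_def gen_def)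
  then obtain A where A: "gen A" and min: "\<And>A'. gen A' \<Longrightarrow> card A \<le> card A'"
    using ex_has_least_nat[of gen _ card] by blast
  have "A \<noteq> {}"
  proof
    assume "A = {}"
    then have "carrier M \<subseteq> {\<zero>\<^bsub>M\<^esub>}"
      using submodule_gen_least[where H = "{\<zero>\<^bsub>M\<^esub>}" and A = A and R = R and M = M] A
        submoduleI[of "{\<zero>\<^bsub>M\<^esub>}"] by (auto simp: gen_def)
    then show False using nz by (auto simp: zero_module_def)
  qed
  then obtain u0 where u0: "u0 \<in> A" by blast
  define L where "L = submodule_gen R M (A - {u0})"
  have AM: "A \<subseteq> carrier M" "finite A" and AL: "A - {u0} \<subseteq> L"
    using A submodule_gen_superset[of "A - {u0}" R M] by (auto simp: gen_def L_def)
  have L: "submodule L R M" unfolding L_def by (rule submodule_gen_submodule) (use AM in auto)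
  have u0M: "u0 \<in> carrier M" using u0 AM by blast
  have u0L: "u0 \<notin> L"
  proof
    assume "u0 \<in> L"
    then have "submodule_gen R M A \<subseteq> L" using AL by (intro submodule_gen_least[OF L]) auto
    then have "gen (A - {u0})" using A AM submoduleE(1)[OF L] by (auto simp: gen_def L_def)
    from min[OF this] show False using card_Diff1_less[OF AM(2) u0] by simp
  qed
  let ?Q = "quot_module M L" and ?q = "\<lambda>u. L +>\<^bsub>M\<^esub> u"
  interpret Q: module R ?Q by (rule quot_module_module[OF L])
  note q = quot_proj_hom[OF L]
  define h where "h r = ?q (r \<odot>\<^bsub>M\<^esub> u0)" for r
  have h: "h \<in> module_hom R (self_module R) ?Q"
    using module_hom_comp[OF smult_left_hom[OF u0M] q] by (simp add: h_def[abs_def])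
  define J where "J = h ` carrier R"
  have J: "submodule J R ?Q"
    using module_hom_image_submodule[OF S.module_axioms Q.module_axioms h] by (simp add: J_def)
  have "carrier ?Q \<subseteq> J"
  proof -
    define K where "K = a_kernel M (quot_module ?Q J) (\<lambda>u. J +>\<^bsub>?Q\<^esub> ?q u)"
    have K: "u \<in> K \<longleftrightarrow> u \<in> carrier M \<and> ?q u \<in> J" for u
      using Q.quot_eq_zero_iff[OF J module_homD(1)[OF q]] by (auto simp: K_def a_kernel_def')
    have "submodule K R M"
      unfolding K_def
      by (rule module.module_hom_kernel[OF Q.quot_module_module[OF J] module_axioms
          module_hom_comp[OF q Q.quot_proj_hom[OF J]]])
    moreover have "A \<subseteq> K"
    proof
      fix a assume a: "a \<in> A"
      then have aM: "a \<in> carrier M" using AM by blast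
      have "?q a = h (if a = u0 then \<one> else \<zero>)"
      proof (cases "a = u0")
        case False
        then have "?q a = \<zero>\<^bsub>?Q\<^esub>" using a AL quot_eq_zero_iff[OF L aM] by blast
        then show ?thesis using module_hom_zero[OF S.module_axioms Q.module_axioms h] False by simp
      qed (simp add: h_def u0M)
      then show "a \<in> K" using aM by (auto simp: K J_def)
    qed
    ultimately have "carrier M \<subseteq> K"
      using submodule_gen_least[where H = K and A = A and R = R and M = M] A by (auto simp: gen_def)
    then show ?thesis using K by (auto simp: quot_carrier)
  qed
  define I where "I = a_kernel (self_module R) ?Q h"
  have I: "submodule I R (self_module R)"
    unfolding I_def by (rule Q.module_hom_kernel[OF S.module_axioms h])
  have "\<one> \<notin> I" using u0L u0M quot_eq_zero_iff[OF L u0M] by (simp add: I_def a_kernel_def' h_def)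
  then have Im: "I \<subseteq> \<mm>" using above[OF R.submodule_self_ideal[OF I]] by blast
  have Imod: "module R (quot_module (self_module R) I)" by (rule S.quot_module_module[OF I])
  have "module_iso R (quot_module (self_module R) I) ?Q"
    by (rule first_isomorphism[OF S.module_axioms Q.module_axioms h I])
      (use \<open>carrier ?Q \<subseteq> J\<close> in \<open>auto simp: I_def a_kernel_def' J_def\<close>)
  then obtain g where g: "g \<in> module_hom R ?Q (quot_module (self_module R) I)"
    and gb: "bij_betw g (carrier ?Q) (carrier (quot_module (self_module R) I))"
    using module_iso_sym[OF Imod Q.module_axioms] unfolding module_iso_def by blast
  let ?W = "quot_module (self_module R) \<mm>"
  have "\<mm> +>\<^bsub>self_module R\<^esub> r = \<zero>\<^bsub>?W\<^esub>" if "r \<in> I" for r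
    using that Im S.submoduleE(1)[OF ms] S.quot_eq_zero_iff[OF ms, of r] by blast
  then obtain F where F: "F \<in> module_hom R (quot_module (self_module R) I) ?W"
    and FI: "\<And>r. r \<in> carrier (self_module R) \<Longrightarrow> F (I +>\<^bsub>self_module R\<^esub> r) = \<mm> +>\<^bsub>self_module R\<^esub> r"
    by (rule S.quot_lift[OF I S.quot_module_module[OF ms] S.quot_proj_hom[OF ms]]) auto
  show ?thesis
  proof (rule bexI[OF _ module_hom_comp[OF module_hom_comp[OF q g] F]])
    show "carrier ?W \<subseteq> (\<lambda>u. F (g (?q u))) ` carrier M"
    proof
      fix w assume "w \<in> carrier ?W"
      then obtain r where r: "r \<in> carrier (self_module R)" "w = F (I +>\<^bsub>self_module R\<^esub> r)"
        using FI by (auto simp: S.quot_carrier)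
      then have "I +>\<^bsub>self_module R\<^esub> r \<in> g ` ?q ` carrier M"
        using gb unfolding bij_betw_def quot_carrier[symmetric] by (auto simp: S.quot_carrier)
      with r(2) show "w \<in> (\<lambda>u. F (g (?q u))) ` carrier M" by auto
    qed
  qed
qed

text \<open>
  The product of two linear forms onto the residue field is a bilinear form that is not zero.
\<close>

lemma (in local_ring) tensor_nonzero:
  assumes M: "module R M" and N: "module R N"
    and fg: "fin_gen_module R M" "fin_gen_module R N" and nz: "\<not> zero_module M" "\<not> zero_module N"
  shows "\<not> zero_module (tensor R M N)"
proof
  assume z: "zero_module (tensor R M N)"
  interpret S: module R "self_module R" by (rule self_module_module)
  interpret T: two_modules R M N using M N by (simp add: two_modules_def)
  let ?m = "max_ideal R"
  let ?q = "\<lambda>r. ?m +>\<^bsub>self_module R\<^esub> r" and ?W = "quot_module (self_module R) ?m"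
  have max: "maximalideal ?m R" unfolding max_ideal_def by (rule theI'[OF unique_maximal])
  then have m: "ideal ?m R" by (rule maximalideal.axioms(1))
  have ms: "submodule ?m R (self_module R)" by (rule ideal_submodule_self[OF m])
  note q = module_homD[OF S.quot_proj_hom[OF ms]]
  interpret W: module R ?W by (rule S.quot_module_module[OF ms])
  obtain f where f: "f \<in> module_hom R M ?W" "carrier ?W \<subseteq> f ` carrier M"
    using module.residue_surjection[OF M fg(1) nz(1) m proper_ideal_subset_max_ideal] by blast
  obtain g where g: "g \<in> module_hom R N ?W" "carrier ?W \<subseteq> g ` carrier N"
    using module.residue_surjection[OF N fg(2) nz(2) m proper_ideal_subset_max_ideal] by blast
  have ex: "\<exists>r. r \<in> carrier R \<and> ?q r = w" if "w \<in> carrier ?W" for w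
    using that by (auto simp: S.quot_carrier)
  obtain \<rho> where \<rho>: "\<forall>u\<in>carrier M. \<rho> u \<in> carrier R \<and> ?q (\<rho> u) = f u"
    using bchoice[of "carrier M" "\<lambda>u r. r \<in> carrier R \<and> ?q r = f u"] ex module_homD(1)[OF f(1)] by blast
  obtain \<tau> where \<tau>: "\<forall>v\<in>carrier N. \<tau> v \<in> carrier R \<and> ?q (\<tau> v) = g v"
    using bchoice[of "carrier N" "\<lambda>v r. r \<in> carrier R \<and> ?q r = g v"] ex module_homD(1)[OF g(1)] by blast
  have sym: "\<tau> v \<odot>\<^bsub>?W\<^esub> f u = \<rho> u \<odot>\<^bsub>?W\<^esub> g v" if "u \<in> carrier M" "v \<in> carrier N" for u v
    using q(3)[of "\<tau> v" "\<rho> u"] q(3)[of "\<rho> u" "\<tau> v"] \<rho> \<tau> that m_comm[of "\<tau> v" "\<rho> u"] by simp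
  obtain G where G: "G \<in> module_hom R (tensor R M N) ?W"
    and Gp: "\<And>u v. u \<in> carrier M \<Longrightarrow> v \<in> carrier N \<Longrightarrow> G (pure_tensor R M N u v) = \<rho> u \<odot>\<^bsub>?W\<^esub> g v"
  proof (rule T.tensor_lift[OF W.module_axioms, of "\<lambda>u v. \<rho> u \<odot>\<^bsub>?W\<^esub> g v"])
    fix v assume v: "v \<in> carrier N"
    have "(\<lambda>u. \<tau> v \<odot>\<^bsub>?W\<^esub> f u) \<in> module_hom R M ?W"
      by (rule module_hom_comp[OF f(1) W.smult_hom]) (use \<tau> v in blast)
    then show "(\<lambda>u. \<rho> u \<odot>\<^bsub>?W\<^esub> g v) \<in> module_hom R M ?W"
      using sym[OF _ v] by (simp add: module_hom_def Pi_def T.M.M.a_closed T.M.smult_closed)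
  next
    fix u assume "u \<in> carrier M"
    then show "(\<lambda>v. \<rho> u \<odot>\<^bsub>?W\<^esub> g v) \<in> module_hom R N ?W"
      using \<rho> by (intro module_hom_comp[OF g(1) W.smult_hom]) blast
  qed blast
  have one: "?q \<one> \<in> carrier ?W" using q(1) by simp
  obtain u where u: "u \<in> carrier M" "f u = ?q \<one>" using one f(2) by auto
  obtain v where v: "v \<in> carrier N" "g v = ?q \<one>" using one g(2) by auto
  have "\<rho> u \<odot>\<^bsub>?W\<^esub> g v = ?q \<one>" using q(3)[of "\<rho> u" \<one>] \<rho> u v by simp
  moreover have "pure_tensor R M N u v = \<zero>\<^bsub>tensor R M N\<^esub>"
    using T.pure_closed[OF u(1) v(1)] z by (simp add: zero_module_def)
  ultimately have "?q \<one> = \<zero>\<^bsub>?W\<^esub>"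
    using Gp[OF u(1) v(1)] module_hom_zero[OF T.tensor_module W.module_axioms G] by simp
  then have "\<one> \<in> ?m" using S.quot_eq_zero_iff[OF ms, of \<one>] by simp
  then show False using ideal.one_imp_carrier[OF m] maximalideal.I_notcarr[OF max] by blast
qed

lemma (in cring) fin_gen_restrict_scalars:
  assumes \<phi>: "\<phi> \<in> ring_hom R R'" and sur: "carrier R' \<subseteq> \<phi> ` carrier R" and M: "module R' M"
    and fg: "fin_gen_module R' M"
  shows "fin_gen_module R (restrict_scalars \<phi> M)"
proof -
  interpret M: module R' M by fact
  interpret MS: module R "restrict_scalars \<phi> M" by (rule restrict_scalars_module[OF is_cring \<phi> M])
  have inv: "\<ominus>\<^bsub>restrict_scalars \<phi> M\<^esub> u = \<ominus>\<^bsub>M\<^esub> u" if "u \<in> carrier M" for u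
    using that by (intro MS.M.minus_equality) (auto simp: M.l_neg)
  have iff: "submodule H R (restrict_scalars \<phi> M) \<longleftrightarrow> submodule H R' M" for H
  proof
    assume H: "submodule H R (restrict_scalars \<phi> M)"
    note E = MS.submoduleE[OF H]
    have HM: "H \<subseteq> carrier M" using E(1) by simp
    show "submodule H R' M"
    proof (rule M.submoduleI[OF HM])
      show "\<zero>\<^bsub>M\<^esub> \<in> H" using subgroup.one_closed[OF submodule.axioms(1)[OF H]] by simp
      show "\<ominus>\<^bsub>M\<^esub> a \<in> H" if "a \<in> H" for a using E(3)[OF that] inv[of a] HM that by auto
      show "a \<oplus>\<^bsub>M\<^esub> b \<in> H" if "a \<in> H" "b \<in> H" for a b using E(5)[OF that] by simp
      show "r \<odot>\<^bsub>M\<^esub> u \<in> H" if "r \<in> carrier R'" "u \<in> H" for r u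
      proof -
        obtain s where "s \<in> carrier R" "r = \<phi> s" using sur \<open>r \<in> carrier R'\<close> by blast
        then show ?thesis using E(4)[of s u] \<open>u \<in> H\<close> by (simp add: restrict_scalars_smult)
      qed
    qed
  next
    assume H: "submodule H R' M"
    note E = M.submoduleE[OF H]
    show "submodule H R (restrict_scalars \<phi> M)"
    proof (rule MS.submoduleI)
      show "H \<subseteq> carrier (restrict_scalars \<phi> M)" using E(1) by simp
      show "\<zero>\<^bsub>restrict_scalars \<phi> M\<^esub> \<in> H" using subgroup.one_closed[OF submodule.axioms(1)[OF H]] by simp
      show "\<ominus>\<^bsub>restrict_scalars \<phi> M\<^esub> a \<in> H" if "a \<in> H" for a using E(3)[OF that] inv[of a] E(1) that by auto
      show "a \<oplus>\<^bsub>restrict_scalars \<phi> M\<^esub> b \<in> H" if "a \<in> H" "b \<in> H" for a b using E(5)[OF that] by simp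
      show "r \<odot>\<^bsub>restrict_scalars \<phi> M\<^esub> u \<in> H" if "r \<in> carrier R" "u \<in> H" for r u
        using E(4) that ring_hom_closed[OF \<phi>] by (simp add: restrict_scalars_smult)
    qed
  qed
  then have "submodule_gen R (restrict_scalars \<phi> M) A = submodule_gen R' M A" for A
    by (simp add: submodule_gen_def)
  with fg show ?thesis by (simp add: fin_gen_module_def)
qed

section \<open>Vanishing of Tor modulo an exact zero-divisor\<close>

text \<open>
  The cokernel in \<open>homology_iso_cokernel\<close> is the same for all degrees, so the homology in degree \<open>i\<close>
  is isomorphic to that in degree \<open>0\<close>, which is the tensor product.
\<close>

lemma (in lifted_resolution) homology_iso_tensor:
  assumes N: "module R N" and yN: "\<And>v. v \<in> carrier N \<Longrightarrow> \<pi> y \<odot>\<^bsub>N\<^esub> v = \<zero>\<^bsub>N\<^esub>"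
    and vanish: "\<And>i. 1 \<le> i \<Longrightarrow> i \<le> n \<Longrightarrow>
      coeff_cycles N B \<delta> i \<subseteq> coeff_boundaries N B \<delta> i"
    and i: "i < n"
  shows "module_iso S (Tor S (restrict_scalars \<pi> M) (restrict_scalars \<pi> N) i)
    (tensor S (restrict_scalars \<pi> M) (restrict_scalars \<pi> N))"
proof -
  let ?M = "restrict_scalars \<pi> M" and ?N = "restrict_scalars \<pi> N"
  have Mm: "module S ?M" and Nm: "module S ?N" by (rule restrict_module[OF P.module_axioms], rule restrict_module[OF N])
  interpret NS: module S ?N by (rule Nm)
  obtain A where good: "\<And>m. good m A" using matrix_exists by blast
  interpret Q: free_resolution S ?M "syz_basis S ?M" "syz_mat S" "syz_gen ?M" by (rule module.syz_free_resolution[OF Mm])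
  interpret T: free_resolution S ?M D A "\<lambda>(p, q, b). a b" by (rule total_free_resolution[OF good])
  interpret QT: two_resolutions S ?M "syz_basis S ?M" "syz_mat S" "syz_gen ?M" D A "\<lambda>(p, q, b). a b"
    by unfold_locales
  let ?H = "coeff_homology ?N D A"
  let ?K = "quot_module (fsupp ?N (B 0)) (mapp ?N \<Delta> ` vecs ?N (B (Suc 0)))"
  have K: "module S ?K"
    by (rule module.quot_module_module[OF NS.fsupp_module
        module_hom_image_submodule[OF NS.fsupp_module NS.fsupp_module NS.mapp_hom[OF \<Delta>_mat]]])
  have H: "module S (?H j)" for j by (rule homology_module[OF T.coeff_complex[OF Nm]])
  have KH: "module_iso S ?K (?H j)" if "j < n" for j
    by (rule homology_iso_cokernel[where n = n, OF N yN good vanish that])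
  have "module_iso S (Tor S ?M ?N i) (syz_homology S ?M ?N i)"
    by (rule module_iso_sym[OF syz_homology_module[OF Mm Nm] Tor_module[OF Mm Nm] Tor_iso[OF Mm Nm]])
  from module_iso_trans[OF this QT.homology_iso[OF Nm]] have "module_iso S (Tor S ?M ?N i) (?H i)" .
  from module_iso_trans[OF this module_iso_sym[OF K H KH[OF i]]] have "module_iso S (Tor S ?M ?N i) ?K" .
  moreover have "module_iso S ?K (?H 0)" by (rule KH) (use i in simp)
  ultimately have "module_iso S (Tor S ?M ?N i) (?H 0)" by (rule module_iso_trans)
  from module_iso_trans[OF this T.homology_zero_iso_tensor[OF Nm]] show ?thesis .
qed

lemma quotient_lifted_resolution:
  assumes S: "cring S" and xy: "exact_zero_divisors S x y"
    and P: "free_resolution (S Quot (PIdl\<^bsub>S\<^esub> x)) M B \<delta> a"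
  shows "lifted_resolution S (S Quot (PIdl\<^bsub>S\<^esub> x)) M B \<delta> a (\<lambda>s. PIdl\<^bsub>S\<^esub> x +>\<^bsub>S\<^esub> s) x y"
proof -
  interpret S: cring S by fact
  have x: "x \<in> carrier S" and y: "y \<in> carrier S"
    and annx: "ann S x = PIdl\<^bsub>S\<^esub> y" and anny: "ann S y = PIdl\<^bsub>S\<^esub> x"
    using xy by (auto simp: exact_zero_divisors_def)
  interpret I: ideal "PIdl\<^bsub>S\<^esub> x" S by (rule S.cgenideal_ideal[OF x])
  have mem: "s \<in> PIdl\<^bsub>S\<^esub> c \<longleftrightarrow> (\<exists>t\<in>carrier S. s = c \<otimes>\<^bsub>S\<^esub> t)" if "c \<in> carrier S" for s c
  proof -
    have "s \<in> PIdl\<^bsub>S\<^esub> c \<longleftrightarrow> (\<exists>t\<in>carrier S. s = t \<otimes>\<^bsub>S\<^esub> c)" unfolding cgenideal_def by blast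
    also have "\<dots> \<longleftrightarrow> (\<exists>t\<in>carrier S. s = c \<otimes>\<^bsub>S\<^esub> t)" by (rule bex_cong) (simp_all only: S.m_comm[OF _ that])
    finally show ?thesis .
  qed
  have ker: "PIdl\<^bsub>S\<^esub> x +>\<^bsub>S\<^esub> s = \<zero>\<^bsub>S Quot (PIdl\<^bsub>S\<^esub> x)\<^esub> \<longleftrightarrow> s \<in> PIdl\<^bsub>S\<^esub> x" if "s \<in> carrier S" for s
    using I.rcos_const_imp_mem[OF that] I.a_rcos_const by (auto simp: FactRing_def)
  have annD: "c \<otimes>\<^bsub>S\<^esub> s = \<zero>\<^bsub>S\<^esub> \<longleftrightarrow> s \<in> ann S c" if "c \<in> carrier S" "s \<in> carrier S" for c s
    unfolding ann_def using that S.m_comm[OF that] by simp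
  show ?thesis
  proof (intro lifted_resolution.intro lifted_resolution_axioms.intro S P x y)
    show "(\<lambda>s. PIdl\<^bsub>S\<^esub> x +>\<^bsub>S\<^esub> s) \<in> ring_hom S (S Quot (PIdl\<^bsub>S\<^esub> x))" by (rule I.rcos_ring_hom)
    show "carrier (S Quot (PIdl\<^bsub>S\<^esub> x)) \<subseteq> (\<lambda>s. PIdl\<^bsub>S\<^esub> x +>\<^bsub>S\<^esub> s) ` carrier S"
      by (auto simp: FactRing_def A_RCOSETS_def')
    fix s assume s: "s \<in> carrier S"
    show "(PIdl\<^bsub>S\<^esub> x +>\<^bsub>S\<^esub> s = \<zero>\<^bsub>S Quot (PIdl\<^bsub>S\<^esub> x)\<^esub>) = (\<exists>t\<in>carrier S. s = x \<otimes>\<^bsub>S\<^esub> t)"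
      by (simp only: ker[OF s] mem[OF x])
    show "(x \<otimes>\<^bsub>S\<^esub> s = \<zero>\<^bsub>S\<^esub>) = (\<exists>t\<in>carrier S. s = y \<otimes>\<^bsub>S\<^esub> t)"
      by (simp only: annD[OF x s] annx mem[OF y])
    show "(y \<otimes>\<^bsub>S\<^esub> s = \<zero>\<^bsub>S\<^esub>) = (\<exists>t\<in>carrier S. s = x \<otimes>\<^bsub>S\<^esub> t)"
      by (simp only: annD[OF y s] anny mem[OF x])
  qed
qed

theorem corollary2p2:
  fixes S :: "('s, 'k) ring_scheme" and x y :: 's
    and R :: "'s set ring"
    and M :: "('s set, 'm, 'p) module_scheme" and N :: "('s set, 'n, 'q) module_scheme"
    and n :: nat
  defines "R \<equiv> S Quot (PIdl\<^bsub>S\<^esub> x)"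
    and "M\<^sub>S \<equiv> restrict_scalars (\<lambda>s. PIdl\<^bsub>S\<^esub> x +>\<^bsub>S\<^esub> s) M"
    and "N\<^sub>S \<equiv> restrict_scalars (\<lambda>s. PIdl\<^bsub>S\<^esub> x +>\<^bsub>S\<^esub> s) N"
  assumes "local_ring S"
    and "exact_zero_divisors S x y"
    and "module R M" and "module R N"
    and "\<forall>v\<in>carrier N. y \<odot>\<^bsub>N\<^sub>S\<^esub> v = \<zero>\<^bsub>N\<^sub>S\<^esub>"
    and "n \<ge> 2"
    and "\<forall>i. 1 \<le> i \<and> i \<le> n \<longrightarrow> zero_module (Tor R M N i)"
  shows "(\<forall>i. i \<le> n - 1 \<longrightarrow> module_iso S (Tor S M\<^sub>S N\<^sub>S i) (tensor S M\<^sub>S N\<^sub>S)) \<and>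
    (\<not> zero_module M \<and> \<not> zero_module N \<and> fin_gen_module R M \<and> fin_gen_module R N \<longrightarrow>
      (\<forall>i. i \<le> n - 1 \<longrightarrow> \<not> zero_module (Tor S M\<^sub>S N\<^sub>S i)))"
proof -
  let ?\<pi> = "\<lambda>s. PIdl\<^bsub>S\<^esub> x +>\<^bsub>S\<^esub> s"
  interpret S: local_ring S by fact
  interpret M: module R M by fact
  interpret N: module R N by fact
  interpret P: free_resolution R M "syz_basis R M" "syz_mat R" "syz_gen M" by (rule M.syz_free_resolution)
  interpret L: lifted_resolution S R M "syz_basis R M" "syz_mat R" "syz_gen M" ?\<pi> x y
    unfolding R_def
    by (rule quotient_lifted_resolution[OF S.is_cring assms(5) P.free_resolution_axioms[unfolded R_def]])
  have MS: "module S M\<^sub>S" and NS: "module S N\<^sub>S"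
    unfolding M\<^sub>S_def N\<^sub>S_def by (rule L.restrict_module, fact)+
  have yN: "?\<pi> y \<odot>\<^bsub>N\<^esub> v = \<zero>\<^bsub>N\<^esub>" if "v \<in> carrier N" for v
    using assms(8) that by (simp add: N\<^sub>S_def restrict_scalars_smult)
  have vanish: "coeff_cycles N (syz_basis R M) (syz_mat R) i
      \<subseteq> coeff_boundaries N (syz_basis R M) (syz_mat R) i"
    if "1 \<le> i" "i \<le> n" for i
  proof -
    have "zero_module (syz_homology R M N i)"
      using zero_module_iso[OF syz_homology_module[OF assms(6,7)] Tor_module[OF assms(6,7)]
          Tor_iso[OF assms(6,7)], of i] assms(10) that by simp
    then show ?thesis using zero_homology_iff[OF P.coeff_complex[OF assms(7)]] by simp
  qed
  have iso: "module_iso S (Tor S M\<^sub>S N\<^sub>S i) (tensor S M\<^sub>S N\<^sub>S)" if "i \<le> n - 1" for i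
    unfolding M\<^sub>S_def N\<^sub>S_def
    by (rule L.homology_iso_tensor[where n = n, OF assms(7) yN vanish]) (use that \<open>n \<ge> 2\<close> in auto)
  moreover have "\<not> zero_module (Tor S M\<^sub>S N\<^sub>S i)"
    if nz: "\<not> zero_module M" "\<not> zero_module N" and fg: "fin_gen_module R M" "fin_gen_module R N"
      and i: "i \<le> n - 1" for i
  proof -
    have "fin_gen_module S M\<^sub>S" "fin_gen_module S N\<^sub>S"
      unfolding M\<^sub>S_def N\<^sub>S_def
      using S.fin_gen_restrict_scalars[OF L.proj_hom L.proj_surj] assms(6,7) fg by blast+
    moreover have "\<not> zero_module M\<^sub>S" "\<not> zero_module N\<^sub>S"
      using nz by (simp_all add: zero_module_def M\<^sub>S_def N\<^sub>S_def)
    ultimately have "\<not> zero_module (tensor S M\<^sub>S N\<^sub>S)" by (intro S.tensor_nonzero[OF MS NS])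
    moreover have "module S (tensor S M\<^sub>S N\<^sub>S)"
      by (rule two_modules.tensor_module) (simp add: two_modules_def MS NS)
    ultimately show ?thesis
      using zero_module_iso[OF Tor_module[OF MS NS] _ iso[OF i]] by blast
  qed
  ultimately show ?thesis by blast
qed

end
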